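(* Let $\Omega=(0,1)$ and consider the system $$\partial_t x^\alpha(z,t)=f^\alpha\big(z,t,x(z,t),\partial_z x(z,t),\partial_z^2x(z,t),u(t)\big),\quad \alpha=1,\dots,n_x,$$ on $\Omega$, with boundary conditions $$g^\lambda(t,x(0,t),\partial_z x(0,t))=0,\ \lambda=1,\dots,n_A,\qquad h^\mu(t,x(1,t),\partial_z x(1,t))=0,\ \mu=1,\dots,n_B,$$ and output $y(t)=c(t,x(z_0,t),\partial_zx(z_0,t))$ at a fixed point $z_0\in\bar\Omega$, where $f^\alpha,g^\lambda,h^\mu,c$ are smooth. Let $\mathcal{E}$, $J^2(\mathcal{E})$, $\mathcal{S}^2$, $\mathcal{B}_A,\mathcal{B}_B$, $\mathcal{S}^1_A,\mathcal{S}^1_B$, the prolongations $j^1(v),j^2(v)$, the standing assumptions and the notion of observability be as given in the context. If there exists a smooth vector field $$v=v_x^\alpha(z,t,x,u)\,\partial_{x^\alpha}$$ on $\mathcal{E}$ with 1. $\partial_u v_x^\alpha|_{t=0}=0$ for $\alpha=1,\dots,n_x$, and 2. $v|_{t=0}\neq 0$, that satisfies 3. $L_{j^2(v)}\big(x_t^\alpha-f^\alpha(z,t,x,x_z,x_{zz},u)\big)=0$ on the submanifold $\mathcal{S}^2\subset J^2(\mathcal{E})$, for $\alpha=1,\dots,n_x$, 4. $L_{j^1(v)}g^\lambda(t,x,x_z)|_{z=0}=0$ on $\mathcal{S}^1_A\subset\mathcal{B}_A$ for $\lambda=1,\dots,n_A$, and $L_{j^1(v)}h^\mu(t,x,x_z)|_{z=1}=0$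 on $\mathcal{S}^1_B\subset\mathcal{B}_B$ for $\mu=1,\dots,n_B$, and 5. $L_{j^1(v)}c(t,x,x_z)|_{z=z_0}=0$, then the system is not observable.
   Context: All functions, vector fields, etc. are assumed smooth, and all considerations are only local. The Einstein summation convention is used; $L_w\varphi$ is the Lie derivative of the function $\varphi$ along the vector field $w$. $\bar\Omega=[0,1]$ is the closure of $\Omega$, and $\mathbb{R}^+$ is the time axis, starting at $t=0$. Bundle: $(\mathcal{E},\pi,\bar\Omega\times\mathbb{R}^+)$, where $\mathcal{E}$ is a $(3+n_x)$-dimensional manifold with coordinates $(z,t,x,u)$, $x=(x^1,\dots,x^{n_x})$, and $\pi(z,t,x,u)=(z,t)$. The jet manifold $J^1(\mathcal{E})$ has coordinates $(z,t,x,u,x_z,x_t,u_z,u_t)$, and $J^2(\mathcal{E})$ has in addition $(x_{zz},x_{zt},x_{tt},u_{zz},u_{zt},u_{tt})$. $\mathcal{S}^2\subset J^2(\mathcal{E})$ is given by $x_t^\alpha-f^\alpha(z,t,x,x_z,x_{zz},u)=0$ ($\alpha=1,\dots,n_x$), $u_z=0$, $u_{zz}=0$, $u_{zt}=0$ (the input depends only on $t$). The Jacobian of these $n_x+3$ functions is assumed to have maximal rank on $\mathcal{S}^2$, so $\mathcal{S}^2$ is a regular submanifold. $\mathcal{B}_A$ and $\mathcal{B}_B$ are manifolds with coordinates $(t,x,u,x_z,x_t,u_z,u_t)$ (the coordinates of $J^1(\mathcal{E})$ without $z$, corresponding to $z=0$ and $z=1$). $\mathcal{S}^1_A=\{g^\lambda(t,x,x_z)=0,\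 \lambda=1,\dots,n_A\}\subset\mathcal{B}_A$ and $\mathcal{S}^1_B=\{h^\mu(t,x,x_z)=0,\ \mu=1,\dots,n_B\}\subset\mathcal{B}_B$. The Jacobians of $(g^\lambda)$ and $(h^\mu)$ are assumed to have maximal ranks $n_A$ and $n_B$, so these are regular submanifolds. Solution: a smooth section $\gamma:\bar\Omega\times\mathbb{R}^+\to\mathcal{E}$, $(z,t)\mapsto(z,t,\gamma_x(z,t),\gamma_u(z,t))$, whose prolongation $j^2(\gamma)$ (obtained by adding all partial derivatives of $\gamma_x,\gamma_u$ with respect to $z,t$ up to order 2) maps $\Omega\times\mathbb{R}^+$ into $\mathcal{S}^2$, and such that $g^\lambda(t,x,x_z)\circ j^1(\gamma)|_{z=0}=0$ and $h^\mu(t,x,x_z)\circ j^1(\gamma)|_{z=1}=0$ for all $t\in\mathbb{R}^+$. Its input is $\gamma_u$ (independent of $z$), its initial condition is $\gamma_x(\cdot,0)$, and its output is $t\mapsto c(t,x,x_z)\circ j^1(\gamma)|_{z=z_0}$. Total derivatives: $d_z=\partial_z+x_z^\alpha\partial_{x^\alpha}+u_z\partial_u+x_{zz}^\alpha\partial_{x_z^\alpha}+x_{zt}^\alpha\partial_{x_t^\alpha}+u_{zz}\partial_{u_z}+u_{zt}\partial_{u_t}$, $d_t=\partial_t+x_t^\alpha\partial_{x^\alpha}+u_t\partial_u+x_{zt}^\alpha\partial_{x_z^\alpha}+x_{tt}^\alpha\partial_{x_t^\alpha}+u_{zt}\partial_{u_z}+u_{tt}\partial_{u_t}$, with $d_{zz}=d_z\circ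 d_z$, $d_{zt}=d_t\circ d_z$, $d_{tt}=d_t\circ d_t$. For $v=v_x^\alpha\partial_{x^\alpha}$ the prolongations are $j^1(v)=v_x^\alpha\partial_{x^\alpha}+d_z(v_x^\alpha)\partial_{x_z^\alpha}+d_t(v_x^\alpha)\partial_{x_t^\alpha}$ and $j^2(v)=j^1(v)+d_{zz}(v_x^\alpha)\partial_{x_{zz}^\alpha}+d_{zt}(v_x^\alpha)\partial_{x_{zt}^\alpha}+d_{tt}(v_x^\alpha)\partial_{x_{tt}^\alpha}$. Standing assumption (well-posedness): solutions of the PDEs with the boundary conditions exist and are uniquely determined by the initial condition $x(\cdot,0)$ and the input function $u(t)$. Observability: a pair of initial conditions is indistinguishable if for every admissible trajectory of the input, the system generates for both initial conditions the same trajectory of the output. The system is observable if (locally) there exists no pair of indistinguishable initial conditions. *)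

theory Defs
  imports "HOL-Analysis.Analysis"
begin

section \<open>Smooth functions\<close>

text \<open>\<open>Ck_on k W F\<close> is meant for open \<open>W\<close>; on other sets smoothness means existence of a smooth
  extension to an open neighbourhood.  All non-open sets below have the form
  ``relatively open subset of a product of intervals and vector spaces'', where derivatives
  relative to the set (\<open>at p within S\<close>) are unique and agree with those of any extension.\<close>

primrec Ck_on :: "nat \<Rightarrow> 'a::euclidean_space set \<Rightarrow> ('a \<Rightarrow> 'b::real_normed_vector) \<Rightarrow> bool" where
  "Ck_on 0 W F \<longleftrightarrow> continuous_on W F"
| "Ck_on (Suc k) W F \<longleftrightarrow>
     (\<forall>p\<in>W. F differentiable (at p)) \<and>
     (\<forall>w. Ck_on k W (\<lambda>p. frechet_derivative F (at p) w))"

definition smooth_on :: "'a::euclidean_space set \<Rightarrow> ('a \<Rightarrow> 'b::real_normed_vector) \<Rightarrow> bool" where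
  "smooth_on S \<phi> \<longleftrightarrow>
     (\<exists>W F. open W \<and> S \<subseteq> W \<and> (\<forall>k. Ck_on k W F) \<and> (\<forall>p\<in>S. F p = \<phi> p))"

text \<open>Lie derivative of a function along a vector field \<open>w\<close> on \<open>S\<close>.\<close>

definition lie :: "'a::euclidean_space set \<Rightarrow> ('a \<Rightarrow> 'a) \<Rightarrow> ('a \<Rightarrow> real) \<Rightarrow> 'a \<Rightarrow> real" where
  "lie S w \<phi> p = frechet_derivative \<phi> (at p within S) (w p)"

definition gradient :: "'a::euclidean_space set \<Rightarrow> ('a \<Rightarrow> real) \<Rightarrow> 'a \<Rightarrow> 'a" where
  "gradient S \<phi> p = (\<Sum>b\<in>Basis. frechet_derivative \<phi> (at p within S) b *\<^sub>R b)"

text \<open>Row rank of the Jacobian of a family of functions.\<close>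

definition jacobian_rank :: "'a::euclidean_space set \<Rightarrow> ('a \<Rightarrow> real) set \<Rightarrow> 'a \<Rightarrow> nat" where
  "jacobian_rank S \<Phi> p = dim ((\<lambda>\<phi>. gradient S \<phi> p) ` \<Phi>)"

section \<open>The system and its jet manifolds\<close>

text \<open>Coordinates:
  \<^item> total space: \<open>(z, t, x, u)\<close>;
  \<^item> boundary manifolds (first jets without \<open>z\<close>): \<open>(t, x, u, x_z, x_t, u_z, u_t)\<close>;
  \<^item> first jets: \<open>(z, b)\<close> with \<open>b\<close> as above;
  \<^item> second jets: \<open>(p, q)\<close> with a first jet \<open>p\<close> and \<open>q = (x_zz, x_zt, x_tt, u_zz, u_zt, u_tt)\<close>.\<close>

type_synonym 'n pt = "real \<times> real \<times> (real^'n) \<times> real"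
type_synonym 'n bjet = "real \<times> (real^'n) \<times> real \<times> (real^'n) \<times> (real^'n) \<times> real \<times> real"
type_synonym 'n jet1 = "real \<times> 'n bjet"
type_synonym 'n jet2 =
  "'n jet1 \<times> (real^'n) \<times> (real^'n) \<times> (real^'n) \<times> real \<times> real \<times> real"

text \<open>The total space is a relatively open part of
  \<open>[0,1] \<times> [0,\<infinity>) \<times> \<real>\<^sup>n \<times> \<real>\<close>.  The boundary conditions are \<open>bcA l\<close> with
  \<open>l = 1, \<dots>, nA\<close> and \<open>bcB m\<close> with \<open>m = 1, \<dots>, nB\<close>; here \<open>nA = 0\<close> or \<open>nB = 0\<close> is allowed.\<close>

record ('n::finite) pde_sys =
  total_space :: "'n pt set"
  rhs :: "real \<times> real \<times> (real^'n) \<times> (real^'n) \<times> (real^'n) \<times> real \<Rightarrow> real^'n"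
  nA :: nat
  bcA :: "nat \<Rightarrow> real \<times> (real^'n) \<times> (real^'n) \<Rightarrow> real"
  nB :: nat
  bcB :: "nat \<Rightarrow> real \<times> (real^'n) \<times> (real^'n) \<Rightarrow> real"
  out_fun :: "real \<times> (real^'n) \<times> (real^'n) \<Rightarrow> real"
  z_out :: real

definition J1 :: "('n::finite) pde_sys \<Rightarrow> 'n jet1 set" where
  "J1 P = {(z, t, x, u, xz, xt, uz, ut). (z, t, x, u) \<in> total_space P}"

definition J2 :: "('n::finite) pde_sys \<Rightarrow> 'n jet2 set" where
  "J2 P = {(p, q). p \<in> J1 P}"

text \<open>First jets over a fixed \<open>z\<close>; \<open>bjets P 0\<close> and \<open>bjets P 1\<close> are the boundary manifolds.\<close>

definition bjets :: "('n::finite) pde_sys \<Rightarrow> real \<Rightarrow> 'n bjet set" where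
  "bjets P z = {b. (z, b) \<in> J1 P}"

definition on_bjet :: "(real \<times> (real^'n) \<times> (real^'n) \<Rightarrow> real) \<Rightarrow> ('n::finite) bjet \<Rightarrow> real" where
  "on_bjet \<phi> = (\<lambda>(t, x, u, xz, xt, uz, ut). \<phi> (t, x, xz))"

definition pde_fun :: "('n::finite) pde_sys \<Rightarrow> 'n \<Rightarrow> 'n jet2 \<Rightarrow> real" where
  "pde_fun P \<alpha> = (\<lambda>((z, t, x, u, xz, xt, uz, ut), (xzz, xzt, xtt, uzz, uzt, utt)).
     xt $ \<alpha> - rhs P (z, t, x, xz, xzz, u) $ \<alpha>)"

definition S2_funs :: "('n::finite) pde_sys \<Rightarrow> ('n jet2 \<Rightarrow> real) set" where
  "S2_funs P = range (pde_fun P) \<union>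
     {\<lambda>((z, t, x, u, xz, xt, uz, ut), (xzz, xzt, xtt, uzz, uzt, utt)). uz,
      \<lambda>((z, t, x, u, xz, xt, uz, ut), (xzz, xzt, xtt, uzz, uzt, utt)). uzz,
      \<lambda>((z, t, x, u, xz, xt, uz, ut), (xzz, xzt, xtt, uzz, uzt, utt)). uzt}"

definition S2 :: "('n::finite) pde_sys \<Rightarrow> 'n jet2 set" where
  "S2 P = {p \<in> J2 P. \<forall>\<phi>\<in>S2_funs P. \<phi> p = 0}"

definition S1A :: "('n::finite) pde_sys \<Rightarrow> 'n bjet set" where
  "S1A P = {b \<in> bjets P 0. \<forall>l\<in>{1..nA P}. on_bjet (bcA P l) b = 0}"

definition S1B :: "('n::finite) pde_sys \<Rightarrow> 'n bjet set" where
  "S1B P = {b \<in> bjets P 1. \<forall>m\<in>{1..nB P}. on_bjet (bcB P m) b = 0}"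

text \<open>In the slice \<open>t = 0\<close> the coordinate domain is required to be a product of a part for the
  state and an interval for the input, so that the initial condition and the input can be
  prescribed independently of each other.\<close>

definition is_bundle :: "('n::finite) pde_sys \<Rightarrow> bool" where
  "is_bundle P \<longleftrightarrow>
     openin (top_of_set ({0..1} \<times> {0..} \<times> UNIV \<times> UNIV)) (total_space P) \<and>
     (\<lambda>(z, t, x, u). (z, t)) ` total_space P = {0..1} \<times> {0..} \<and>
     (\<exists>D I. is_interval I \<and> (\<forall>z x u. (z, 0, x, u) \<in> total_space P \<longleftrightarrow> (z, x) \<in> D \<and> u \<in> I))"

definition regular_system :: "('n::finite) pde_sys \<Rightarrow> bool" where
  "regular_system P \<longleftrightarrow>
     is_bundle P \<and> z_out P \<in> {0..1} \<and>
     smooth_on {(z, t, x, xz, xzz, u). (z, t, x, u) \<in> total_space P} (rhs P) \<and>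
     (\<forall>l\<in>{1..nA P}. smooth_on {(t, x, xz). \<exists>u. (0, t, x, u) \<in> total_space P} (bcA P l)) \<and>
     (\<forall>m\<in>{1..nB P}. smooth_on {(t, x, xz). \<exists>u. (1, t, x, u) \<in> total_space P} (bcB P m)) \<and>
     smooth_on {(t, x, xz). \<exists>u. (z_out P, t, x, u) \<in> total_space P} (out_fun P) \<and>
     (\<forall>p\<in>S2 P. jacobian_rank (J2 P) (S2_funs P) p = CARD('n) + 3) \<and>
     (\<forall>b\<in>S1A P. jacobian_rank (bjets P 0) ((\<lambda>l. on_bjet (bcA P l)) ` {1..nA P}) b = nA P) \<and>
     (\<forall>b\<in>S1B P. jacobian_rank (bjets P 1) ((\<lambda>m. on_bjet (bcB P m)) ` {1..nB P}) b = nB P)"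

section \<open>Total derivatives and prolongation of vertical vector fields\<close>

text \<open>The total derivatives \<open>d_z\<close>, \<open>d_t\<close> raise the jet order by one.  They are given separately for
  functions on the total space (suffix 0) and for functions on first jets (suffix 1); the sum of
  partial derivatives with jet coordinates as coefficients is written as the derivative in the
  corresponding direction.\<close>

definition dz0 :: "('n::finite) pde_sys \<Rightarrow> ('n pt \<Rightarrow> 'b::real_normed_vector) \<Rightarrow> 'n jet1 \<Rightarrow> 'b" where
  "dz0 P \<phi> = (\<lambda>(z, t, x, u, xz, xt, uz, ut).
     frechet_derivative \<phi> (at (z, t, x, u) within total_space P) (1, 0, xz, uz))"

definition dt0 :: "('n::finite) pde_sys \<Rightarrow> ('n pt \<Rightarrow> 'b::real_normed_vector) \<Rightarrow> 'n jet1 \<Rightarrow> 'b" where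
  "dt0 P \<phi> = (\<lambda>(z, t, x, u, xz, xt, uz, ut).
     frechet_derivative \<phi> (at (z, t, x, u) within total_space P) (0, 1, xt, ut))"

definition dz1 :: "('n::finite) pde_sys \<Rightarrow> ('n jet1 \<Rightarrow> 'b::real_normed_vector) \<Rightarrow> 'n jet2 \<Rightarrow> 'b" where
  "dz1 P \<phi> = (\<lambda>((z, t, x, u, xz, xt, uz, ut), (xzz, xzt, xtt, uzz, uzt, utt)).
     frechet_derivative \<phi> (at (z, t, x, u, xz, xt, uz, ut) within J1 P)
       (1, 0, xz, uz, xzz, xzt, uzz, uzt))"

definition dt1 :: "('n::finite) pde_sys \<Rightarrow> ('n jet1 \<Rightarrow> 'b::real_normed_vector) \<Rightarrow> 'n jet2 \<Rightarrow> 'b" where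
  "dt1 P \<phi> = (\<lambda>((z, t, x, u, xz, xt, uz, ut), (xzz, xzt, xtt, uzz, uzt, utt)).
     frechet_derivative \<phi> (at (z, t, x, u, xz, xt, uz, ut) within J1 P)
       (0, 1, xt, ut, xzt, xtt, uzt, utt))"

text \<open>A vertical vector field \<open>v_x \<partial>\<^sub>x\<close> is represented by its coefficient function.\<close>

definition j1 :: "('n::finite) pde_sys \<Rightarrow> ('n pt \<Rightarrow> real^'n) \<Rightarrow> 'n jet1 \<Rightarrow> 'n jet1" where
  "j1 P v = (\<lambda>(z, t, x, u, xz, xt, uz, ut).
     let p = (z, t, x, u, xz, xt, uz, ut)
     in (0, 0, v (z, t, x, u), 0, dz0 P v p, dt0 P v p, 0, 0))"

definition j2 :: "('n::finite) pde_sys \<Rightarrow> ('n pt \<Rightarrow> real^'n) \<Rightarrow> 'n jet2 \<Rightarrow> 'n jet2" where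
  "j2 P v = (\<lambda>(p, q).
     (j1 P v p, (dz1 P (dz0 P v) (p, q), dt1 P (dz0 P v) (p, q), dt1 P (dt0 P v) (p, q), 0, 0, 0)))"

text \<open>The first prolongation at a fixed \<open>z\<close>.  Its \<open>\<partial>\<^sub>z\<close>-component vanishes, so it is a vector field
  on the manifold \<open>bjets P z\<close>.\<close>

definition j1_at :: "('n::finite) pde_sys \<Rightarrow> ('n pt \<Rightarrow> real^'n) \<Rightarrow> real \<Rightarrow> 'n bjet \<Rightarrow> 'n bjet" where
  "j1_at P v z b = snd (j1 P v (z, b))"

section \<open>Solutions\<close>

text \<open>Solutions on \<open>[0,1] \<times> J\<close>, where \<open>J\<close> is \<open>{0..}\<close> or \<open>{0..<T}\<close>.\<close>

definition pd_z :: "(real \<times> real) set \<Rightarrow> (real \<times> real \<Rightarrow> 'b::real_normed_vector) \<Rightarrow> real \<times> real \<Rightarrow> 'b" where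
  "pd_z M \<phi> p = frechet_derivative \<phi> (at p within M) (1, 0)"

definition pd_t :: "(real \<times> real) set \<Rightarrow> (real \<times> real \<Rightarrow> 'b::real_normed_vector) \<Rightarrow> real \<times> real \<Rightarrow> 'b" where
  "pd_t M \<phi> p = frechet_derivative \<phi> (at p within M) (0, 1)"

definition sec_j1 ::
  "(real \<times> real) set \<Rightarrow> (real \<times> real \<Rightarrow> real^('n::finite)) \<Rightarrow> (real \<times> real \<Rightarrow> real) \<Rightarrow> real \<times> real \<Rightarrow> 'n jet1" where
  "sec_j1 M \<gamma>x \<gamma>u p =
     (fst p, snd p, \<gamma>x p, \<gamma>u p, pd_z M \<gamma>x p, pd_t M \<gamma>x p, pd_z M \<gamma>u p, pd_t M \<gamma>u p)"

definition sec_j2 ::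
  "(real \<times> real) set \<Rightarrow> (real \<times> real \<Rightarrow> real^('n::finite)) \<Rightarrow> (real \<times> real \<Rightarrow> real) \<Rightarrow> real \<times> real \<Rightarrow> 'n jet2" where
  "sec_j2 M \<gamma>x \<gamma>u p =
     (sec_j1 M \<gamma>x \<gamma>u p,
      (pd_z M (pd_z M \<gamma>x) p, pd_t M (pd_z M \<gamma>x) p, pd_t M (pd_t M \<gamma>x) p,
       pd_z M (pd_z M \<gamma>u) p, pd_t M (pd_z M \<gamma>u) p, pd_t M (pd_t M \<gamma>u) p))"

definition is_solution ::
  "('n::finite) pde_sys \<Rightarrow> real set \<Rightarrow> (real \<times> real \<Rightarrow> real^'n) \<Rightarrow> (real \<times> real \<Rightarrow> real) \<Rightarrow> bool" where
  "is_solution P J \<gamma>x \<gamma>u \<longleftrightarrow>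
     smooth_on ({0..1} \<times> J) \<gamma>x \<and> smooth_on ({0..1} \<times> J) \<gamma>u \<and>
     (\<forall>z\<in>{0..1}. \<forall>t\<in>J. (z, t, \<gamma>x (z, t), \<gamma>u (z, t)) \<in> total_space P) \<and>
     (\<forall>z\<in>{0<..<1}. \<forall>t\<in>J. sec_j2 ({0..1} \<times> J) \<gamma>x \<gamma>u (z, t) \<in> S2 P) \<and>
     (\<forall>t\<in>J. \<forall>l\<in>{1..nA P}. on_bjet (bcA P l) (snd (sec_j1 ({0..1} \<times> J) \<gamma>x \<gamma>u (0, t))) = 0) \<and>
     (\<forall>t\<in>J. \<forall>m\<in>{1..nB P}. on_bjet (bcB P m) (snd (sec_j1 ({0..1} \<times> J) \<gamma>x \<gamma>u (1, t))) = 0)"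

definition has_data ::
  "real set \<Rightarrow> (real \<times> real \<Rightarrow> real^('n::finite)) \<Rightarrow> (real \<times> real \<Rightarrow> real) \<Rightarrow> (real \<Rightarrow> real^'n) \<Rightarrow> (real \<Rightarrow> real) \<Rightarrow> bool" where
  "has_data J \<gamma>x \<gamma>u \<xi> u \<longleftrightarrow>
     (\<forall>z\<in>{0..1}. \<gamma>x (z, 0) = \<xi> z) \<and> (\<forall>z\<in>{0..1}. \<forall>t\<in>J. \<gamma>u (z, t) = u t)"

definition output_of ::
  "('n::finite) pde_sys \<Rightarrow> (real \<times> real \<Rightarrow> real^'n) \<Rightarrow> (real \<times> real \<Rightarrow> real) \<Rightarrow> real \<Rightarrow> real" where
  "output_of P \<gamma>x \<gamma>u t = on_bjet (out_fun P) (snd (sec_j1 ({0..1} \<times> {0..}) \<gamma>x \<gamma>u (z_out P, t)))"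

section \<open>Well-posedness and observability\<close>

text \<open>\<open>U\<close> is the set of admissible input trajectories.  A smooth \<open>\<xi>\<close> is an initial condition of the
  system if it is compatible with the equations and the boundary conditions, i.e. if for every
  admissible input there is a solution at least for a short time.  (An arbitrary profile
  \<open>\<xi>\<close> violates the corner compatibility conditions at \<open>t = 0\<close> and admits no smooth solution.)\<close>

definition initial_conditions :: "('n::finite) pde_sys \<Rightarrow> (real \<Rightarrow> real) set \<Rightarrow> (real \<Rightarrow> real^'n) set" where
  "initial_conditions P U =
     {\<xi>. smooth_on {0..1} \<xi> \<and>
         (\<forall>u\<in>U. \<exists>T>0. \<exists>\<gamma>x \<gamma>u. is_solution P {0..<T} \<gamma>x \<gamma>u \<and> has_data {0..<T} \<gamma>x \<gamma>u \<xi> u)}"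

text \<open>Existence of a solution on the whole time axis, uniqueness on every time interval, and
  existence of sufficiently many initial conditions: the state at an interior point
  \<open>0 < z < 1\<close> can initially have any value.\<close>

definition well_posed :: "('n::finite) pde_sys \<Rightarrow> (real \<Rightarrow> real) set \<Rightarrow> bool" where
  "well_posed P U \<longleftrightarrow>
     U \<noteq> {} \<and> (\<forall>u\<in>U. smooth_on {0..} u) \<and>
     (\<forall>\<xi>\<in>initial_conditions P U. \<forall>u\<in>U.
        \<exists>\<gamma>x \<gamma>u. is_solution P {0..} \<gamma>x \<gamma>u \<and> has_data {0..} \<gamma>x \<gamma>u \<xi> u) \<and>
     (\<forall>\<xi>\<in>initial_conditions P U. \<forall>u\<in>U. \<forall>T>0. \<forall>\<gamma>x \<gamma>u \<eta>x \<eta>u.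
        is_solution P {0..<T} \<gamma>x \<gamma>u \<and> has_data {0..<T} \<gamma>x \<gamma>u \<xi> u \<and>
        is_solution P {0..<T} \<eta>x \<eta>u \<and> has_data {0..<T} \<eta>x \<eta>u \<xi> u
        \<longrightarrow> (\<forall>p\<in>{0..1} \<times> {0..<T}. \<gamma>x p = \<eta>x p)) \<and>
     (\<forall>z\<in>{0<..<1}. \<forall>x u. (z, 0, x, u) \<in> total_space P \<longrightarrow> (\<exists>\<xi>\<in>initial_conditions P U. \<xi> z = x))"

definition indistinguishable ::
  "('n::finite) pde_sys \<Rightarrow> (real \<Rightarrow> real) set \<Rightarrow> (real \<Rightarrow> real^'n) \<Rightarrow> (real \<Rightarrow> real^'n) \<Rightarrow> bool" where
  "indistinguishable P U \<xi> \<eta> \<longleftrightarrow>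
     (\<forall>u\<in>U. \<forall>\<gamma>x \<gamma>u \<eta>x \<eta>u.
        is_solution P {0..} \<gamma>x \<gamma>u \<and> has_data {0..} \<gamma>x \<gamma>u \<xi> u \<and>
        is_solution P {0..} \<eta>x \<eta>u \<and> has_data {0..} \<eta>x \<eta>u \<eta> u
        \<longrightarrow> (\<forall>t\<ge>0. output_of P \<gamma>x \<gamma>u t = output_of P \<eta>x \<eta>u t))"

text \<open>Basic neighbourhoods for smooth functions on \<open>[0,1]\<close> (the smooth topology):
  derivatives up to order \<open>k\<close> differ by less than \<open>\<delta>\<close>.\<close>

definition Ck_close :: "nat \<Rightarrow> real \<Rightarrow> (real \<Rightarrow> 'b::real_normed_vector) \<Rightarrow> (real \<Rightarrow> 'b) \<Rightarrow> bool" where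
  "Ck_close k \<delta> \<xi> \<eta> \<longleftrightarrow>
     (let D = (\<lambda>\<phi> z. vector_derivative \<phi> (at z within {0..1}))
      in \<forall>j\<le>k. \<forall>z\<in>{0..1}. norm ((D ^^ j) \<xi> z - (D ^^ j) \<eta> z) < \<delta>)"

text \<open>Local observability: every initial condition has a neighbourhood in which no other initial
  condition is indistinguishable from it.  This is the weakest local notion (it is implied by the
  absence of indistinguishable pairs altogether, or in some neighbourhood for a coarser topology),
  hence its negation is the strongest.\<close>

definition observable :: "('n::finite) pde_sys \<Rightarrow> (real \<Rightarrow> real) set \<Rightarrow> bool" where
  "observable P U \<longleftrightarrow>
     (\<forall>\<xi>\<in>initial_conditions P U. \<exists>k. \<exists>\<delta>>0.
        \<not> (\<exists>\<eta>\<in>initial_conditions P U.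
              Ck_close k \<delta> \<xi> \<eta> \<and> (\<exists>z\<in>{0..1}. \<xi> z \<noteq> \<eta> z) \<and> indistinguishable P U \<xi> \<eta>))"

end

theory Submission
  imports Defs
begin

text \<open>The flow of \<open>v\<close> maps solutions to solutions with the same input and the same output, and at \<open>t = 0\<close> it does
  not depend on the input.  Applied to one initial condition it thus produces a curve \<open>\<Xi> s\<close> of initial
  conditions, which is not constant because \<open>v \<noteq> 0\<close> at \<open>t = 0\<close>.  For a fixed \<open>s\<close> the flow need not exist along a
  whole trajectory.  But the solutions starting at \<open>\<Xi> s\<close> do, by well-posedness, and on every bounded time
  interval the flow for sufficiently short parameter times exists near such a solution; by uniqueness it carries
  the solution for \<open>\<Xi> s\<close> to the one for \<open>\<Xi> (s + r)\<close> when \<open>r\<close> is small.  So the output at each time is locally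
  constant in \<open>s\<close>, hence constant.\<close>

section \<open>Calculus of \<open>C\<^sup>k\<close> functions\<close>

text \<open>The invariance conditions on \<open>v\<close> hold only on the submanifolds, so
  invariance of their equations under the flow has to be proved. For the PDE, the defect
  \<open>x_t - f\<close> of the transformed section obeys a linear ODE in the flow parameter. The
  boundary functions are not solved for a jet coordinate; there the maximal rank is used to bound
  the distance to the zero set. That the flow moves the derivatives of a section by the
  prolongations of \<open>v\<close> is the commutation of mixed derivatives. The sections live on
  sets with corners, so all of this is done for smooth extensions to open sets, and derivatives
  relative to a set are translated into ordinary ones. The flow must be smooth jointly in parameter
  and point and have a uniform lifetime near a compact set; the section on differential equations
  provides this. Two forms of locality remain: the size of a flow box depends on the input, the time
  horizon and the profile, so statements along the curve of initial conditions pass from a point to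
  its neighbours by connectedness; and observability is local in the smooth topology, so the curve
  has to converge with all derivatives.\<close>

abbreviation D :: "('a::euclidean_space \<Rightarrow> 'b::real_normed_vector) \<Rightarrow> 'a \<Rightarrow> 'a \<Rightarrow> 'b" where
  "D F p \<equiv> frechet_derivative F (at p)"

lemma has_derivative_D: "F differentiable at p \<Longrightarrow> (F has_derivative D F p) (at p)"
  by (simp add: frechet_derivative_works)

lemma D_eqI: "(F has_derivative F') (at p) \<Longrightarrow> D F p = F'"
  by (metis frechet_derivative_at)

lemma D_cong_open:
  assumes "open W" "p \<in> W" "\<And>q. q \<in> W \<Longrightarrow> F q = G q" "F differentiable at p"
  shows "(G has_derivative D F p) (at p)" "G differentiable at p" "D G p = D F p"
proof -
  show *: "(G has_derivative D F p) (at p)"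
    using has_derivative_transform_within_open[OF has_derivative_D[OF assms(4)] assms(1,2)] assms(3) by simp
  show "G differentiable at p" using * by (rule differentiableI)
  show "D G p = D F p" using * by (rule D_eqI)
qed

lemma Ck_on_cong:
  assumes "open W" "\<And>p. p \<in> W \<Longrightarrow> F p = G p" "Ck_on k W F"
  shows "Ck_on k W G"
  using assms(2,3)
proof (induction k arbitrary: F G)
  case 0 then show ?case using continuous_on_cong by (metis Ck_on.simps(1))
next
  case (Suc k)
  have "D G p w = D F p w" if "p \<in> W" for p w
    using D_cong_open(3)[OF assms(1) that, of F G] Suc.prems that by auto
  then have "Ck_on k W (\<lambda>p. D G p w)" for w
    using Suc.IH[of "\<lambda>p. D F p w" "\<lambda>p. D G p w"] Suc.prems by auto
  moreover have "G differentiable at p" if "p \<in> W" for p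
    using D_cong_open(2)[OF assms(1) that, of F G] Suc.prems that by auto
  ultimately show ?case by simp
qed

lemma Ck_on_subset: "Ck_on k W F \<Longrightarrow> W' \<subseteq> W \<Longrightarrow> Ck_on k W' F"
  by (induction k arbitrary: F) (auto intro: continuous_on_subset)

lemma Ck_on_imp_continuous_on: "Ck_on k W F \<Longrightarrow> continuous_on W F"
  by (cases k) (auto intro!: differentiable_imp_continuous_on differentiable_at_imp_differentiable_on)

lemma Ck_on_SucD: "Ck_on (Suc k) W F \<Longrightarrow> Ck_on k W F"
proof (induction k arbitrary: F)
  case 0 then show ?case using Ck_on_imp_continuous_on by (metis Ck_on.simps(1))
next
  case (Suc k) then show ?case by (metis Ck_on.simps(2))
qed

lemma Ck_on_le: "Ck_on m W F \<Longrightarrow> k \<le> m \<Longrightarrow> Ck_on k W F"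
proof (induction m)
  case (Suc m) then show ?case using Ck_on_SucD le_Suc_eq by blast
qed simp

text \<open>The derivative may be supplied in any explicit form \<open>F'\<close>, so the calculus
  rules below follow by induction once their derivative formula has the same shape as the
  function.\<close>

lemma Ck_on_SucI:
  assumes "open W" "\<And>p. p \<in> W \<Longrightarrow> (F has_derivative F' p) (at p)" "\<And>w. Ck_on k W (\<lambda>p. F' p w)"
  shows "Ck_on (Suc k) W F"
proof -
  have "Ck_on k W (\<lambda>p. D F p w)" for w
    by (rule Ck_on_cong[OF assms(1) _ assms(3)[of w]]) (metis D_eqI assms(2))
  then show ?thesis using assms(2) by (auto intro: differentiableI)
qed

lemma Ck_on_has_derivative: "Ck_on (Suc k) W F \<Longrightarrow> p \<in> W \<Longrightarrow> (F has_derivative D F p) (at p)"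
  by (simp add: has_derivative_D)

lemma Ck_on_D: "Ck_on (Suc k) W F \<Longrightarrow> Ck_on k W (\<lambda>p. D F p w)"
  by simp

declare Ck_on.simps(2) [simp del]

lemma Ck_on_const: "open W \<Longrightarrow> Ck_on k W (\<lambda>p. c)"
proof (induction k arbitrary: c)
  case (Suc k) then show ?case by (intro Ck_on_SucI[where F' = "\<lambda>p w. 0"]) auto
qed simp

lemma Ck_on_bounded_linear_id: "open W \<Longrightarrow> bounded_linear L \<Longrightarrow> Ck_on k W L"
proof (cases k)
  case (Suc m)
  show "open W \<Longrightarrow> bounded_linear L \<Longrightarrow> ?thesis" unfolding Suc
    by (rule Ck_on_SucI[where F' = "\<lambda>p. L"]) (auto intro: bounded_linear_imp_has_derivative Ck_on_const)
qed (simp add: linear_continuous_on)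

lemma Ck_on_bounded_linear:
  assumes "open W" "bounded_linear L" "Ck_on k W F"
  shows "Ck_on k W (\<lambda>p. L (F p))"
  using assms(3)
proof (induction k arbitrary: F)
  case 0 then show ?case
    using assms by (auto intro: bounded_linear.continuous_on)
next
  case (Suc k)
  show ?case
  proof (rule Ck_on_SucI[OF assms(1)])
    show "((\<lambda>p. L (F p)) has_derivative (\<lambda>w. L (D F p w))) (at p)" if "p \<in> W" for p
      by (rule bounded_linear.has_derivative[OF assms(2) Ck_on_has_derivative[OF Suc.prems that]])
    show "Ck_on k W (\<lambda>p. L (D F p w))" for w
      by (rule Suc.IH[OF Ck_on_D[OF Suc.prems]])
  qed
qed

lemma Ck_on_add:
  assumes "open W" "Ck_on k W F" "Ck_on k W G"
  shows "Ck_on k W (\<lambda>p. F p + G p)"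
  using assms(2,3)
proof (induction k arbitrary: F G)
  case 0 then show ?case by (auto intro: continuous_intros)
next
  case (Suc k)
  show ?case
  proof (rule Ck_on_SucI[OF assms(1)])
    show "((\<lambda>p. F p + G p) has_derivative (\<lambda>w. D F p w + D G p w)) (at p)" if "p \<in> W" for p
      using Suc.prems by (intro has_derivative_add Ck_on_has_derivative[OF _ that])
    show "Ck_on k W (\<lambda>p. D F p w + D G p w)" for w
      by (rule Suc.IH[OF Ck_on_D Ck_on_D]) (rule Suc.prems)+
  qed
qed

lemma Ck_on_sum:
  assumes "open W" "\<And>i. i \<in> I \<Longrightarrow> Ck_on k W (F i)"
  shows "Ck_on k W (\<lambda>p. \<Sum>i\<in>I. F i p)"
  using assms(2) by (induction I rule: infinite_finite_induct) (simp_all add: Ck_on_const Ck_on_add assms(1))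

lemma Ck_on_scaleR:
  fixes f :: "'a::euclidean_space \<Rightarrow> real"
  assumes "open W" "Ck_on k W f" "Ck_on k W G"
  shows "Ck_on k W (\<lambda>p. f p *\<^sub>R G p)"
  using assms(2,3)
proof (induction k arbitrary: f G)
  case 0 then show ?case by (auto intro: continuous_intros)
next
  case (Suc k)
  show ?case
  proof (rule Ck_on_SucI[OF assms(1)])
    show "((\<lambda>p. f p *\<^sub>R G p) has_derivative (\<lambda>w. f p *\<^sub>R D G p w + D f p w *\<^sub>R G p)) (at p)" if "p \<in> W" for p
      using Suc.prems by (intro has_derivative_scaleR Ck_on_has_derivative[OF _ that])
    show "Ck_on k W (\<lambda>p. f p *\<^sub>R D G p w + D f p w *\<^sub>R G p)" for w
      by (rule Ck_on_add[OF assms(1)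
            Suc.IH[OF Ck_on_SucD[OF Suc.prems(1)] Ck_on_D[OF Suc.prems(2)]]
            Suc.IH[OF Ck_on_D[OF Suc.prems(1)] Ck_on_SucD[OF Suc.prems(2)]]])
  qed
qed

text \<open>\<open>Ck_on\<close> only speaks of derivatives in fixed directions. Expanding in
  \<open>Basis\<close> reduces a derivative in a moving direction to fixed ones with scalar
  coefficients.\<close>

lemma linear_Basis_sum:
  fixes L :: "'a::euclidean_space \<Rightarrow> 'b::real_normed_vector"
  assumes "linear L"
  shows "L w = (\<Sum>b\<in>Basis. (w \<bullet> b) *\<^sub>R L b)"
proof -
  have "L w = L (\<Sum>b\<in>Basis. (w \<bullet> b) *\<^sub>R b)" by (simp add: euclidean_representation)
  also have "\<dots> = (\<Sum>b\<in>Basis. (w \<bullet> b) *\<^sub>R L b)"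
    by (simp add: linear_sum[OF assms] linear_scale[OF assms])
  finally show ?thesis .
qed

lemma Ck_on_linear_D: "Ck_on (Suc k) W F \<Longrightarrow> p \<in> W \<Longrightarrow> linear (D F p)"
  by (meson Ck_on_has_derivative has_derivative_linear)

text \<open>In the chain rule the direction \<open>D F p w\<close> moves with \<open>p\<close>;
  after expansion in \<open>Basis\<close> the induction hypothesis applies to each
  \<open>D G\<close> in a fixed direction, and the product rule does the rest.\<close>

lemma Ck_on_compose:
  fixes G :: "'b::euclidean_space \<Rightarrow> 'c::real_normed_vector"
  assumes "open W" "open W'" "Ck_on k W F" "Ck_on k W' G" "\<And>p. p \<in> W \<Longrightarrow> F p \<in> W'"
  shows "Ck_on k W (\<lambda>p. G (F p))"
  using assms(3-5)
proof (induction k arbitrary: F G)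
  case 0 then show ?case
    by (auto intro: continuous_on_compose2)
next
  case (Suc k)
  have 1: "((\<lambda>p. G (F p)) has_derivative (\<lambda>w. \<Sum>b\<in>Basis. (D F p w \<bullet> b) *\<^sub>R D G (F p) b)) (at p)"
    if p: "p \<in> W" for p
  proof -
    have "((\<lambda>p. G (F p)) has_derivative (\<lambda>w. D G (F p) (D F p w))) (at p)"
      using has_derivative_compose[OF Ck_on_has_derivative[OF Suc.prems(1) p]
          Ck_on_has_derivative[OF Suc.prems(2) Suc.prems(3)[OF p]]] by simp
    moreover have "(\<lambda>w. D G (F p) (D F p w)) = (\<lambda>w. \<Sum>b\<in>Basis. (D F p w \<bullet> b) *\<^sub>R D G (F p) b)"
      by (rule ext, rule linear_Basis_sum, rule Ck_on_linear_D[OF Suc.prems(2) Suc.prems(3)[OF p]])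
    ultimately show ?thesis by simp
  qed
  show ?case
  proof (rule Ck_on_SucI[OF assms(1) 1])
    fix w
    have "Ck_on k W (\<lambda>p. D G (F p) b)" for b
      by (rule Suc.IH[OF Ck_on_SucD[OF Suc.prems(1)] Ck_on_D[OF Suc.prems(2)] Suc.prems(3)])
    moreover have "Ck_on k W (\<lambda>p. D F p w \<bullet> b)" for b
      using Ck_on_bounded_linear[OF assms(1) bounded_linear_inner_left[of b] Ck_on_D[OF Suc.prems(1)]] .
    ultimately show "Ck_on k W (\<lambda>p. \<Sum>b\<in>Basis. (D F p w \<bullet> b) *\<^sub>R D G (F p) b)"
      by (intro Ck_on_sum Ck_on_scaleR assms(1))
  qed
qed

lemma Ck_on_Pair:
  assumes "open W" "Ck_on k W F" "Ck_on k W G"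
  shows "Ck_on k W (\<lambda>p. (F p, G p))"
proof -
  have "Ck_on k W (\<lambda>p. (F p, 0) + (0, G p))"
    by (intro Ck_on_add Ck_on_bounded_linear[OF assms(1) _ assms(2), of "\<lambda>x. (x, 0)"]
        Ck_on_bounded_linear[OF assms(1) _ assms(3), of "\<lambda>x. (0, x)"] assms(1))
      (auto intro!: bounded_linear_Pair bounded_linear_ident bounded_linear_zero)
  then show ?thesis by simp
qed

lemma Ck_on_fst: "open W \<Longrightarrow> Ck_on k W F \<Longrightarrow> Ck_on k W (\<lambda>p. fst (F p))"
  by (rule Ck_on_bounded_linear[OF _ bounded_linear_fst])

lemma Ck_on_snd: "open W \<Longrightarrow> Ck_on k W F \<Longrightarrow> Ck_on k W (\<lambda>p. snd (F p))"
  by (rule Ck_on_bounded_linear[OF _ bounded_linear_snd])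

lemma Ck_on_ident: "open W \<Longrightarrow> Ck_on k W (\<lambda>p. p)"
  by (rule Ck_on_bounded_linear_id[OF _ bounded_linear_ident])

lemma Ck_on_D_apply:
  assumes "open W" "open W'" "Ck_on (Suc k) W' F" "Ck_on k W G" "Ck_on k W H" "\<And>p. p \<in> W \<Longrightarrow> G p \<in> W'"
  shows "Ck_on k W (\<lambda>p. D F (G p) (H p))"
proof -
  have 1: "Ck_on k W (\<lambda>p. D F (G p) b)" for b
    by (rule Ck_on_compose[OF assms(1,2,4) Ck_on_D[OF assms(3)]]) (rule assms(6))
  have 2: "Ck_on k W (\<lambda>p. H p \<bullet> b)" for b
    by (rule Ck_on_bounded_linear[OF assms(1) bounded_linear_inner_left assms(5)])
  have 3: "Ck_on k W (\<lambda>p. \<Sum>b\<in>Basis. (H p \<bullet> b) *\<^sub>R D F (G p) b)"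
    by (rule Ck_on_sum[OF assms(1) Ck_on_scaleR[OF assms(1) 2 1]])
  show ?thesis
    by (rule Ck_on_cong[OF assms(1) _ 3])
      (rule linear_Basis_sum[symmetric], rule Ck_on_linear_D[OF assms(3) assms(6)])
qed

lemma Ck_on_Union:
  assumes "\<And>i. i \<in> I \<Longrightarrow> open (A i)" "\<And>i. i \<in> I \<Longrightarrow> Ck_on k (A i) F"
  shows "Ck_on k (\<Union>i\<in>I. A i) F"
  using assms(2)
proof (induction k arbitrary: F)
  case 0 then show ?case using assms(1) by (auto intro: continuous_on_open_UN)
next
  case (Suc k) then show ?case by (auto simp: Ck_on.simps(2))
qed

section \<open>Uniform differentiability on compact sets\<close>

lemma compact_neighbourhood:
  fixes K :: "'a::euclidean_space set"
  assumes "compact K" "open W" "K \<subseteq> W"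
  obtains r K' where "r > 0" "compact K'" "K' \<subseteq> W" "\<And>q x. q \<in> K \<Longrightarrow> dist q x \<le> r \<Longrightarrow> x \<in> K'"
proof -
  obtain e where e: "e > 0" "(\<Union>x\<in>K. cball x e) \<subseteq> W"
    using compact_subset_open_imp_cball_epsilon_subset[OF assms] by blast
  let ?K' = "{x + y |x y. x \<in> K \<and> y \<in> cball 0 e}"
  have 1: "compact ?K'" using compact_sums[OF assms(1) compact_cball] .
  have "x + y \<in> W" if "x \<in> K" "norm y \<le> e" for x y
    using e(2) that by (force simp: dist_norm)
  then have 2: "?K' \<subseteq> W" by auto
  have 3: "x \<in> ?K'" if "q \<in> K" "dist q x \<le> e" for q x
  proof -
    have "x = q + (x - q)" "x - q \<in> cball 0 e" using that by (auto simp: dist_norm norm_minus_commute)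
    then show ?thesis using that(1) by blast
  qed
  show ?thesis by (rule that[OF e(1) 1 2 3])
qed

text \<open>Only \<open>q\<close> lies in \<open>K\<close>; \<open>x\<close> may be any nearby
  point. This one-sided form follows from uniform continuity on a slightly larger compact
  set.\<close>

lemma uniform_continuity_compact:
  fixes K :: "'a::euclidean_space set" and f :: "'a \<Rightarrow> 'b::real_normed_vector"
  assumes "compact K" "open W" "K \<subseteq> W" "continuous_on W f" "\<epsilon> > 0"
  obtains d where "d > 0" "\<And>q x. q \<in> K \<Longrightarrow> norm (x - q) < d \<Longrightarrow> x \<in> W \<and> norm (f x - f q) < \<epsilon>"
proof -
  obtain r K' where K': "r > 0" "compact K'" "K' \<subseteq> W" "\<And>q x. q \<in> K \<Longrightarrow> dist q x \<le> r \<Longrightarrow> x \<in> K'"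
    using compact_neighbourhood[OF assms(1-3)] by blast
  have "uniformly_continuous_on K' f"
    using K' assms(4) compact_uniformly_continuous continuous_on_subset by blast
  then obtain d where d: "d > 0" "\<And>x x'. x \<in> K' \<Longrightarrow> x' \<in> K' \<Longrightarrow> dist x' x < d \<Longrightarrow> dist (f x') (f x) < \<epsilon>"
    using assms(5) unfolding uniformly_continuous_on_def by metis
  show ?thesis
  proof (rule that[of "min d r"])
    fix q x assume q: "q \<in> K" and x: "norm (x - q) < min d r"
    then have "x \<in> K'" "q \<in> K'" using K'(4)[of q x] K'(4)[of q q] K'(1) by (auto simp: dist_norm norm_minus_commute)
    then show "x \<in> W \<and> norm (f x - f q) < \<epsilon>" using d(2)[of q x] x K'(3) by (auto simp: dist_norm)
  qed (use d K' in auto)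
qed

lemma norm_linear_le_Basis:
  fixes L :: "'a::euclidean_space \<Rightarrow> 'b::real_normed_vector"
  assumes "linear L" "\<And>b. b \<in> Basis \<Longrightarrow> norm (L b) \<le> B"
  shows "norm (L w) \<le> real DIM('a) * B * norm w"
proof -
  have "norm (L w) \<le> (\<Sum>b\<in>(Basis::'a set). norm ((w \<bullet> b) *\<^sub>R L b))"
    by (subst linear_Basis_sum[OF assms(1)]) (rule norm_sum)
  also have "\<dots> \<le> (\<Sum>b\<in>(Basis::'a set). norm w * B)"
    by (rule sum_mono) (auto intro!: mult_mono assms(2) simp: Basis_le_norm)
  finally show ?thesis by (simp add: mult_ac)
qed

lemma uniform_D_continuity:
  fixes F :: "'a::euclidean_space \<Rightarrow> 'b::real_normed_vector"
  assumes "compact K" "open W" "K \<subseteq> W" "Ck_on (Suc k) W F" "\<epsilon> > 0"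
  obtains d where "d > 0"
    "\<And>q x w. q \<in> K \<Longrightarrow> norm (x - q) < d \<Longrightarrow> x \<in> W \<and> norm (D F x w - D F q w) \<le> \<epsilon> * norm w"
proof -
  \<comment> \<open>Control on the basis vectors costs a factor \<open>DIM('a)\<close> when passed
    to an arbitrary direction.\<close>
  define e where "e = \<epsilon> / real DIM('a)"
  have e: "e > 0" unfolding e_def using assms(5) by simp
  have "\<exists>d>0. \<forall>q x. q \<in> K \<longrightarrow> norm (x - q) < d \<longrightarrow> x \<in> W \<and> norm (D F x b - D F q b) < e" for b
    using uniform_continuity_compact[OF assms(1-3) _ e, of "\<lambda>x. D F x b"]
      Ck_on_imp_continuous_on[OF Ck_on_D[OF assms(4)]] by metis
  then obtain d where d: "\<And>b. d b > 0" "\<And>b q x. q \<in> K \<Longrightarrow> norm (x - q) < d b \<Longrightarrow> x \<in> W \<and> norm (D F x b - D F q b) < e"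
    by metis
  show ?thesis
  proof (rule that[of "Min (d ` Basis)"])
    show "Min (d ` Basis) > 0" using d(1) by simp
    fix q x and w :: 'a assume q: "q \<in> K" and x: "norm (x - q) < Min (d ` Basis)"
    have *: "norm (x - q) < d b" if "b \<in> Basis" for b using x that by simp
    have xW: "x \<in> W" using d(2)[OF q *] nonempty_Basis by blast
    have lin: "linear (\<lambda>w. D F x w - D F q w)"
      using Ck_on_linear_D[OF assms(4)] xW q assms(3) by (intro linear_compose_sub) auto
    have "norm (D F x w - D F q w) \<le> real DIM('a) * e * norm w"
      using norm_linear_le_Basis[OF lin, of e w] d(2)[OF q *] by fastforce
    then show "x \<in> W \<and> norm (D F x w - D F q w) \<le> \<epsilon> * norm w" using xW unfolding e_def by simp
  qed
qed

lemma bounded_D_compact: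
  fixes F :: "'a::euclidean_space \<Rightarrow> 'b::real_normed_vector"
  assumes "compact K" "K \<subseteq> W" "Ck_on (Suc k) W F"
  obtains B where "B > 0" "\<And>q w. q \<in> K \<Longrightarrow> norm (D F q w) \<le> B * norm w"
proof -
  have "\<exists>B. \<forall>q\<in>K. norm (D F q b) \<le> B" for b
  proof -
    have "compact ((\<lambda>q. D F q b) ` K)"
      by (rule compact_continuous_image[OF continuous_on_subset[OF Ck_on_imp_continuous_on[OF Ck_on_D[OF assms(3)]] assms(2)] assms(1)])
    then have "bounded ((\<lambda>q. D F q b) ` K)" by (rule compact_imp_bounded)
    then show ?thesis unfolding bounded_iff by auto
  qed
  then obtain B where B: "\<And>b q. q \<in> K \<Longrightarrow> norm (D F q b) \<le> B b" by metis
  define C where "C = \<bar>Max (B ` Basis)\<bar> + 1"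
  have C: "B b \<le> C" if "b \<in> Basis" for b
  proof -
    have "B b \<le> Max (B ` Basis)" using that by simp
    then show ?thesis unfolding C_def by linarith
  qed
  have "C > 0" unfolding C_def by linarith
  show ?thesis
  proof (rule that[of "real DIM('a) * C"])
    show "0 < real DIM('a) * C" using \<open>C > 0\<close> by simp
    fix q w assume "q \<in> K"
    then show "norm (D F q w) \<le> real DIM('a) * C * norm w"
      by (intro norm_linear_le_Basis[OF Ck_on_linear_D[OF assms(3)]] subsetD[OF assms(2)] order_trans[OF B C])
  qed
qed

text \<open>Mean value inequality on a ball about \<open>q\<close>, on which \<open>D F\<close>
  differs from \<open>D F q\<close> by at most \<epsilon>. Both \<open>x\<close> and
  \<open>y\<close> vary, so local Lipschitz bounds can be read off as well.\<close>

lemma uniform_differentiability: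
  fixes F :: "'a::euclidean_space \<Rightarrow> 'b::real_normed_vector"
  assumes "compact K" "open W" "K \<subseteq> W" "Ck_on (Suc k) W F" "\<epsilon> > 0"
  obtains d where "d > 0"
    "\<And>q x y. q \<in> K \<Longrightarrow> norm (x - q) < d \<Longrightarrow> norm (y - q) < d \<Longrightarrow>
       x \<in> W \<and> y \<in> W \<and> norm (F y - F x - D F q (y - x)) \<le> \<epsilon> * norm (y - x)"
proof -
  obtain d where d: "d > 0"
    "\<And>q x w. q \<in> K \<Longrightarrow> norm (x - q) < d \<Longrightarrow> x \<in> W \<and> norm (D F x w - D F q w) \<le> \<epsilon> * norm w"
    using uniform_D_continuity[OF assms] by metis
  show ?thesis
  proof (rule that[OF d(1)])
    fix q x y assume q: "q \<in> K" and x: "norm (x - q) < d" and y: "norm (y - q) < d"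
    have seg: "x + t *\<^sub>R (y - x) \<in> ball q d" if "t \<in> {0..1}" for t
    proof -
      have "(1 - t) *\<^sub>R x + t *\<^sub>R y \<in> ball q d"
        using convex_ball[of q d] x y that unfolding convex_alt
        by (auto simp: dist_norm norm_minus_commute)
      then show ?thesis by (simp add: algebra_simps)
    qed
    have der: "(F has_derivative D F x) (at x within ball q d)" if "x \<in> ball q d" for x
      using Ck_on_has_derivative[OF assms(4)] d(2)[OF q, of x] that
      by (auto simp: dist_norm norm_minus_commute intro: has_derivative_at_withinI)
    have "norm (F y - F x - D F q (y - x)) \<le> norm (y - x) * \<epsilon>"
    proof (rule differentiable_bound_linearization[OF seg der])
      show "onorm (D F z - D F q) \<le> \<epsilon>" if "z \<in> ball q d" for z
        using d(2)[OF q, of z] that assms(5)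
        by (intro onorm_bound) (auto simp: dist_norm norm_minus_commute)
    qed (use d(1) in auto)
    then show "x \<in> W \<and> y \<in> W \<and> norm (F y - F x - D F q (y - x)) \<le> \<epsilon> * norm (y - x)"
      using d(2)[OF q x] d(2)[OF q y] by (simp add: mult.commute)
  qed
qed

lemma vector_derivative_bound:
  fixes e :: "real \<Rightarrow> 'b::real_normed_vector"
  assumes "\<And>s. s \<in> {a..b} \<Longrightarrow> (e has_vector_derivative e' s) (at s within {a..b})"
    "\<And>s. s \<in> {a..b} \<Longrightarrow> norm (e' s) \<le> B" "s0 \<in> {a..b}" "s \<in> {a..b}"
  shows "norm (e s - e s0) \<le> B * \<bar>s - s0\<bar>"
proof -
  have "norm (e s - e s0) \<le> B * norm (s - s0)"
  proof (rule differentiable_bound[of "{a..b}" e "\<lambda>s x. x *\<^sub>R e' s"])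
    show "onorm (\<lambda>x. x *\<^sub>R e' s) \<le> B" if "s \<in> {a..b}" for s
    proof (rule onorm_bound)
      show "0 \<le> B" using assms(2)[OF that] norm_ge_zero[of "e' s"] by linarith
      show "norm (x *\<^sub>R e' s) \<le> B * norm x" for x
        using mult_left_mono[OF assms(2)[OF that], of "\<bar>x\<bar>"] by (simp add: mult.commute)
    qed
  qed (use assms in \<open>auto simp: has_vector_derivative_def\<close>)
  then show ?thesis by simp
qed

text \<open>Both mixed derivatives are the limit of the same second difference quotient.\<close>

lemma D_symmetric:
  fixes F :: "'a::euclidean_space \<Rightarrow> 'b::real_normed_vector"
  assumes "open W" "p \<in> W" "Ck_on 2 W F"
  shows "D (\<lambda>q. D F q a) p b = D (\<lambda>q. D F q b) p a"
proof -
  define \<Delta> where "\<Delta> a b h = F (p + h *\<^sub>R a + h *\<^sub>R b) - F (p + h *\<^sub>R a) - F (p + h *\<^sub>R b) + F p" for a b and h :: real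
  have F: "Ck_on (Suc (Suc 0)) W F" using assms(3) by (simp add: numeral_2_eq_2)
  have main: "((\<lambda>h. \<Delta> a b h /\<^sub>R (h * h)) \<longlongrightarrow> D (\<lambda>q. D F q a) p b) (at_right 0)" for a b
  proof (rule tendstoI)
    fix \<epsilon> :: real assume "\<epsilon> > 0"
    define G where "G = (\<lambda>q. D F q a)"
    have G: "Ck_on (Suc 0) W G" unfolding G_def using Ck_on_D[OF F] .
    have "continuous_on W (\<lambda>q. D G q b)" using Ck_on_imp_continuous_on[OF Ck_on_D[OF G]] .
    then obtain d where d: "d > 0" "\<And>x. norm (x - p) < d \<Longrightarrow> x \<in> W \<and> norm (D G x b - D G p b) < \<epsilon> / 2"
      using uniform_continuity_compact[of "{p}" W "\<lambda>q. D G q b" "\<epsilon> / 2"] assms \<open>\<epsilon> > 0\<close>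
      by (metis compact_sing empty_subsetI half_gt_zero insert_subset singletonI)
    \<comment> \<open>With \<open>h\<close> below this bound the parallelogram at \<open>p\<close>
      spanned by \<open>h\<close> times \<open>a\<close> and \<open>h\<close> times \<open>b\<close>
      stays within distance \<open>d\<close> of \<open>p\<close>.\<close>
    define h0 where "h0 = d / (norm a + norm b + 1)"
    have nn: "norm a + norm b + 1 > 0" by (smt (verit) norm_ge_zero)
    have h0: "h0 > 0" unfolding h0_def using d(1) nn by simp
    have near: "norm ((p + s *\<^sub>R a + t *\<^sub>R b) - p) < d" if "0 \<le> s" "s \<le> h" "0 \<le> t" "t \<le> h" "0 < h" "h < h0" for s t h
    proof -
      have "norm ((p + s *\<^sub>R a + t *\<^sub>R b) - p) \<le> s * norm a + t * norm b"
        using norm_triangle_ineq[of "s *\<^sub>R a" "t *\<^sub>R b"] that by simp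
      also have "\<dots> \<le> h * norm a + h * norm b" using that by (intro add_mono mult_right_mono) auto
      also have "\<dots> \<le> h * (norm a + norm b + 1)" using that by (simp add: algebra_simps)
      also have "\<dots> < h0 * (norm a + norm b + 1)" using that nn by (intro mult_strict_right_mono) auto
      also have "\<dots> = d" unfolding h0_def using nn by simp
      finally show ?thesis .
    qed
    have est: "norm (\<Delta> a b h /\<^sub>R (h * h) - D G p b) < \<epsilon>" if h: "0 < h" "h < h0" for h
    proof -
      \<comment> \<open>The second difference is an increment in \<open>s\<close> of a first
        difference; the mean value bound in \<open>s\<close> and, for the derivative occurring
        there, in \<open>t\<close> gives the two factors \<open>h\<close>.\<close>
      define \<phi> where "\<phi> s = F (p + s *\<^sub>R a + h *\<^sub>R b) - F (p + s *\<^sub>R a + 0 *\<^sub>R b) - (s * h) *\<^sub>R D G p b" for s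
      have inner: "norm (G (p + s *\<^sub>R a + h *\<^sub>R b) - G (p + s *\<^sub>R a) - h *\<^sub>R D G p b) \<le> (\<epsilon> / 2) * h" if s: "s \<in> {0..h}" for s
      proof -
        define \<psi> where "\<psi> t = G (p + s *\<^sub>R a + t *\<^sub>R b) - t *\<^sub>R D G p b" for t
        have "norm (\<psi> h - \<psi> 0) \<le> (\<epsilon> / 2) * \<bar>h - 0\<bar>"
        proof (rule vector_derivative_bound[of 0 h])
          fix t assume t: "t \<in> {0..h}"
          have n: "norm ((p + s *\<^sub>R a + t *\<^sub>R b) - p) < d" using near[of s h t] s t h by auto
          have "(G has_derivative D G (p + s *\<^sub>R a + t *\<^sub>R b)) (at (p + s *\<^sub>R a + t *\<^sub>R b))"
            using Ck_on_has_derivative[OF G] d(2)[OF n] by blast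
          moreover have "((\<lambda>t. p + s *\<^sub>R a + t *\<^sub>R b) has_vector_derivative b) (at t within {0..h})"
            by (auto intro!: derivative_eq_intros)
          ultimately have "((\<lambda>t. G (p + s *\<^sub>R a + t *\<^sub>R b)) has_vector_derivative D G (p + s *\<^sub>R a + t *\<^sub>R b) b) (at t within {0..h})"
            by (rule vector_derivative_diff_chain_within[unfolded o_def, OF _ has_derivative_at_withinI, rotated])
          then show "(\<psi> has_vector_derivative D G (p + s *\<^sub>R a + t *\<^sub>R b) b - D G p b) (at t within {0..h})"
            unfolding \<psi>_def by (auto intro!: derivative_eq_intros)
          show "norm (D G (p + s *\<^sub>R a + t *\<^sub>R b) b - D G p b) \<le> \<epsilon> / 2" using d(2)[OF n] by simp
        qed (use h in auto)
        then show ?thesis using h unfolding \<psi>_def by (simp add: algebra_simps)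
      qed
      have "norm (\<phi> h - \<phi> 0) \<le> ((\<epsilon> / 2) * h) * \<bar>h - 0\<bar>"
      proof (rule vector_derivative_bound[of 0 h])
        fix s assume s: "s \<in> {0..h}"
        have *: "((\<lambda>s. F (p + s *\<^sub>R a + t *\<^sub>R b)) has_vector_derivative G (p + s *\<^sub>R a + t *\<^sub>R b)) (at s within {0..h})"
          if t: "t \<in> {0..h}" for t
        proof -
          have n: "norm ((p + s *\<^sub>R a + t *\<^sub>R b) - p) < d" using near[of s h t] s t h by auto
          have "(F has_derivative D F (p + s *\<^sub>R a + t *\<^sub>R b)) (at (p + s *\<^sub>R a + t *\<^sub>R b))"
            using Ck_on_has_derivative[OF F] d(2)[OF n] by blast
          moreover have "((\<lambda>s. p + s *\<^sub>R a + t *\<^sub>R b) has_vector_derivative a) (at s within {0..h})"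
            by (auto intro!: derivative_eq_intros)
          ultimately show ?thesis unfolding G_def
            by (rule vector_derivative_diff_chain_within[unfolded o_def, OF _ has_derivative_at_withinI, rotated])
        qed
        have "((\<lambda>s. (s * h) *\<^sub>R D G p b) has_vector_derivative h *\<^sub>R D G p b) (at s within {0..h})"
          by (auto intro!: derivative_eq_intros)
        then show "(\<phi> has_vector_derivative G (p + s *\<^sub>R a + h *\<^sub>R b) - G (p + s *\<^sub>R a) - h *\<^sub>R D G p b) (at s within {0..h})"
          unfolding \<phi>_def using *[of h] *[of 0] h by (auto intro!: has_vector_derivative_diff)
        show "norm (G (p + s *\<^sub>R a + h *\<^sub>R b) - G (p + s *\<^sub>R a) - h *\<^sub>R D G p b) \<le> (\<epsilon> / 2) * h"
          using inner[OF s] .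
      qed (use h in auto)
      moreover have "\<phi> h - \<phi> 0 = \<Delta> a b h - (h * h) *\<^sub>R D G p b" unfolding \<phi>_def \<Delta>_def by simp
      ultimately have 2: "norm (\<Delta> a b h - (h * h) *\<^sub>R D G p b) \<le> (\<epsilon> / 2) * (h * h)" using h by simp
      have "\<Delta> a b h /\<^sub>R (h * h) - D G p b = (\<Delta> a b h - (h * h) *\<^sub>R D G p b) /\<^sub>R (h * h)"
        using h by (simp add: algebra_simps)
      then have "norm (\<Delta> a b h /\<^sub>R (h * h) - D G p b) = norm (\<Delta> a b h - (h * h) *\<^sub>R D G p b) / (h * h)"
        using h by (simp add: divide_inverse mult.commute)
      also have "\<dots> \<le> \<epsilon> / 2" using 2 h by (simp add: divide_le_eq)
      finally show ?thesis using \<open>\<epsilon> > 0\<close> by simp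
    qed
    show "\<forall>\<^sub>F h in at_right 0. dist (\<Delta> a b h /\<^sub>R (h * h)) (D (\<lambda>q. D F q a) p b) < \<epsilon>"
      unfolding eventually_at_right_field using est h0 by (auto simp: dist_norm G_def)
  qed
  have "\<Delta> a b = \<Delta> b a" by (rule ext) (simp add: \<Delta>_def algebra_simps)
  then show ?thesis
    using tendsto_unique[OF trivial_limit_at_right_real main[of a b]] main[of b a] by simp
qed

section \<open>Ordinary differential equations\<close>

text \<open>A Gronwall bound without exponentials: at the point \<open>m\<close> where
  \<open>norm (e s)\<close> is largest the mean value bound reads \<open>norm (e m) \<le> norm (e
  s0) + norm (e m) / 2 + (b - a) * \<beta>\<close>, because \<open>L * (b - a) \<le> 1/2\<close>,
  and half of the maximum is absorbed.\<close>

lemma interval_estimate: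
  fixes e :: "real \<Rightarrow> 'b::real_normed_vector"
  assumes der: "\<And>s. s \<in> {a..b} \<Longrightarrow> (e has_vector_derivative e' s) (at s within {a..b})"
    and bd: "\<And>s. s \<in> {a..b} \<Longrightarrow> norm (e' s) \<le> L * norm (e s) + \<beta>"
    and L: "L \<ge> 0" "\<beta> \<ge> 0" "L * (b - a) \<le> 1/2" and s: "s0 \<in> {a..b}" "s \<in> {a..b}"
  shows "norm (e s) \<le> 2 * (norm (e s0) + (b - a) * \<beta>)"
proof -
  have "continuous_on {a..b} e"
    using der has_vector_derivative_continuous continuous_on_eq_continuous_within by blast
  then have "continuous_on {a..b} (\<lambda>s. norm (e s))" by (rule continuous_on_norm)
  then obtain m where m: "m \<in> {a..b}" "\<And>s. s \<in> {a..b} \<Longrightarrow> norm (e s) \<le> norm (e m)"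
    using continuous_attains_sup[of "{a..b}" "\<lambda>s. norm (e s)"] s by (metis compact_Icc empty_iff)
  have "norm (e m - e s0) \<le> (L * norm (e m) + \<beta>) * \<bar>m - s0\<bar>"
  proof (rule vector_derivative_bound[OF der _ s(1) m(1)])
    fix s assume "s \<in> {a..b}"
    then show "norm (e' s) \<le> L * norm (e m) + \<beta>"
      using bd[of s] mult_left_mono[OF m(2)[of s] L(1)] by linarith
  qed
  also have "\<dots> \<le> (L * norm (e m) + \<beta>) * (b - a)"
    using m s L by (intro mult_left_mono add_nonneg_nonneg mult_nonneg_nonneg) auto
  also have "\<dots> = (L * (b - a)) * norm (e m) + (b - a) * \<beta>" by (simp add: algebra_simps)
  also have "\<dots> \<le> (1/2) * norm (e m) + (b - a) * \<beta>"
    using mult_right_mono[OF L(3) norm_ge_zero[of "e m"]] by simp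
  finally have "norm (e m - e s0) \<le> (1/2) * norm (e m) + (b - a) * \<beta>" .
  then have "norm (e m) \<le> 2 * (norm (e s0) + (b - a) * \<beta>)"
    using norm_triangle_ineq2[of "e m" "e s0"] by simp
  then show ?thesis using m(2)[OF s(2)] by linarith
qed

text \<open>The zeros are relatively closed by continuity, and relatively open by the preceding
  estimate on short intervals. The inequality is asked for only near zeros, since the Lipschitz
  bounds in some applications are local.\<close>

lemma zero_propagation:
  fixes e :: "real \<Rightarrow> 'b::real_normed_vector"
  assumes der: "\<And>s. s \<in> {a..b} \<Longrightarrow> (e has_vector_derivative e' s) (at s within {a..b})"
    and bd: "\<And>s0. s0 \<in> {a..b} \<Longrightarrow> e s0 = 0 \<Longrightarrow>
       \<exists>L \<rho>. \<rho> > 0 \<and> (\<forall>s\<in>{a..b}. \<bar>s - s0\<bar> < \<rho> \<longrightarrow> norm (e' s) \<le> L * norm (e s))"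
    and s: "s0 \<in> {a..b}" "e s0 = 0" "s1 \<in> {a..b}"
  shows "e s1 = 0"
proof (rule connected_induction_simple[OF connected_Icc[of a b] s(1,3), of "\<lambda>s. e s = 0", OF s(2)])
  have cont: "continuous_on {a..b} e"
    using der has_vector_derivative_continuous continuous_on_eq_continuous_within by blast
  fix c assume c: "c \<in> {a..b}"
  show "\<exists>T. openin (top_of_set {a..b}) T \<and> c \<in> T \<and> (\<forall>x\<in>T. \<forall>y\<in>T. e x = 0 \<longrightarrow> e y = 0)"
  proof (cases "e c = 0")
    case False
    have "openin (top_of_set {a..b}) ({a..b} \<inter> e -` (- {0}))"
      using continuous_openin_preimage_gen[OF cont, of "- {0}"] by auto
    then show ?thesis using False c by (intro exI[of _ "{a..b} \<inter> e -` (- {0})"]) auto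
  next
    case True
    obtain L \<rho> where L: "\<rho> > 0" "\<And>s. s \<in> {a..b} \<Longrightarrow> \<bar>s - c\<bar> < \<rho> \<Longrightarrow> norm (e' s) \<le> L * norm (e s)"
      using bd[OF c True] by metis
    define L' where "L' = \<bar>L\<bar> + 1"
    \<comment> \<open>An interval of length at most \<open>2 * r\<close> satisfies the smallness
      condition of \<open>interval_estimate\<close> with \<open>L'\<close>.\<close>
    define r where "r = min (\<rho> / 2) (1 / (4 * L'))"
    have L': "L' > 0" "L \<le> L'" unfolding L'_def by linarith+
    have r: "r > 0" "r < \<rho>" "L' * (2 * r) \<le> 1/2"
    proof -
      show "r > 0" "r < \<rho>" unfolding r_def using L(1) L' by auto
      have "L' * (2 * r) \<le> L' * (2 * (1 / (4 * L')))"
        unfolding r_def using L' by (intro mult_left_mono) auto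
      then show "L' * (2 * r) \<le> 1/2" using L' by simp
    qed
    define a' b' where "a' = max a (c - r)" and "b' = min b (c + r)"
    have sub: "{a'..b'} \<subseteq> {a..b}" "c \<in> {a'..b'}" using c r unfolding a'_def b'_def by auto
    have "e y = 0" if y: "y \<in> {a'..b'}" for y
    proof -
      have "norm (e y) \<le> 2 * (norm (e c) + (b' - a') * 0)"
      proof (rule interval_estimate[OF _ _ _ _ _ sub(2) y])
        fix s assume s: "s \<in> {a'..b'}"
        then have s': "s \<in> {a..b}" using sub by blast
        show "(e has_vector_derivative e' s) (at s within {a'..b'})"
          by (rule has_vector_derivative_within_subset[OF der[OF s'] sub(1)])
        have "\<bar>s - c\<bar> < \<rho>" using s r unfolding a'_def b'_def by auto
        then show "norm (e' s) \<le> L' * norm (e s) + 0"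
          using L(2)[OF s'] mult_right_mono[OF L'(2) norm_ge_zero[of "e s"]] by linarith
      next
        have "L' * (b' - a') \<le> L' * (2 * r)"
          using L' unfolding a'_def b'_def by (intro mult_left_mono) auto
        then show "L' * (b' - a') \<le> 1/2" using r by linarith
      qed (use L' in auto)
      then show ?thesis using True by simp
    qed
    moreover have "{a..b} \<inter> ball c r \<subseteq> {a'..b'}" unfolding a'_def b'_def by (auto simp: dist_real_def)
    ultimately show ?thesis using c r(1)
      by (intro exI[of _ "{a..b} \<inter> ball c r"]) (auto simp: openin_open)
  qed
qed

text \<open>Contraction in the sup norm with factor \<open>L * d \<le> 1/2\<close>. Since the speed
  in the ball is at most \<open>M + L * r\<close>, the condition
  \<open>d * (M + L * r) \<le> r\<close> keeps the iterates inside. Time runs in both directions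
  from 0.\<close>

lemma picard_existence:
  fixes G :: "real \<times> 'b::euclidean_space \<Rightarrow> 'b"
  assumes cont: "continuous_on ({-d..d} \<times> cball y0 r) G"
    and lip: "\<And>s x y. s \<in> {-d..d} \<Longrightarrow> x \<in> cball y0 r \<Longrightarrow> y \<in> cball y0 r \<Longrightarrow> norm (G (s, x) - G (s, y)) \<le> L * norm (x - y)"
    and M: "\<And>s. s \<in> {-d..d} \<Longrightarrow> norm (G (s, y0)) \<le> M"
    and d: "d \<ge> 0" "r \<ge> 0" "L \<ge> 0" "d * (M + L * r) \<le> r" "L * d \<le> 1/2"
  obtains \<eta> where "\<eta> 0 = y0" "\<And>s. s \<in> {-d..d} \<Longrightarrow> \<eta> s \<in> cball y0 r"
    "\<And>s. s \<in> {-d..d} \<Longrightarrow> (\<eta> has_vector_derivative G (s, \<eta> s)) (at s within {-d..d})"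
proof -
  \<comment> \<open>Clamping the time to \<open>{-d..d}\<close> extends curves to the whole line, so
    that the complete space of bounded continuous functions can be used.\<close>
  define cl where "cl s = max (-d) (min d s)" for s :: real
  have cl: "cl s \<in> {-d..d}" for s unfolding cl_def using d by auto
  have cl_id: "cl s = s" if "s \<in> {-d..d}" for s unfolding cl_def using that by auto
  have cl_cont: "continuous_on UNIV cl" unfolding cl_def by (intro continuous_intros)
  define S where "S = PiC UNIV (\<lambda>_::real. cball y0 r)"
  have S: "f \<in> S \<longleftrightarrow> (\<forall>s. apply_bcontfun f s \<in> cball y0 r)" for f
    unfolding S_def mem_PiC_iff by auto
  define k where "k f s = G (s, apply_bcontfun f s)" for f s
  have k_cont: "continuous_on {-d..d} (k f)" if "f \<in> S" for f
    unfolding k_def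
    by (rule continuous_on_compose2[OF cont]) (use that S in \<open>auto intro!: continuous_intros\<close>)
  define H where "H f s = integral {-d..s} (k f)" for f s
  have H: "(H f has_vector_derivative k f s) (at s within {-d..d})" if "f \<in> S" "s \<in> {-d..d}" for f s
    using integral_has_vector_derivative[OF k_cont[OF that(1)] that(2)] unfolding H_def .
  \<comment> \<open>The antiderivative \<open>H f\<close> starts at \<open>-d\<close>; subtracting
    \<open>H f 0\<close> moves the initial time to 0.\<close>
  define I where "I f s = y0 + (H f (cl s) - H f 0)" for f s
  have z: "0 \<in> {-d..d}" using d by auto
  have kM: "norm (k f s) \<le> M + L * r" if "f \<in> S" "s \<in> {-d..d}" for f s
  proof -
    have f: "apply_bcontfun f s \<in> cball y0 r" using that S by auto
    have "norm (G (s, apply_bcontfun f s) - G (s, y0)) \<le> L * norm (apply_bcontfun f s - y0)"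
      using lip[OF that(2) f, of y0] d by auto
    also have "\<dots> \<le> L * r" using f d by (intro mult_left_mono) (auto simp: dist_norm norm_minus_commute)
    finally show ?thesis unfolding k_def
      using M[OF that(2)] norm_triangle_sub[of "G (s, apply_bcontfun f s)" "G (s, y0)"] by linarith
  qed
  have I_ball: "I f s \<in> cball y0 r" if "f \<in> S" for f s
  proof -
    have "norm (H f (cl s) - H f 0) \<le> (M + L * r) * \<bar>cl s - 0\<bar>"
      by (rule vector_derivative_bound[OF H[OF that] kM[OF that] z cl])
    also have "\<dots> \<le> (M + L * r) * d"
      using kM[OF that z] order_trans[OF norm_ge_zero] cl[of s] by (intro mult_left_mono) auto
    finally have "norm (H f (cl s) - H f 0) \<le> r" using d(4) by (simp add: mult.commute)
    then show ?thesis unfolding I_def by (simp add: dist_norm norm_minus_commute)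
  qed
  have I_b: "I f \<in> bcontfun" if "f \<in> S" for f
  proof -
    have "continuous_on {-d..d} (H f)"
      using H[OF that] has_vector_derivative_continuous continuous_on_eq_continuous_within by blast
    then have "continuous_on UNIV (\<lambda>s. H f (cl s))"
      by (rule continuous_on_compose2[OF _ cl_cont]) (use cl in auto)
    then have 1: "continuous_on UNIV (I f)" unfolding I_def by (intro continuous_intros)
    have "norm (I f s) \<le> norm y0 + r" for s
      using I_ball[OF that, of s] norm_triangle_sub[of "I f s" y0] by (auto simp: dist_norm norm_minus_commute)
    then show ?thesis using 1 by (intro bcontfun_normI)
  qed
  define T where "T f = Bcontfun (I f)" for f
  have T: "apply_bcontfun (T f) = I f" if "f \<in> S" for f
    unfolding T_def by (rule Bcontfun_inverse[OF I_b[OF that]])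
  have "\<exists>!f. f \<in> S \<and> T f = f"
  proof (rule Banach_fix)
    show "complete S" unfolding complete_eq_closed S_def by (rule closed_PiC) auto
    have "const_bcontfun y0 \<in> S" using d by (auto simp: S const_bcontfun.rep_eq)
    then show "S \<noteq> {}" by blast
    show "T ` S \<subseteq> S" using T I_ball by (auto simp: S)
    show "dist (T f) (T g) \<le> (1/2) * dist f g" if f: "f \<in> S" and g: "g \<in> S" for f g
    proof (rule dist_bound)
      fix s
      have "norm ((H f (cl s) - H g (cl s)) - (H f 0 - H g 0)) \<le> (L * dist f g) * \<bar>cl s - 0\<bar>"
      proof (rule vector_derivative_bound[of "-d" d "\<lambda>s. H f s - H g s" "\<lambda>s. k f s - k g s"])
        fix s assume s: "s \<in> {-d..d}"
        show "((\<lambda>s. H f s - H g s) has_vector_derivative k f s - k g s) (at s within {-d..d})"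
          by (intro has_vector_derivative_diff H f g s)
        have "norm (k f s - k g s) \<le> L * norm (apply_bcontfun f s - apply_bcontfun g s)"
          unfolding k_def by (rule lip[OF s]) (use f g S in auto)
        also have "\<dots> \<le> L * dist f g" using dist_bounded[of f s g] d
          by (intro mult_left_mono) (auto simp: dist_norm)
        finally show "norm (k f s - k g s) \<le> L * dist f g" .
      qed (use cl z in auto)
      also have "\<dots> \<le> (L * dist f g) * d" using cl[of s] d by (intro mult_left_mono) auto
      also have "\<dots> = (L * d) * dist f g" by simp
      also have "\<dots> \<le> (1/2) * dist f g" using d by (intro mult_right_mono) auto
      finally show "dist (apply_bcontfun (T f) s) (apply_bcontfun (T g) s) \<le> (1/2) * dist f g"
        unfolding T[OF f] T[OF g] I_def by (simp add: dist_norm algebra_simps)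
    qed
  qed auto
  then obtain f where f: "f \<in> S" "T f = f" by blast
  have fI: "apply_bcontfun f s = I f s" for s using T[OF f(1)] f(2) by simp
  show ?thesis
  proof (rule that[of "apply_bcontfun f"])
    show "apply_bcontfun f 0 = y0" unfolding fI I_def using cl_id[OF z] by simp
    show "apply_bcontfun f s \<in> cball y0 r" for s using f S by blast
    fix s assume s: "s \<in> {-d..d}"
    have "((\<lambda>s. y0 + (H f s - H f 0)) has_vector_derivative k f s) (at s within {-d..d})"
      using H[OF f(1) s] by (auto intro!: derivative_eq_intros)
    then show "(apply_bcontfun f has_vector_derivative G (s, apply_bcontfun f s)) (at s within {-d..d})"
      unfolding k_def
      by (rule has_vector_derivative_transform[OF s, rotated]) (simp add: fI I_def cl_id)
  qed
qed

section \<open>Dependence of solutions on initial values and parameters\<close>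

lemma lipschitz_of_D_bound:
  fixes F :: "real \<times> 'p::euclidean_space \<times> 'b::euclidean_space \<Rightarrow> 'c::real_normed_vector"
  assumes "Ck_on (Suc k) (I \<times> N \<times> Y) F" "convex Y" "s \<in> I" "p \<in> N" "y \<in> Y" "y' \<in> Y" "L \<ge> 0"
    "\<And>y e. y \<in> Y \<Longrightarrow> norm (D F (s, p, y) (0, 0, e)) \<le> L * norm e"
  shows "norm (F (s, p, y) - F (s, p, y')) \<le> L * norm (y - y')"
proof (rule differentiable_bound[of Y "\<lambda>y. F (s, p, y)" "\<lambda>y e. D F (s, p, y) (0, 0, e)"])
  fix y assume y: "y \<in> Y"
  have 1: "(F has_derivative D F (s, p, y)) (at (s, p, y))"
    by (rule Ck_on_has_derivative[OF assms(1)]) (use y assms in auto)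
  have 2: "((\<lambda>y. (s, p, y)) has_derivative (\<lambda>e. (0, 0, e))) (at y within Y)"
    by (auto intro!: derivative_eq_intros)
  show "((\<lambda>y. F (s, p, y)) has_derivative (\<lambda>e. D F (s, p, y) (0, 0, e))) (at y within Y)"
    by (rule has_derivative_compose[OF 2 1])
  show "onorm (\<lambda>e. D F (s, p, y) (0, 0, e)) \<le> L"
    by (rule onorm_bound) (use assms y in auto)
qed (use assms in auto)

text \<open>\<open>F\<close> is merely continuous in the parameter, because this is also applied to
  the variational equation of a C1 problem. Two solutions are compared by
  \<open>interval_estimate\<close>: the Lipschitz bound handles the difference in \<open>y\<close>,
  and uniform continuity along the compact trajectory of \<open>p0\<close> the difference in
  \<open>p\<close>. The bound \<open>L * \<delta> \<le> 1/4\<close> covers intervals of length up to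
  \<open>2 * \<delta>\<close>.\<close>

lemma continuous_dependence:
  fixes F :: "real \<times> 'p::euclidean_space \<times> 'b::euclidean_space \<Rightarrow> 'b"
  assumes N: "open N" "open Y" "\<delta> > 0"
    and F: "continuous_on ({-\<delta><..<\<delta>} \<times> N \<times> Y) F"
    and lip: "\<And>s p y y'. s \<in> {-\<delta><..<\<delta>} \<Longrightarrow> p \<in> N \<Longrightarrow> y \<in> Y \<Longrightarrow> y' \<in> Y \<Longrightarrow>
        norm (F (s, p, y) - F (s, p, y')) \<le> L * norm (y - y')"
    and L: "L \<ge> 0" "L * \<delta> \<le> 1/4"
    and in_Y: "\<And>s p. s \<in> {-\<delta><..<\<delta>} \<Longrightarrow> p \<in> N \<Longrightarrow> \<phi> (s, p) \<in> Y"
    and der: "\<And>s p. s \<in> {-\<delta><..<\<delta>} \<Longrightarrow> p \<in> N \<Longrightarrow>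
        ((\<lambda>s. \<phi> (s, p)) has_vector_derivative F (s, p, \<phi> (s, p))) (at s)"
    and init: "continuous_on N (\<lambda>p. \<phi> (0, p))"
  shows "continuous_on ({-\<delta><..<\<delta>} \<times> N) \<phi>"
proof (clarsimp simp only: continuous_on_iff)
  fix s0 p0 and \<epsilon> :: real assume s0: "s0 \<in> {-\<delta><..<\<delta>}" and p0: "p0 \<in> N" and \<epsilon>: "\<epsilon> > 0"
  \<comment> \<open>A compact interval inside the open one that contains \<open>s0\<close> in its
    interior.\<close>
  define d where "d = (\<bar>s0\<bar> + \<delta>) / 2"
  have d: "\<bar>s0\<bar> < d" "d < \<delta>" "d > 0" using s0 N unfolding d_def by auto
  have sub: "s \<in> {-\<delta><..<\<delta>}" if "s \<in> {-d..d}" for s using that d by auto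
  define q where "q s = (s, p0, \<phi> (s, p0))" for s
  have cont_s: "continuous_on {-d..d} (\<lambda>s. \<phi> (s, p))" if "p \<in> N" for p
    using der[OF sub that] has_vector_derivative_continuous continuous_at_imp_continuous_on by blast
  have K: "compact (q ` {-d..d})" unfolding q_def
    by (intro compact_continuous_image continuous_intros cont_s p0) auto
  have KW: "q ` {-d..d} \<subseteq> {-\<delta><..<\<delta>} \<times> N \<times> Y" unfolding q_def using sub p0 in_Y by auto
  \<comment> \<open>The estimate multiplies this by \<open>4 * d\<close>, giving \<epsilon>/8.
    Together with 2 \<epsilon>/8 from the initial values and \<epsilon>/2 from \<open>d3\<close> the
    total stays below \<epsilon>.\<close>
  define \<epsilon>' where "\<epsilon>' = \<epsilon> / (32 * d)"
  have e': "\<epsilon>' > 0" unfolding \<epsilon>'_def using \<epsilon> d by simp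
  have W: "open ({-\<delta><..<\<delta>} \<times> N \<times> Y)" by (intro open_Times open_greaterThanLessThan N)
  have "\<exists>d1>0. \<forall>q'\<in>q ` {-d..d}. \<forall>x. norm (x - q') < d1 \<longrightarrow> norm (F x - F q') < \<epsilon>'"
    by (rule uniform_continuity_compact[OF K W KW F e']) meson
  then obtain d1 where d1: "d1 > 0" "\<And>s x. s \<in> {-d..d} \<Longrightarrow> norm (x - q s) < d1 \<Longrightarrow> norm (F x - F (q s)) < \<epsilon>'"
    by auto
  obtain d2 where d2: "d2 > 0" "\<And>p. p \<in> N \<Longrightarrow> dist p p0 < d2 \<Longrightarrow> dist (\<phi> (0, p)) (\<phi> (0, p0)) < \<epsilon> / 8"
    using init \<epsilon> p0 unfolding continuous_on_iff by (metis divide_pos_pos zero_less_numeral)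
  obtain d3 where d3: "d3 > 0" "\<And>s. s \<in> {-d..d} \<Longrightarrow> dist s s0 < d3 \<Longrightarrow> dist (\<phi> (s, p0)) (\<phi> (s0, p0)) < \<epsilon> / 2"
    using cont_s[OF p0] \<epsilon> d(1) unfolding continuous_on_iff
    by (smt (verit) atLeastAtMost_iff half_gt_zero)
  define \<rho> where "\<rho> = min (min d1 d2) (min d3 (d - \<bar>s0\<bar>))"
  have \<rho>: "\<rho> > 0" unfolding \<rho>_def using d d1 d2 d3 by auto
  have main: "norm (\<phi> (s, p) - \<phi> (s, p0)) \<le> 3 * \<epsilon> / 8" if s: "s \<in> {-d..d}" and p: "p \<in> N" "dist p p0 < \<rho>" for s p
  proof -
    have "norm (\<phi> (s, p) - \<phi> (s, p0)) \<le> 2 * (norm (\<phi> (0, p) - \<phi> (0, p0)) + (d - (-d)) * \<epsilon>')"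
    proof (rule interval_estimate[where e = "\<lambda>s. \<phi> (s, p) - \<phi> (s, p0)" and L = L and e' = "\<lambda>s. F (s, p, \<phi> (s, p)) - F (s, p0, \<phi> (s, p0))"])
      fix s assume s: "s \<in> {-d..d}"
      show "((\<lambda>s. \<phi> (s, p) - \<phi> (s, p0)) has_vector_derivative F (s, p, \<phi> (s, p)) - F (s, p0, \<phi> (s, p0))) (at s within {-d..d})"
        by (intro has_vector_derivative_diff has_vector_derivative_at_within[OF der] sub s p p0)
      have "norm ((s, p, \<phi> (s, p0)) - q s) < d1" using p unfolding q_def \<rho>_def by (simp add: norm_Pair dist_norm)
      then have "norm (F (s, p, \<phi> (s, p0)) - F (q s)) < \<epsilon>'" by (rule d1(2)[OF s])
      moreover have "norm (F (s, p, \<phi> (s, p)) - F (s, p, \<phi> (s, p0))) \<le> L * norm (\<phi> (s, p) - \<phi> (s, p0))"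
        by (intro lip in_Y sub s p p0)
      ultimately show "norm (F (s, p, \<phi> (s, p)) - F (s, p0, \<phi> (s, p0))) \<le> L * norm (\<phi> (s, p) - \<phi> (s, p0)) + \<epsilon>'"
        unfolding q_def
        using norm_triangle_ineq[of "F (s, p, \<phi> (s, p)) - F (s, p, \<phi> (s, p0))" "F (s, p, \<phi> (s, p0)) - F (s, p0, \<phi> (s, p0))"]
        by simp
    next
      have "L * (d - - d) \<le> 2 * (L * \<delta>)" using d L mult_left_mono[of d \<delta> L] by (simp add: algebra_simps)
      then show "L * (d - - d) \<le> 1/2" using L by simp
    qed (use L e' d s in auto)
    also have "\<dots> = 2 * norm (\<phi> (0, p) - \<phi> (0, p0)) + \<epsilon> / 8" unfolding \<epsilon>'_def using d by (simp add: field_simps)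
    also have "\<dots> \<le> 2 * (\<epsilon> / 8) + \<epsilon> / 8" using d2(2)[OF p(1)] p(2) unfolding \<rho>_def by (simp add: dist_norm)
    finally show ?thesis by simp
  qed
  have fin: "dist (\<phi> (s, p)) (\<phi> (s0, p0)) < \<epsilon>" if p: "p \<in> N" and dd: "dist (s, p) (s0, p0) < \<rho>" for s p
  proof -
    have 1: "dist s s0 < \<rho>" "dist p p0 < \<rho>"
      using dd dist_fst_le[of "(s, p)" "(s0, p0)"] dist_snd_le[of "(s, p)" "(s0, p0)"] by auto
    then have s: "s \<in> {-d..d}" unfolding \<rho>_def dist_real_def by auto
    have "dist (\<phi> (s, p0)) (\<phi> (s0, p0)) < \<epsilon> / 2" using d3(2)[OF s] 1 unfolding \<rho>_def by simp
    then show ?thesis using main[OF s p 1(2)] dist_triangle[of "\<phi> (s, p)" "\<phi> (s0, p0)" "\<phi> (s, p0)"] \<epsilon>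
      by (simp add: dist_norm)
  qed
  show "\<exists>d>0. \<forall>x'\<in>{- \<delta><..<\<delta>} \<times> N. dist x' (s0, p0) < d \<longrightarrow> dist (\<phi> x') (\<phi> (s0, p0)) < \<epsilon>"
    using \<rho> fin by (intro exI[of _ \<rho>]) auto
qed

text \<open>The candidate \<open>A\<close> solves the variational equation along the trajectory of
  \<open>p0\<close>; the remainder \<open>\<phi> (s, p0 + h) - \<phi> (s, p0) - A s h\<close> is
  then estimated by \<open>interval_estimate\<close>. \<open>bd\<close> bounds the
  \<open>y\<close>-derivative of \<open>F\<close>, which provides the Lipschitz constant of both
  equations.\<close>

lemma differentiable_dependence:
  fixes F :: "real \<times> 'p::euclidean_space \<times> 'b::euclidean_space \<Rightarrow> 'b"
  assumes N: "open N" "open Y" "convex Y" "\<delta> > 0"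
    and F: "Ck_on (Suc 0) ({-\<delta><..<\<delta>} \<times> N \<times> Y) F"
    and bd: "\<And>s p y e. s \<in> {-\<delta><..<\<delta>} \<Longrightarrow> p \<in> N \<Longrightarrow> y \<in> Y \<Longrightarrow> norm (D F (s, p, y) (0, 0, e)) \<le> L * norm e"
    and L: "L \<ge> 0" "L * \<delta> \<le> 1/4"
    and in_Y: "\<And>s p. s \<in> {-\<delta><..<\<delta>} \<Longrightarrow> p \<in> N \<Longrightarrow> \<phi> (s, p) \<in> Y"
    and der: "\<And>s p. s \<in> {-\<delta><..<\<delta>} \<Longrightarrow> p \<in> N \<Longrightarrow>
        ((\<lambda>s. \<phi> (s, p)) has_vector_derivative F (s, p, \<phi> (s, p))) (at s)"
    and init: "Ck_on (Suc 0) N (\<lambda>p. \<phi> (0, p))"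
    and p0: "p0 \<in> N" and d: "0 < d" "d < \<delta>"
  obtains A where
    "\<And>s. s \<in> {-d..d} \<Longrightarrow> ((\<lambda>p. \<phi> (s, p)) has_derivative A s) (at p0)"
    "\<And>s w. s \<in> {-d..d} \<Longrightarrow> ((\<lambda>s. A s w) has_vector_derivative D F (s, p0, \<phi> (s, p0)) (0, w, A s w)) (at s within {-d..d})"
proof -
  have sub: "s \<in> {-\<delta><..<\<delta>}" if "s \<in> {-d..d}" for s using that d by auto
  have Ld: "L * (d - - d) \<le> 1/2"
    using d L mult_left_mono[of d \<delta> L] by (simp add: algebra_simps)
  define W where "W = {-\<delta><..<\<delta>} \<times> N \<times> Y"
  have W: "open W" unfolding W_def by (intro open_Times open_greaterThanLessThan N)
  note F' = F[folded W_def]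
  define q where "q s = (s, p0, \<phi> (s, p0))" for s
  have cont_s: "continuous_on {-d..d} (\<lambda>s. \<phi> (s, p0))"
    using der[OF sub p0] has_vector_derivative_continuous continuous_at_imp_continuous_on by blast
  have contq: "continuous_on {-d..d} q" unfolding q_def
    by (intro continuous_intros cont_s)
  have q: "q s \<in> W" if "s \<in> {-d..d}" for s unfolding q_def W_def using sub[OF that] p0 in_Y by auto
  define K where "K = q ` {-d..d}"
  have K: "compact K" unfolding K_def
    by (intro compact_continuous_image contq) auto
  have KW: "K \<subseteq> W" unfolding K_def using q by auto
  have lin: "linear (D F (q s))" if "s \<in> {-d..d}" for s by (rule Ck_on_linear_D[OF F' q[OF that]])
  obtain B where B: "B > 0" "\<And>q w. q \<in> K \<Longrightarrow> norm (D F q w) \<le> B * norm w"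
    by (rule bounded_D_compact[OF K KW F']) meson
  have B': "norm (D F (q s) w) \<le> B * norm w" if "s \<in> {-d..d}" for s w
    using B(2) that unfolding K_def by blast
  have z: "0 \<in> {-d..d}" using d by auto
  have contD: "continuous_on ({-d..d} \<times> UNIV) (\<lambda>(s, y). D F (q s) (0, w, y))" for w
  proof -
    have "continuous_on ({-d..d} \<times> UNIV) (\<lambda>x. D F (q (fst x)) b)" for b
      using Ck_on_imp_continuous_on[OF Ck_on_D[OF F']]
      by (rule continuous_on_compose2) (use q in \<open>auto intro!: continuous_intros continuous_on_compose2[OF contq]\<close>)
    then have "continuous_on ({-d..d} \<times> UNIV) (\<lambda>x. \<Sum>b\<in>Basis. ((0, w, snd x) \<bullet> b) *\<^sub>R D F (q (fst x)) b)"
      by (intro continuous_intros)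
    then show ?thesis
      by (rule continuous_on_eq) (auto simp: linear_Basis_sum[OF lin, symmetric])
  qed
  have "\<exists>\<eta>. \<eta> 0 = D (\<lambda>p. \<phi> (0, p)) p0 b \<and>
      (\<forall>s\<in>{-d..d}. (\<eta> has_vector_derivative D F (q s) (0, b, \<eta> s)) (at s within {-d..d}))" for b
  proof -
    define y0 where "y0 = D (\<lambda>p. \<phi> (0, p)) p0 b"
    define M where "M = B * norm (0::real, b, y0)"
    \<comment> \<open>As \<open>L * d \<le> 1/4\<close>, this gives
      \<open>d * (M + L * r) \<le> r / 2 + r / 4\<close>.\<close>
    define r where "r = 2 * d * M"
    have M: "M \<ge> 0" unfolding M_def using B by simp
    have r: "r \<ge> 0" unfolding r_def using M d by simp
    have "L * d \<le> 1/4" using Ld by simp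
    then have dMr: "d * (M + L * r) \<le> r"
      using mult_right_mono[of "L * d" "1/4" r] r unfolding r_def by (simp add: algebra_simps)
    show ?thesis
    proof (rule picard_existence[where d = d and ?y0.0 = y0 and r = r and G = "\<lambda>(s, y). D F (q s) (0, b, y)" and L = L and M = M])
      show "continuous_on ({-d..d} \<times> cball y0 r) (\<lambda>(s, y). D F (q s) (0, b, y))"
        by (rule continuous_on_subset[OF contD]) auto
      show "norm ((case (s, x) of (s, y) \<Rightarrow> D F (q s) (0, b, y)) - (case (s, y) of (s, y) \<Rightarrow> D F (q s) (0, b, y))) \<le> L * norm (x - y)"
        if "s \<in> {-d..d}" for s x y
        using bd[OF sub[OF that] p0 in_Y[OF sub[OF that] p0], of "x - y"] linear_diff[OF lin[OF that], of "(0, b, x)" "(0, b, y)"]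
        unfolding q_def by simp
      show "norm (case (s, y0) of (s, y) \<Rightarrow> D F (q s) (0, b, y)) \<le> M" if "s \<in> {-d..d}" for s
        unfolding M_def prod.case by (rule B'[OF that])
      show "L * d \<le> 1/2" using \<open>L * d \<le> 1/4\<close> by simp
      fix \<eta> assume "\<eta> 0 = y0"
        "\<And>s. s \<in> {-d..d} \<Longrightarrow> (\<eta> has_vector_derivative (case (s, \<eta> s) of (s, y) \<Rightarrow> D F (q s) (0, b, y))) (at s within {-d..d})"
      then show ?thesis unfolding y0_def by auto
    qed (use d r L dMr in auto)
  qed
  then obtain \<eta> where \<eta>: "\<And>b. \<eta> b 0 = D (\<lambda>p. \<phi> (0, p)) p0 b"
    "\<And>b s. s \<in> {-d..d} \<Longrightarrow> (\<eta> b has_vector_derivative D F (q s) (0, b, \<eta> b s)) (at s within {-d..d})"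
    by metis
  \<comment> \<open>\<open>A s\<close> is the linear extension of the solutions in basis directions,
    so its linearity holds by construction.\<close>
  define A where "A s w = (\<Sum>b\<in>Basis. (w \<bullet> b) *\<^sub>R \<eta> b s)" for s w
  have A_lin: "bounded_linear (A s)" for s
    unfolding A_def by (intro bounded_linear_sum bounded_linear_compose[OF bounded_linear_scaleR_left] bounded_linear_inner_left)
  have A0: "A 0 w = D (\<lambda>p. \<phi> (0, p)) p0 w" for w
    unfolding A_def \<eta>(1) by (rule linear_Basis_sum[symmetric, OF Ck_on_linear_D[OF init p0]])
  have A_der: "((\<lambda>s. A s w) has_vector_derivative D F (q s) (0, w, A s w)) (at s within {-d..d})"
    if s: "s \<in> {-d..d}" for s w
  proof -
    have "((\<lambda>s. A s w) has_vector_derivative (\<Sum>b\<in>Basis. (w \<bullet> b) *\<^sub>R D F (q s) (0, b, \<eta> b s))) (at s within {-d..d})"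
      unfolding A_def
      by (intro has_vector_derivative_sum bounded_linear.has_vector_derivative[OF bounded_linear_scaleR_right] \<eta>(2) s)
    moreover have "(\<Sum>b\<in>Basis. (w \<bullet> b) *\<^sub>R D F (q s) (0, b, \<eta> b s)) = D F (q s) (\<Sum>b\<in>Basis. (w \<bullet> b) *\<^sub>R (0, b, \<eta> b s))"
      by (simp add: linear_sum[OF lin[OF s]] linear_scale[OF lin[OF s]] del: scaleR_Pair)
    moreover have "(\<Sum>b\<in>Basis. (w \<bullet> b) *\<^sub>R (0::real, b, \<eta> b s)) = (0, w, A s w)"
      unfolding A_def by (simp add: prod_eq_iff fst_sum snd_sum euclidean_representation)
    ultimately show ?thesis by simp
  qed
  have init': "((\<lambda>p. \<phi> (0, p)) has_derivative D (\<lambda>p. \<phi> (0, p)) p0) (at p0)"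
    by (rule Ck_on_has_derivative[OF init p0])
  obtain \<rho>N where \<rho>N: "\<rho>N > 0" "\<And>h. norm h < \<rho>N \<Longrightarrow> p0 + h \<in> N"
  proof -
    obtain r where "r > 0" "ball p0 r \<subseteq> N" using N p0 open_contains_ball by blast
    then show ?thesis by (intro that[of r]) (auto simp: dist_norm subset_iff)
  qed
  \<comment> \<open>A Lipschitz bound in the parameter comes first: it converts an error that is
    small relative to the displacement \<open>(0, h, y)\<close> into one that is small relative to
    \<open>h\<close>.\<close>
  obtain C \<rho>1 where C: "C > 0" "\<rho>1 > 0" "\<rho>1 \<le> \<rho>N"
    "\<And>s h. s \<in> {-d..d} \<Longrightarrow> norm h < \<rho>1 \<Longrightarrow> norm (\<phi> (s, p0 + h) - \<phi> (s, p0)) \<le> C * norm h"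
  proof -
    obtain d1 where d1: "d1 > 0" "\<And>s x. s \<in> {-d..d} \<Longrightarrow> norm (x - q s) < d1 \<Longrightarrow>
        norm (F x - F (q s) - D F (q s) (x - q s)) \<le> 1 * norm (x - q s)"
    proof -
      have "\<exists>d1>0. \<forall>q\<in>K. \<forall>x. norm (x - q) < d1 \<longrightarrow> norm (F x - F q - D F q (x - q)) \<le> 1 * norm (x - q)"
        by (rule uniform_differentiability[OF K W KW F' zero_less_one]) (metis norm_zero right_minus_eq)
      then show ?thesis using that unfolding K_def by auto
    qed
    obtain B0 where B0: "\<And>w. norm (D (\<lambda>p. \<phi> (0, p)) p0 w) \<le> norm w * B0" "B0 \<ge> 0"
      using bounded_linear.nonneg_bounded[OF has_derivative_bounded_linear[OF init']] by blast
    obtain d2 where d2: "d2 > 0" "\<And>p. norm (p - p0) < d2 \<Longrightarrow>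
        norm (\<phi> (0, p) - \<phi> (0, p0) - D (\<lambda>p. \<phi> (0, p)) p0 (p - p0)) \<le> 1 * norm (p - p0)"
      using init' zero_less_one unfolding has_derivative_at_alt by blast
    define C where "C = 2 * ((1 + B0) + (d - - d) * (1 + B))"
    define \<rho>1 where "\<rho>1 = min (min d1 d2) \<rho>N"
    have "norm (\<phi> (s, p0 + h) - \<phi> (s, p0)) \<le> C * norm h" if s: "s \<in> {-d..d}" and h: "norm h < \<rho>1" for s h
    proof -
      have ph: "p0 + h \<in> N" using \<rho>N(2) h unfolding \<rho>1_def by auto
      have "norm (\<phi> (s, p0 + h) - \<phi> (s, p0)) \<le> 2 * (norm (\<phi> (0, p0 + h) - \<phi> (0, p0)) + (d - - d) * ((1 + B) * norm h))"
      proof (rule interval_estimate[where e = "\<lambda>s. \<phi> (s, p0 + h) - \<phi> (s, p0)" and L = L and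
            e' = "\<lambda>s. F (s, p0 + h, \<phi> (s, p0 + h)) - F (s, p0, \<phi> (s, p0))", OF _ _ L(1) _ Ld z s])
        fix s assume s: "s \<in> {-d..d}"
        show "((\<lambda>s. \<phi> (s, p0 + h) - \<phi> (s, p0)) has_vector_derivative F (s, p0 + h, \<phi> (s, p0 + h)) - F (s, p0, \<phi> (s, p0))) (at s within {-d..d})"
          by (intro has_vector_derivative_diff has_vector_derivative_at_within[OF der] sub s p0 ph)
        define x where "x = (s, p0 + h, \<phi> (s, p0))"
        have xq: "x - q s = (0, h, 0)" "norm (x - q s) = norm h" unfolding x_def q_def by (auto simp: norm_Pair)
        have "norm (F x - F (q s) - D F (q s) (x - q s)) \<le> 1 * norm (x - q s)"
          by (rule d1(2)[OF s]) (use xq h in \<open>auto simp: \<rho>1_def\<close>)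
        then have "norm (F x - F (q s)) \<le> norm h + B * norm h"
          using B'[OF s, of "x - q s"] norm_triangle_sub[of "F x - F (q s)" "D F (q s) (x - q s)"] xq by simp
        moreover have "norm (F (s, p0 + h, \<phi> (s, p0 + h)) - F x) \<le> L * norm (\<phi> (s, p0 + h) - \<phi> (s, p0))"
          unfolding x_def by (rule lipschitz_of_D_bound[OF F N(3) sub[OF s] ph])
            (use in_Y sub s ph p0 L bd in auto)
        ultimately show "norm (F (s, p0 + h, \<phi> (s, p0 + h)) - F (s, p0, \<phi> (s, p0))) \<le> L * norm (\<phi> (s, p0 + h) - \<phi> (s, p0)) + (1 + B) * norm h"
          using norm_triangle_ineq[of "F (s, p0 + h, \<phi> (s, p0 + h)) - F x" "F x - F (q s)"]
          unfolding q_def by (simp add: algebra_simps)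
      qed (use B in auto)
      also have "norm (\<phi> (0, p0 + h) - \<phi> (0, p0)) \<le> (1 + B0) * norm h"
        using d2(2)[of "p0 + h"] h B0(1)[of h]
          norm_triangle_sub[of "\<phi> (0, p0 + h) - \<phi> (0, p0)" "D (\<lambda>p. \<phi> (0, p)) p0 h"]
        unfolding \<rho>1_def by (simp add: algebra_simps)
      finally have "norm (\<phi> (s, p0 + h) - \<phi> (s, p0)) \<le> 2 * ((1 + B0) * norm h + (d - - d) * ((1 + B) * norm h))" by simp
      then show ?thesis unfolding C_def by (simp add: algebra_simps)
    qed
    moreover have "C > 0" unfolding C_def using B0 B d by (intro mult_pos_pos add_pos_nonneg) auto
    moreover have "\<rho>1 > 0" "\<rho>1 \<le> \<rho>N" unfolding \<rho>1_def using d1 d2 \<rho>N by auto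
    ultimately show ?thesis using that by blast
  qed
  show ?thesis
  proof (rule that[of A])
    show "((\<lambda>s. A s w) has_vector_derivative D F (s, p0, \<phi> (s, p0)) (0, w, A s w)) (at s within {-d..d})"
      if "s \<in> {-d..d}" for s w using A_der[OF that] unfolding q_def .
    fix s assume s: "s \<in> {-d..d}"
    show "((\<lambda>p. \<phi> (s, p)) has_derivative A s) (at p0)"
      unfolding has_derivative_at_alt
    proof (intro conjI allI impI)
      show "bounded_linear (A s)" by (rule A_lin)
      fix \<epsilon> :: real assume \<epsilon>: "\<epsilon> > 0"
      \<comment> \<open>The denominator is the sum of the coefficients of
        \<open>\<epsilon>1 * norm h\<close> in the final estimate.\<close>
      define \<epsilon>1 where "\<epsilon>1 = \<epsilon> / (2 + 2 * (d - - d) * (1 + C))"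
      have den: "2 + 2 * (d - - d) * (1 + C) > 0" using d C by (intro add_pos_nonneg) auto
      have \<epsilon>1: "\<epsilon>1 > 0" unfolding \<epsilon>1_def using \<epsilon> den by simp
      obtain d1 where d1: "d1 > 0" "\<And>s x. s \<in> {-d..d} \<Longrightarrow> norm (x - q s) < d1 \<Longrightarrow>
          norm (F x - F (q s) - D F (q s) (x - q s)) \<le> \<epsilon>1 * norm (x - q s)"
      proof -
        have "\<exists>d1>0. \<forall>q\<in>K. \<forall>x. norm (x - q) < d1 \<longrightarrow> norm (F x - F q - D F q (x - q)) \<le> \<epsilon>1 * norm (x - q)"
          by (rule uniform_differentiability[OF K W KW F' \<epsilon>1]) (metis norm_zero right_minus_eq)
        then show ?thesis using that unfolding K_def by auto
      qed
      obtain d2 where d2: "d2 > 0" "\<And>p. norm (p - p0) < d2 \<Longrightarrow>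
          norm (\<phi> (0, p) - \<phi> (0, p0) - D (\<lambda>p. \<phi> (0, p)) p0 (p - p0)) \<le> \<epsilon>1 * norm (p - p0)"
        using init' \<epsilon>1 unfolding has_derivative_at_alt by blast
      define \<rho> where "\<rho> = min (min d2 \<rho>1) (d1 / (1 + C))"
      have \<rho>: "\<rho> > 0" unfolding \<rho>_def using d1 d2 C by simp
      have "norm (\<phi> (s, p) - \<phi> (s, p0) - A s (p - p0)) \<le> \<epsilon> * norm (p - p0)" if p: "norm (p - p0) < \<rho>" for p
      proof -
        define h where "h = p - p0"
        have ph: "p0 + h = p" "p0 + h \<in> N" using \<rho>N(2)[of h] p C unfolding h_def \<rho>_def by auto
        define e where "e s = \<phi> (s, p0 + h) - \<phi> (s, p0) - A s h" for s
        have "norm (e s) \<le> 2 * (norm (e 0) + (d - - d) * (\<epsilon>1 * (1 + C) * norm h))"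
        proof (rule interval_estimate[where e = e and L = L and
              e' = "\<lambda>s. F (s, p0 + h, \<phi> (s, p0 + h)) - F (q s) - D F (q s) (0, h, A s h)", OF _ _ L(1) _ Ld z s])
          fix s assume s: "s \<in> {-d..d}"
          show "(e has_vector_derivative F (s, p0 + h, \<phi> (s, p0 + h)) - F (q s) - D F (q s) (0, h, A s h)) (at s within {-d..d})"
            unfolding e_def q_def
            by (intro has_vector_derivative_diff has_vector_derivative_at_within[OF der] sub s p0 ph A_der[OF s, unfolded q_def])
          define x where "x = (s, p0 + h, \<phi> (s, p0 + h))"
          define y where "y = \<phi> (s, p0 + h) - \<phi> (s, p0)"
          have xq: "x - q s = (0, h, y)" unfolding x_def q_def y_def by auto
          have y: "norm y \<le> C * norm h" unfolding y_def by (rule C(4)[OF s]) (use p in \<open>simp add: h_def \<rho>_def\<close>)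
          have "norm (x - q s) \<le> norm h + norm y"
            unfolding xq using norm_Pair_le[of "0::real" "(h, y)"] norm_Pair_le[of h y] by simp
          then have nx: "norm (x - q s) \<le> (1 + C) * norm h" using y by (simp add: algebra_simps)
          also have "\<dots> < d1" using p C unfolding h_def[symmetric] \<rho>_def by (simp add: less_divide_eq mult.commute)
          finally have "norm (F x - F (q s) - D F (q s) (x - q s)) \<le> \<epsilon>1 * norm (x - q s)" by (rule d1(2)[OF s])
          also have "\<dots> \<le> \<epsilon>1 * ((1 + C) * norm h)" using nx \<epsilon>1 by (intro mult_left_mono) auto
          finally have 1: "norm (F x - F (q s) - D F (q s) (0, h, y)) \<le> \<epsilon>1 * (1 + C) * norm h" unfolding xq by (simp add: mult.assoc)
          have "D F (q s) (0, h, y) - D F (q s) (0, h, A s h) = D F (q s) (0, 0, e s)"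
            using linear_diff[OF lin[OF s], of "(0, h, y)" "(0, h, A s h)"] unfolding e_def y_def by simp
          moreover have "norm (D F (q s) (0, 0, e s)) \<le> L * norm (e s)"
            unfolding q_def by (intro bd sub s p0 in_Y)
          ultimately have "norm (D F (q s) (0, h, y) - D F (q s) (0, h, A s h)) \<le> L * norm (e s)" by simp
          with 1 show "norm (F (s, p0 + h, \<phi> (s, p0 + h)) - F (q s) - D F (q s) (0, h, A s h)) \<le> L * norm (e s) + \<epsilon>1 * (1 + C) * norm h"
            using norm_triangle_ineq[of "F x - F (q s) - D F (q s) (0, h, y)" "D F (q s) (0, h, y) - D F (q s) (0, h, A s h)"]
            unfolding x_def by simp
        qed (use \<epsilon>1 C in auto)
        also have "norm (e 0) \<le> \<epsilon>1 * norm h"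
          using d2(2)[of p] p ph unfolding e_def A0 h_def \<rho>_def by simp
        finally have "norm (e s) \<le> 2 * (\<epsilon>1 * norm h + (d - - d) * (\<epsilon>1 * (1 + C) * norm h))" by simp
        also have "\<dots> = \<epsilon>1 * (2 + 2 * (d - - d) * (1 + C)) * norm h" by (simp add: algebra_simps)
        also have "\<dots> = \<epsilon> * norm h" unfolding \<epsilon>1_def using den by simp
        finally show ?thesis unfolding e_def h_def by simp
      qed
      then show "\<exists>d>0. \<forall>y. norm (y - p0) < d \<longrightarrow> norm (\<phi> (s, y) - \<phi> (s, p0) - A s (y - p0)) \<le> \<epsilon> * norm (y - p0)"
        using \<rho> by blast
    qed
  qed
qed

text \<open>The derivative in the parameter solves the variational equation, so its continuity is
  \<open>continuous_dependence\<close> once more, with the whole space as state domain. Total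
  differentiability of \<phi> follows from its partial derivatives.\<close>

lemma dependence_C1:
  fixes F :: "real \<times> 'p::euclidean_space \<times> 'b::euclidean_space \<Rightarrow> 'b"
  assumes N: "open N" "open Y" "convex Y" "\<delta> > 0"
    and F: "Ck_on (Suc 0) ({-\<delta><..<\<delta>} \<times> N \<times> Y) F"
    and bd: "\<And>s p y e. s \<in> {-\<delta><..<\<delta>} \<Longrightarrow> p \<in> N \<Longrightarrow> y \<in> Y \<Longrightarrow> norm (D F (s, p, y) (0, 0, e)) \<le> L * norm e"
    and L: "L \<ge> 0" "L * \<delta> \<le> 1/4"
    and in_Y: "\<And>s p. s \<in> {-\<delta><..<\<delta>} \<Longrightarrow> p \<in> N \<Longrightarrow> \<phi> (s, p) \<in> Y"
    and der: "\<And>s p. s \<in> {-\<delta><..<\<delta>} \<Longrightarrow> p \<in> N \<Longrightarrow>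
        ((\<lambda>s. \<phi> (s, p)) has_vector_derivative F (s, p, \<phi> (s, p))) (at s)"
    and init: "Ck_on (Suc 0) N (\<lambda>p. \<phi> (0, p))"
  shows "\<And>s p w. s \<in> {-\<delta><..<\<delta>} \<Longrightarrow> p \<in> N \<Longrightarrow>
      ((\<lambda>s. D (\<lambda>p. \<phi> (s, p)) p w) has_vector_derivative D F (s, p, \<phi> (s, p)) (0, w, D (\<lambda>p. \<phi> (s, p)) p w)) (at s)"
    and "\<And>w. continuous_on ({-\<delta><..<\<delta>} \<times> N) (\<lambda>(s, p). D (\<lambda>p. \<phi> (s, p)) p w)"
    and "continuous_on ({-\<delta><..<\<delta>} \<times> N) \<phi>"
    and "\<And>s p. s \<in> {-\<delta><..<\<delta>} \<Longrightarrow> p \<in> N \<Longrightarrow>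
      (\<phi> has_derivative (\<lambda>(\<sigma>, w). \<sigma> *\<^sub>R F (s, p, \<phi> (s, p)) + D (\<lambda>p. \<phi> (s, p)) p w)) (at (s, p))"
proof -
  define I where "I = {-\<delta><..<\<delta>}"
  have I: "open I" unfolding I_def by simp
  define W where "W = I \<times> N \<times> Y"
  have W: "open W" unfolding W_def by (intro open_Times I N)
  note F' = F[folded I_def, folded W_def]
  define A where "A s p = D (\<lambda>p. \<phi> (s, p)) p" for s p
  have both: "((\<lambda>p. \<phi> (s, p)) has_derivative A s p) (at p) \<and>
      ((\<lambda>s. A s p w) has_vector_derivative D F (s, p, \<phi> (s, p)) (0, w, A s p w)) (at s)"
    if s: "s \<in> I" and p: "p \<in> N" for s p w
  proof -
    define d where "d = (\<bar>s\<bar> + \<delta>) / 2"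
    have d: "0 < d" "d < \<delta>" "\<bar>s\<bar> < d" using s N(4) unfolding d_def I_def by auto
    have "\<exists>A'. (\<forall>s\<in>{-d..d}. ((\<lambda>p. \<phi> (s, p)) has_derivative A' s) (at p)) \<and>
      (\<forall>s\<in>{-d..d}. \<forall>w. ((\<lambda>s. A' s w) has_vector_derivative D F (s, p, \<phi> (s, p)) (0, w, A' s w)) (at s within {-d..d}))"
      (is "\<exists>A'. ?Q A'")
    proof (rule differentiable_dependence[OF N F bd L in_Y der init p d(1,2)])
      fix A' assume "\<And>s. s \<in> {-d..d} \<Longrightarrow> ((\<lambda>p. \<phi> (s, p)) has_derivative A' s) (at p)"
        "\<And>s w. s \<in> {-d..d} \<Longrightarrow> ((\<lambda>s. A' s w) has_vector_derivative D F (s, p, \<phi> (s, p)) (0, w, A' s w)) (at s within {-d..d})"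
      then have "?Q A'" by simp
      then show ?thesis using exI[of ?Q A'] by blast
    qed
    then obtain A' where A': "\<And>s. s \<in> {-d..d} \<Longrightarrow> ((\<lambda>p. \<phi> (s, p)) has_derivative A' s) (at p)"
      "\<And>s w. s \<in> {-d..d} \<Longrightarrow> ((\<lambda>s. A' s w) has_vector_derivative D F (s, p, \<phi> (s, p)) (0, w, A' s w)) (at s within {-d..d})"
      by blast
    have eq: "A' s = A s p" if "s \<in> {-d..d}" for s
      unfolding A_def by (rule D_eqI[symmetric, OF A'(1)[OF that]])
    have s': "s \<in> {-d..d}" "-d < s" "s < d" using d(3) by auto
    have "((\<lambda>s. A' s w) has_vector_derivative D F (s, p, \<phi> (s, p)) (0, w, A' s w)) (at s)"
      using A'(2)[OF s'(1), of w] unfolding at_within_Icc_at[OF s'(2,3)] .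
    then have "((\<lambda>s. A s p w) has_vector_derivative D F (s, p, \<phi> (s, p)) (0, w, A s p w)) (at s)"
      unfolding eq[OF s'(1)]
      by (rule has_vector_derivative_transform_within_open[of _ _ _ "{-d<..<d}"]) (use s' eq in auto)
    then show ?thesis using A'(1)[OF s'(1)] eq[OF s'(1)] by simp
  qed
  show 1: "((\<lambda>s. D (\<lambda>p. \<phi> (s, p)) p w) has_vector_derivative D F (s, p, \<phi> (s, p)) (0, w, D (\<lambda>p. \<phi> (s, p)) p w)) (at s)"
    if "s \<in> {-\<delta><..<\<delta>}" "p \<in> N" for s p w
    using both that unfolding A_def I_def by blast
  have lipF: "norm (F (s, p, y) - F (s, p, y')) \<le> L * norm (y - y')"
    if "s \<in> {-\<delta><..<\<delta>}" "p \<in> N" "y \<in> Y" "y' \<in> Y" for s p y y'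
    by (rule lipschitz_of_D_bound[OF F N(3) that L(1) bd]) (use that in auto)
  show cont: "continuous_on ({-\<delta><..<\<delta>} \<times> N) \<phi>"
    by (rule continuous_dependence[OF N(1,2,4) Ck_on_imp_continuous_on[OF F] lipF L in_Y der
          Ck_on_imp_continuous_on[OF init]])
  have Dlin: "linear (D F (s, p, \<phi> (s, p)))" if "s \<in> I" "p \<in> N" for s p
    by (rule Ck_on_linear_D[OF F']) (use that in_Y in \<open>auto simp: W_def I_def\<close>)
  show contA: "continuous_on ({-\<delta><..<\<delta>} \<times> N) (\<lambda>(s, p). D (\<lambda>p. \<phi> (s, p)) p w)" for w
  proof (rule continuous_dependence[OF N(1) open_UNIV N(4), where F = "\<lambda>(s, p, y). D F (s, p, \<phi> (s, p)) (0, w, y)" and L = L])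
    have IN: "open (I \<times> N \<times> (UNIV::'b set))" by (intro open_Times I N) auto
    have "Ck_on 0 (I \<times> N \<times> (UNIV::'b set)) (\<lambda>x. D F (fst x, fst (snd x), \<phi> (fst x, fst (snd x))) (0, w, snd (snd x)))"
    proof (rule Ck_on_D_apply[OF IN W F'])
      have "continuous_on (I \<times> N \<times> (UNIV::'b set)) (\<lambda>x. \<phi> (fst x, fst (snd x)))"
        by (rule continuous_on_compose2[OF cont]) (auto intro!: continuous_intros simp: I_def)
      then show "Ck_on 0 (I \<times> N \<times> (UNIV::'b set)) (\<lambda>x. (fst x, fst (snd x), \<phi> (fst x, fst (snd x))))"
        by (auto intro!: continuous_intros)
      show "Ck_on 0 (I \<times> N \<times> (UNIV::'b set)) (\<lambda>x. (0, w, snd (snd x)))"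
        by (auto intro!: continuous_intros)
    qed (use in_Y in \<open>auto simp: W_def I_def\<close>)
    then show "continuous_on ({-\<delta><..<\<delta>} \<times> N \<times> UNIV) (\<lambda>(s, p, y). D F (s, p, \<phi> (s, p)) (0, w, y))"
      unfolding I_def by (simp add: case_prod_beta)
    show "norm ((case (s, p, y) of (s, p, y) \<Rightarrow> D F (s, p, \<phi> (s, p)) (0, w, y)) -
        (case (s, p, y') of (s, p, y) \<Rightarrow> D F (s, p, \<phi> (s, p)) (0, w, y))) \<le> L * norm (y - y')"
      if s: "s \<in> {-\<delta><..<\<delta>}" and p: "p \<in> N" for s p y y'
      using bd[OF s p in_Y[OF s p], of "y - y'"] linear_diff[OF Dlin[OF _ p, of s], of "(0, w, y)" "(0, w, y')"] s
      unfolding I_def by simp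
    show "((\<lambda>s. case (s, p) of (s, p) \<Rightarrow> D (\<lambda>p. \<phi> (s, p)) p w) has_vector_derivative
         (case (s, p, case (s, p) of (s, p) \<Rightarrow> D (\<lambda>p. \<phi> (s, p)) p w) of (s, p, y) \<Rightarrow> D F (s, p, \<phi> (s, p)) (0, w, y))) (at s)"
      if "s \<in> {-\<delta><..<\<delta>}" "p \<in> N" for s p
      using 1[OF that] by simp
    show "continuous_on N (\<lambda>p. case (0, p) of (s, p) \<Rightarrow> D (\<lambda>p. \<phi> (s, p)) p w)"
      using Ck_on_imp_continuous_on[OF Ck_on_D[OF init, of w]] by simp
  qed (use L in auto)
  show "(\<phi> has_derivative (\<lambda>(\<sigma>, w). \<sigma> *\<^sub>R F (s, p, \<phi> (s, p)) + D (\<lambda>p. \<phi> (s, p)) p w)) (at (s, p))"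
    if s: "s \<in> {-\<delta><..<\<delta>}" and p: "p \<in> N" for s p
  proof -
    define fy where "fy p s = blinfun_scaleR_left (F (s, p, \<phi> (s, p)))" for s p
    have op: "open (N \<times> I)" and mem: "(p, s) \<in> N \<times> I" using N(1) I s p by (auto simp: open_Times I_def)
    \<comment> \<open>The arguments are swapped because \<open>has_derivative_partialsI\<close>
      demands continuity of the partial derivative in the second variable, and the one in
      \<open>s\<close> is the right-hand side itself.\<close>
    have "((\<lambda>(p, s). \<phi> (s, p)) has_derivative (\<lambda>(w, \<sigma>). A s p w + fy p s \<sigma>)) (at (p, s) within N \<times> I)"
    proof (rule has_derivative_partialsI)
      show "((\<lambda>p. \<phi> (s, p)) has_derivative A s p) (at p within N)"
        using both[of s p] s p unfolding I_def by (blast intro: has_derivative_at_withinI)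
      show "((\<lambda>s. \<phi> (s, p)) has_derivative fy p s) (at s within I)" if "p \<in> N" "s \<in> I" for p s
        using der[of s p] that unfolding I_def fy_def has_vector_derivative_def
        by (auto intro: has_derivative_at_withinI)
      have c: "continuous_on (N \<times> I) (\<lambda>x. \<phi> (snd x, fst x))"
        by (rule continuous_on_compose2[OF cont]) (auto intro!: continuous_intros simp: I_def)
      have "continuous_on (N \<times> I) (\<lambda>x. F (snd x, fst x, \<phi> (snd x, fst x)))"
        by (rule continuous_on_compose2[OF Ck_on_imp_continuous_on[OF F]])
          (auto intro!: continuous_intros c[unfolded I_def] in_Y simp: I_def)
      then have "continuous_on (N \<times> I) (\<lambda>(p, s). fy p s)"
        unfolding fy_def case_prod_beta by (rule bounded_linear.continuous_on[OF bounded_linear_blinfun_scaleR_left])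
      then show "continuous (at (p, s) within N \<times> I) (\<lambda>(p, s). fy p s)"
        using mem continuous_on_eq_continuous_within by blast
    qed (use s in \<open>auto simp: I_def\<close>)
    then have 2: "((\<lambda>(p, s). \<phi> (s, p)) has_derivative (\<lambda>(w, \<sigma>). A s p w + fy p s \<sigma>)) (at (p, s))"
      unfolding at_within_open[OF mem op] .
    have 3: "((\<lambda>x. (snd x, fst x)) has_derivative (\<lambda>x. (snd x, fst x))) (at (s, p))"
      by (intro derivative_eq_intros) auto
    have "((\<lambda>x. case (snd x, fst x) of (p, s) \<Rightarrow> \<phi> (s, p)) has_derivative
        (\<lambda>x. case (snd x, fst x) of (w, \<sigma>) \<Rightarrow> A s p w + fy p s \<sigma>)) (at (s, p))"
      by (rule has_derivative_compose[OF 3]) (use 2 in simp)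
    then show ?thesis unfolding A_def fy_def by (simp add: case_prod_unfold add.commute)
  qed
qed

text \<open>Directional derivatives of the solution in the parameter solve the variational equation, which has
  the same form as the original equation, with one derivative less.\<close>

lemma smooth_dependence:
  fixes F :: "real \<times> 'p::euclidean_space \<times> 'b::euclidean_space \<Rightarrow> 'b"
  assumes N: "open N" "open Y" "convex Y" "\<delta> > 0"
    and F: "Ck_on (Suc k) ({-\<delta><..<\<delta>} \<times> N \<times> Y) F"
    and bd: "\<And>s p y e. s \<in> {-\<delta><..<\<delta>} \<Longrightarrow> p \<in> N \<Longrightarrow> y \<in> Y \<Longrightarrow> norm (D F (s, p, y) (0, 0, e)) \<le> L * norm e"
    and L: "L \<ge> 0" "L * \<delta> \<le> 1/4"
    and in_Y: "\<And>s p. s \<in> {-\<delta><..<\<delta>} \<Longrightarrow> p \<in> N \<Longrightarrow> \<phi> (s, p) \<in> Y"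
    and der: "\<And>s p. s \<in> {-\<delta><..<\<delta>} \<Longrightarrow> p \<in> N \<Longrightarrow>
        ((\<lambda>s. \<phi> (s, p)) has_vector_derivative F (s, p, \<phi> (s, p))) (at s)"
    and init: "Ck_on (Suc k) N (\<lambda>p. \<phi> (0, p))"
  shows "Ck_on (Suc k) ({-\<delta><..<\<delta>} \<times> N) \<phi>"
  using N(2,3) F bd in_Y der init
\<comment> \<open>The induction hypothesis is reused for another equation, whose state ranges over
  the whole space.\<close>
proof (induction k arbitrary: Y F \<phi>)
  case 0
  have C2: "continuous_on ({-\<delta><..<\<delta>} \<times> N) (\<lambda>(s, p). D (\<lambda>p. \<phi> (s, p)) p w)" for w
    by (rule dependence_C1(2)[OF N(1) 0(1,2) N(4) 0(3) 0(4) L 0(5,6,7)])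
  have C3: "continuous_on ({-\<delta><..<\<delta>} \<times> N) \<phi>"
    by (rule dependence_C1(3)[OF N(1) 0(1,2) N(4) 0(3) 0(4) L 0(5,6,7)])
  have C4: "(\<phi> has_derivative (\<lambda>(\<sigma>, w). \<sigma> *\<^sub>R F (s, p, \<phi> (s, p)) + D (\<lambda>p. \<phi> (s, p)) p w)) (at (s, p))"
    if "s \<in> {-\<delta><..<\<delta>}" "p \<in> N" for s p
    by (rule dependence_C1(4)[OF N(1) 0(1,2) N(4) 0(3) 0(4) L 0(5,6,7)]) (use that in auto)
  have op: "open ({-\<delta><..<\<delta>} \<times> N)" by (intro open_Times N) auto
  show ?case
  proof (rule Ck_on_SucI[OF op])
    show "(\<phi> has_derivative (\<lambda>(\<sigma>, w). \<sigma> *\<^sub>R F (fst x, snd x, \<phi> x) + D (\<lambda>p. \<phi> (fst x, p)) (snd x) w)) (at x)"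
      if "x \<in> {-\<delta><..<\<delta>} \<times> N" for x
      using C4[of "fst x" "snd x"] that by auto
    have "continuous_on ({-\<delta><..<\<delta>} \<times> N) (\<lambda>x. F (fst x, snd x, \<phi> x))"
      by (rule continuous_on_compose2[OF Ck_on_imp_continuous_on[OF 0(3)]])
        (use 0(5) in \<open>auto intro!: continuous_intros C3\<close>)
    then show "Ck_on 0 ({-\<delta><..<\<delta>} \<times> N) (\<lambda>x. case w of (\<sigma>, w) \<Rightarrow> \<sigma> *\<^sub>R F (fst x, snd x, \<phi> x) + D (\<lambda>p. \<phi> (fst x, p)) (snd x) w)" for w
      using C2[of "snd w"] by (auto simp: case_prod_beta intro!: continuous_intros)
  qed
next
  case (Suc k)
  note F = Suc.prems(3) and in_Y = Suc.prems(5) and init = Suc.prems(7)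
  note F1 = Ck_on_le[OF F, of "Suc 0", OF Suc_le_mono[THEN iffD2, OF le0]]
  note i1 = Ck_on_le[OF init, of "Suc 0", OF Suc_le_mono[THEN iffD2, OF le0]]
  have C1: "((\<lambda>s. D (\<lambda>p. \<phi> (s, p)) p w) has_vector_derivative D F (s, p, \<phi> (s, p)) (0, w, D (\<lambda>p. \<phi> (s, p)) p w)) (at s)"
    if "s \<in> {-\<delta><..<\<delta>}" "p \<in> N" for s p w
    by (rule dependence_C1(1)[OF N(1) Suc.prems(1,2) N(4) F1 Suc.prems(4) L in_Y Suc.prems(6) i1]) (use that in auto)
  have C4: "(\<phi> has_derivative (\<lambda>(\<sigma>, w). \<sigma> *\<^sub>R F (s, p, \<phi> (s, p)) + D (\<lambda>p. \<phi> (s, p)) p w)) (at (s, p))"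
    if "s \<in> {-\<delta><..<\<delta>}" "p \<in> N" for s p
    by (rule dependence_C1(4)[OF N(1) Suc.prems(1,2) N(4) F1 Suc.prems(4) L in_Y Suc.prems(6) i1]) (use that in auto)
  have \<phi>: "Ck_on (Suc k) ({-\<delta><..<\<delta>} \<times> N) \<phi>"
    by (rule Suc.IH[OF Suc.prems(1,2) Ck_on_SucD[OF F] Suc.prems(4) in_Y Suc.prems(6) Ck_on_SucD[OF init]])
  have op: "open ({-\<delta><..<\<delta>} \<times> N)" by (intro open_Times N) auto
  have opY: "open ({-\<delta><..<\<delta>} \<times> N \<times> Y)" by (intro open_Times N Suc.prems) auto
  have opU: "open ({-\<delta><..<\<delta>} \<times> N \<times> (UNIV::'b set))" by (intro open_Times N) auto
  have curve: "Ck_on (Suc k) ({-\<delta><..<\<delta>} \<times> N) (\<lambda>x. (fst x, snd x, \<phi> x))"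
    by (intro Ck_on_Pair Ck_on_fst Ck_on_snd Ck_on_ident \<phi> op)
  have FC: "Ck_on (Suc k) ({-\<delta><..<\<delta>} \<times> N) (\<lambda>x. F (fst x, snd x, \<phi> x))"
    by (rule Ck_on_compose[OF op opY curve Ck_on_SucD[OF F]]) (use in_Y in auto)
  define A where "A w = (\<lambda>(s, p). D (\<lambda>p. \<phi> (s, p)) p w)" for w
  have AC: "Ck_on (Suc k) ({-\<delta><..<\<delta>} \<times> N) (A w)" for w
  proof (rule Suc.IH[OF open_UNIV convex_UNIV, where F = "\<lambda>x. D F (fst x, fst (snd x), \<phi> (fst x, fst (snd x))) (0, w, snd (snd x))"])
    have pr: "Ck_on (Suc k) ({-\<delta><..<\<delta>} \<times> N \<times> (UNIV::'b set)) (\<lambda>x. (fst x, fst (snd x)))"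
      by (intro Ck_on_Pair Ck_on_fst Ck_on_snd Ck_on_ident opU)
    have "Ck_on (Suc k) ({-\<delta><..<\<delta>} \<times> N \<times> (UNIV::'b set)) (\<lambda>x. \<phi> (fst x, fst (snd x)))"
      by (rule Ck_on_compose[OF opU op pr \<phi>]) auto
    then have g: "Ck_on (Suc k) ({-\<delta><..<\<delta>} \<times> N \<times> (UNIV::'b set)) (\<lambda>x. (fst x, fst (snd x), \<phi> (fst x, fst (snd x))))"
      by (intro Ck_on_Pair Ck_on_fst Ck_on_snd Ck_on_ident opU)
    have h: "Ck_on (Suc k) ({-\<delta><..<\<delta>} \<times> N \<times> (UNIV::'b set)) (\<lambda>x. (0, w, snd (snd x)))"
      by (intro Ck_on_Pair Ck_on_snd Ck_on_ident Ck_on_const opU)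
    show "Ck_on (Suc k) ({-\<delta><..<\<delta>} \<times> N \<times> (UNIV::'b set)) (\<lambda>x. D F (fst x, fst (snd x), \<phi> (fst x, fst (snd x))) (0, w, snd (snd x)))"
      by (rule Ck_on_D_apply[OF opU opY F g h]) (use in_Y in auto)
    show "((\<lambda>s. A w (s, p)) has_vector_derivative
        D F (fst (s, p, A w (s, p)), fst (snd (s, p, A w (s, p))), \<phi> (fst (s, p, A w (s, p)), fst (snd (s, p, A w (s, p)))))
          (0, w, snd (snd (s, p, A w (s, p))))) (at s)"
      if "s \<in> {-\<delta><..<\<delta>}" "p \<in> N" for s p
      using C1[OF that] unfolding A_def by simp
    show "Ck_on (Suc k) N (\<lambda>p. A w (0, p))"
      using Ck_on_D[OF init] unfolding A_def by simp
    fix s p and y e :: 'b assume s: "s \<in> {-\<delta><..<\<delta>}" and p: "p \<in> N"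
    define q where "q = (\<lambda>x::real \<times> 'p \<times> 'b. (fst x, fst (snd x), \<phi> (fst x, fst (snd x))))"
    define G where "G = (\<lambda>x. D F (q x) (0, w, snd (snd x)))"
    have qV: "q (s, p, y) \<in> {-\<delta><..<\<delta>} \<times> N \<times> Y" for y unfolding q_def using s p in_Y by auto
    have lin: "linear (D F (s, p, \<phi> (s, p)))" by (rule Ck_on_linear_D[OF F]) (use s p in_Y in auto)
    have "Ck_on (Suc k) ({-\<delta><..<\<delta>} \<times> N \<times> (UNIV::'b set)) G"
      unfolding G_def q_def by (rule Ck_on_D_apply[OF opU opY F g h]) (use in_Y in auto)
    then have G1: "(G has_derivative D G (s, p, y)) (at (s, p, y))"
      by (rule Ck_on_has_derivative) (use s p in auto)
    have G2: "((\<lambda>y. (s, p, y)) has_derivative (\<lambda>e. (0, 0, e))) (at y)"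
      by (auto intro!: derivative_eq_intros)
    have Ga: "((\<lambda>y. G (s, p, y)) has_derivative (\<lambda>e. D G (s, p, y) (0, 0, e))) (at y)"
      by (rule has_derivative_compose[OF G2 G1])
    \<comment> \<open>The variational right-hand side is affine in its state, so its derivative in
      the state is that of \<open>F\<close> along the solution, and \<open>L\<close> serves again
      with the same \<delta>.\<close>
    have Geq: "(\<lambda>y. G (s, p, y)) = (\<lambda>y. D F (s, p, \<phi> (s, p)) (0, w, 0) + D F (s, p, \<phi> (s, p)) (0, 0, y))"
    proof (rule ext)
      fix y show "G (s, p, y) = D F (s, p, \<phi> (s, p)) (0, w, 0) + D F (s, p, \<phi> (s, p)) (0, 0, y)"
        unfolding G_def q_def using linear_add[OF lin, of "(0, w, 0)" "(0, 0, y)"] by simp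
    qed
    have Gd: "((\<lambda>y. D F (s, p, \<phi> (s, p)) (0, w, 0) + D F (s, p, \<phi> (s, p)) (0, 0, y)) has_derivative
        (\<lambda>e. D F (s, p, \<phi> (s, p)) (0, 0, e))) (at y)"
    proof -
      have "bounded_linear (\<lambda>y. D F (s, p, \<phi> (s, p)) (0, 0, y))"
        using bounded_linear_compose[OF linear_conv_bounded_linear[THEN iffD1, OF lin], of "\<lambda>y. (0, 0, y)"]
        by (simp add: bounded_linear_Pair bounded_linear_zero bounded_linear_ident)
      then show ?thesis by (auto intro!: derivative_eq_intros bounded_linear_imp_has_derivative)
    qed
    have "(\<lambda>e. D G (s, p, y) (0, 0, e)) = (\<lambda>e. D F (s, p, \<phi> (s, p)) (0, 0, e))"
      by (rule has_derivative_unique[OF Ga[unfolded Geq] Gd])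
    then have "D G (s, p, y) (0, 0, e) = D F (s, p, \<phi> (s, p)) (0, 0, e)" by (rule fun_cong)
    then show "norm (D (\<lambda>x. D F (fst x, fst (snd x), \<phi> (fst x, fst (snd x))) (0, w, snd (snd x))) (s, p, y) (0, 0, e)) \<le> L * norm e"
      using Suc.prems(4)[OF s p in_Y[OF s p], of e] unfolding G_def q_def by simp
  qed auto
  show ?case
  proof (rule Ck_on_SucI[OF op])
    show "(\<phi> has_derivative (\<lambda>(\<sigma>, w). \<sigma> *\<^sub>R F (fst x, snd x, \<phi> x) + A w x)) (at x)"
      if "x \<in> {-\<delta><..<\<delta>} \<times> N" for x
      using C4[of "fst x" "snd x"] that unfolding A_def by auto
    show "Ck_on (Suc k) ({-\<delta><..<\<delta>} \<times> N) (\<lambda>x. case w of (\<sigma>, w) \<Rightarrow> \<sigma> *\<^sub>R F (fst x, snd x, \<phi> x) + A w x)" for w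
      unfolding case_prod_beta by (intro Ck_on_add Ck_on_scaleR Ck_on_const FC AC op)
  qed
qed

text \<open>Compactness of \<open>K\<close> yields one radius and one \<delta> for all starting
  points near \<open>K\<close>. Smoothness is obtained with the starting point as parameter, ball by
  ball because \<open>smooth_dependence\<close> asks for a convex state domain, and then
  patched.\<close>

lemma local_flow:
  fixes V :: "'a::euclidean_space \<Rightarrow> 'a"
  assumes W: "open W" and V: "\<And>k. Ck_on k W V" and K: "compact K" "K \<subseteq> W"
  obtains \<delta> N \<Phi> where "\<delta> > 0" "open N" "K \<subseteq> N" "N \<subseteq> W" "\<And>k. Ck_on k ({-\<delta><..<\<delta>} \<times> N) \<Phi>"
    "\<And>p. p \<in> N \<Longrightarrow> \<Phi> (0, p) = p"
    "\<And>s p. s \<in> {-\<delta><..<\<delta>} \<Longrightarrow> p \<in> N \<Longrightarrow> \<Phi> (s, p) \<in> W"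
    "\<And>s p. s \<in> {-\<delta><..<\<delta>} \<Longrightarrow> p \<in> N \<Longrightarrow> ((\<lambda>s. \<Phi> (s, p)) has_vector_derivative V (\<Phi> (s, p))) (at s)"
proof -
  obtain r0 K' where K': "r0 > 0" "compact K'" "K' \<subseteq> W" "\<And>q x. q \<in> K \<Longrightarrow> dist q x \<le> r0 \<Longrightarrow> x \<in> K'"
    using compact_neighbourhood[OF K(1) W K(2)] by blast
  have V1: "Ck_on (Suc 0) W V" by (rule V)
  obtain L where L: "L > 0" "\<And>q w. q \<in> K' \<Longrightarrow> norm (D V q w) \<le> L * norm w"
    by (rule bounded_D_compact[OF K'(2,3) V1]) meson
  have contV: "continuous_on K' V"
    by (rule continuous_on_subset[OF Ck_on_imp_continuous_on[OF V1] K'(3)])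
  have "bounded (V ` K')"
    by (intro compact_imp_bounded compact_continuous_image contV K'(2))
  then obtain M where M: "M > 0" "\<And>q. q \<in> K' \<Longrightarrow> norm (V q) \<le> M" unfolding bounded_pos by auto
  \<comment> \<open>A starting point within \<open>r\<close> of \<open>q\<close> moves by at most
    \<open>r\<close>, hence stays in \<open>ball q (3 * r)\<close>, which lies in \<open>K'\<close>.
    In \<delta> the first bound is the smallness condition relative to \<open>L\<close>, the second
    confines the motion to radius \<open>r\<close>.\<close>
  define r where "r = r0 / 3"
  define \<delta> where "\<delta> = min (1 / (4 * L)) (r / (M + L * r))"
  have r: "r > 0" "3 * r = r0" unfolding r_def using K' by auto
  have Mr: "M + L * r > 0" using M L r by (intro add_pos_pos mult_pos_pos)
  have \<delta>: "\<delta> > 0" "L * \<delta> \<le> 1/4" "\<delta> * (M + L * r) \<le> r"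
  proof -
    show "\<delta> > 0" unfolding \<delta>_def using L r Mr by simp
    have "L * \<delta> \<le> L * (1 / (4 * L))" unfolding \<delta>_def using L by (intro mult_left_mono) auto
    then show "L * \<delta> \<le> 1/4" using L by simp
    have "\<delta> * (M + L * r) \<le> (r / (M + L * r)) * (M + L * r)" unfolding \<delta>_def using Mr by (intro mult_right_mono) auto
    then show "\<delta> * (M + L * r) \<le> r" using Mr by simp
  qed
  define N where "N = (\<Union>q\<in>K. ball q r)"
  have ballK': "x \<in> K'" if "q \<in> K" "x \<in> ball q (3 * r)" for q x using K'(4)[OF that(1), of x] that(2) r by auto
  have "\<exists>\<eta>. \<eta> 0 = p \<and> (\<forall>s\<in>{-\<delta>..\<delta>}. \<eta> s \<in> cball p r \<and> (\<eta> has_vector_derivative V (\<eta> s)) (at s within {-\<delta>..\<delta>}))"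
    if pN: "p \<in> N" for p
  proof -
    obtain q where q: "q \<in> K" "dist q p < r" using pN unfolding N_def by auto
    have sub: "cball p r \<subseteq> K'"
    proof
      fix x assume "x \<in> cball p r"
      then show "x \<in> K'" using ballK'[OF q(1), of x] q(2) dist_triangle[of q x p] r(1) by auto
    qed
    show ?thesis
    proof (rule picard_existence[where d = \<delta> and ?y0.0 = p and r = r and G = "\<lambda>x. V (snd x)" and L = L and M = M])
      show "continuous_on ({-\<delta>..\<delta>} \<times> cball p r) (\<lambda>x. V (snd x))"
        by (rule continuous_on_compose2[OF contV]) (use sub in \<open>auto intro!: continuous_intros\<close>)
      show "norm (V (snd (s, x)) - V (snd (s, y))) \<le> L * norm (x - y)" if "x \<in> cball p r" "y \<in> cball p r" for s :: real and x y
        unfolding snd_conv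
      proof (rule differentiable_bound[OF convex_cball _ _ that])
        show "(V has_derivative D V x) (at x within cball p r)" if "x \<in> cball p r" for x
          by (rule has_derivative_at_withinI[OF Ck_on_has_derivative[OF V1]]) (use that sub K' in auto)
        show "onorm (D V x) \<le> L" if "x \<in> cball p r" for x
          by (rule onorm_bound) (use that sub L in auto)
      qed
      show "norm (V (snd (s, p))) \<le> M" for s :: real using M(2)[OF subsetD[OF sub]] r by simp
      show "L * \<delta> \<le> 1/2" using \<delta>(2) by simp
      fix \<eta> assume "\<eta> 0 = p" "\<And>s. s \<in> {-\<delta>..\<delta>} \<Longrightarrow> \<eta> s \<in> cball p r"
        "\<And>s. s \<in> {-\<delta>..\<delta>} \<Longrightarrow> (\<eta> has_vector_derivative V (snd (s, \<eta> s))) (at s within {-\<delta>..\<delta>})"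
      then show ?thesis by auto
    qed (use r L \<delta> in auto)
  qed
  then obtain \<eta> where \<eta>: "\<And>p. p \<in> N \<Longrightarrow> \<eta> p 0 = p" "\<And>p s. p \<in> N \<Longrightarrow> s \<in> {-\<delta>..\<delta>} \<Longrightarrow> \<eta> p s \<in> cball p r"
    "\<And>p s. p \<in> N \<Longrightarrow> s \<in> {-\<delta>..\<delta>} \<Longrightarrow> (\<eta> p has_vector_derivative V (\<eta> p s)) (at s within {-\<delta>..\<delta>})"
    by metis
  define \<Phi> where "\<Phi> = (\<lambda>(s, p). \<eta> p s)"
  have der: "((\<lambda>s. \<Phi> (s, p)) has_vector_derivative V (\<Phi> (s, p))) (at s)" if "s \<in> {-\<delta><..<\<delta>}" "p \<in> N" for s p
    using \<eta>(3)[OF that(2), of s] that(1) at_within_Icc_at[of "-\<delta>" s \<delta>] unfolding \<Phi>_def by simp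
  have N0: "\<Phi> (0, p) = p" if "p \<in> N" for p unfolding \<Phi>_def using \<eta>(1)[OF that] by simp
  have in_ball: "\<Phi> (s, p) \<in> ball q (3 * r)" if "q \<in> K" "p \<in> ball q r" "s \<in> {-\<delta><..<\<delta>}" for s p q
  proof -
    have "p \<in> N" using that unfolding N_def by auto
    then have "\<eta> p s \<in> cball p r" using \<eta>(2) that(3) by auto
    then show ?thesis using that(2) dist_triangle[of q "\<eta> p s" p] r(1) unfolding \<Phi>_def by auto
  qed
  have smooth: "Ck_on (Suc k) ({-\<delta><..<\<delta>} \<times> ball q r) \<Phi>" if q: "q \<in> K" for k q
  proof (rule smooth_dependence[where N = "ball q r" and Y = "ball q (3 * r)" and \<delta> = \<delta> and F = "\<lambda>x. V (snd (snd x))" and L = L])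
    have op: "open ({-\<delta><..<\<delta>} \<times> ball q r \<times> ball q (3 * r))" by (intro open_Times) auto
    have pr: "Ck_on (Suc k) ({-\<delta><..<\<delta>} \<times> ball q r \<times> ball q (3 * r)) (\<lambda>x. snd (snd x))"
      by (intro Ck_on_snd Ck_on_ident op)
    show "Ck_on (Suc k) ({-\<delta><..<\<delta>} \<times> ball q r \<times> ball q (3 * r)) (\<lambda>x. V (snd (snd x)))"
      by (rule Ck_on_compose[OF op W pr V]) (use ballK'[OF q] K'(3) in auto)
    show "norm (D (\<lambda>x. V (snd (snd x))) (s, p, y) (0, 0, e)) \<le> L * norm e"
      if "y \<in> ball q (3 * r)" for s :: real and p :: 'a and y e
    proof -
      have y: "y \<in> K'" using ballK'[OF q that] .
      have 1: "(V has_derivative D V y) (at y)" using Ck_on_has_derivative[OF V1] y K'(3) by blast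
      have 2: "((\<lambda>x. snd (snd x)) has_derivative (\<lambda>x. snd (snd x))) (at (s, p, y))"
        by (auto intro!: derivative_eq_intros)
      have "((\<lambda>x. V (snd (snd x))) has_derivative (\<lambda>x. D V y (snd (snd x)))) (at (s, p, y))"
        using has_derivative_compose[OF 2, of V "D V y"] 1 by simp
      then show ?thesis using L(2)[OF y] by (simp add: D_eqI)
    qed
    have "Ck_on (Suc k) (ball q r) (\<lambda>p. p)" by (intro Ck_on_ident) auto
    then show "Ck_on (Suc k) (ball q r) (\<lambda>p. \<Phi> (0, p))"
      by (rule Ck_on_cong[rotated 2]) (use q in \<open>auto simp: N_def intro!: N0[symmetric]\<close>)
    show "((\<lambda>s. \<Phi> (s, p)) has_vector_derivative V (snd (snd (s, p, \<Phi> (s, p))))) (at s)"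
      if "s \<in> {-\<delta><..<\<delta>}" "p \<in> ball q r" for s p
      using der[OF that(1), of p] that(2) q unfolding N_def by auto
  qed (use L \<delta> in_ball[OF q] in auto)
  have "Ck_on (Suc k) (\<Union>q\<in>K. {-\<delta><..<\<delta>} \<times> ball q r) \<Phi>" for k
    by (rule Ck_on_Union) (auto intro: open_Times smooth)
  moreover have "(\<Union>q\<in>K. {-\<delta><..<\<delta>} \<times> ball q r) = {-\<delta><..<\<delta>} \<times> N" unfolding N_def by auto
  ultimately have "Ck_on k ({-\<delta><..<\<delta>} \<times> N) \<Phi>" for k using Ck_on_SucD by metis
  moreover have "\<Phi> (s, p) \<in> W" if "s \<in> {-\<delta><..<\<delta>}" "p \<in> N" for s p
    using that in_ball ballK' K'(3) unfolding N_def by blast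
  moreover have "open N" "K \<subseteq> N" unfolding N_def using r by auto
  moreover have "N \<subseteq> W"
  proof
    fix x assume "x \<in> N"
    then obtain q where "q \<in> K" "x \<in> ball q r" unfolding N_def by blast
    then show "x \<in> W" using ballK'[of q x] r(1) K'(3) by auto
  qed
  ultimately show ?thesis using that[OF \<delta>(1) _ _ _ _ N0 _ der] by blast
qed

section \<open>Invariance of regular level sets\<close>

text \<open>A simplified Newton scheme: with a linear right inverse \<open>R\<close> of
  \<open>D G b0\<close> on \<open>V\<close>, a correction \<open>R y\<close> that makes
  \<open>b + R y\<close> a zero is a fixed point of \<open>T y = y - G (b + R y)\<close>, a
  contraction near \<open>b0\<close>. The fixed point has norm at most
  \<open>2 * norm (G b)\<close>. The radius \<open>\<rho>0\<close> makes the zero lie where further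
  local bounds are available.\<close>

lemma metric_regularity:
  fixes G :: "'a::euclidean_space \<Rightarrow> 'a"
  assumes B: "open B" "Ck_on (Suc 0) B G" "b0 \<in> B" "G b0 = 0"
    and V: "subspace V" "\<And>b. b \<in> B \<Longrightarrow> G b \<in> V" "V \<subseteq> range (D G b0)" and \<rho>0: "\<rho>0 > 0"
  shows "\<exists>C \<rho>. C > 0 \<and> \<rho> > 0 \<and> (\<forall>b. norm (b - b0) < \<rho> \<longrightarrow>
      (\<exists>b'\<in>B. G b' = 0 \<and> norm (b' - b0) < \<rho>0 \<and> norm (b - b') \<le> C * norm (G b)))"
proof -
  have lin: "linear (D G b0)" by (rule Ck_on_linear_D[OF B(2,3)])
  obtain R where R: "linear R" "\<And>v. v \<in> V \<Longrightarrow> D G b0 (R v) = v"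
    using linear_exists_right_inverse_on[OF lin subspace_UNIV] V(3) by blast
  obtain c where c: "c > 0" "\<And>v. norm (R v) \<le> c * norm v"
    using bounded_linear.pos_bounded[OF linear_conv_bounded_linear[THEN iffD1, OF R(1)]] by (metis mult.commute)
  \<comment> \<open>With linearization error \<kappa> and \<open>norm (R y) \<le> c * norm y\<close>
    the contraction factor is \<open>\<kappa> * c = 1/2\<close>.\<close>
  define \<kappa> where "\<kappa> = 1 / (2 * c)"
  have \<kappa>: "\<kappa> > 0" "\<kappa> * c = 1/2" unfolding \<kappa>_def using c by auto
  have "\<exists>d>0. \<forall>x y. norm (x - b0) < d \<longrightarrow> norm (y - b0) < d \<longrightarrow>
      x \<in> B \<and> norm (G y - G x - D G b0 (y - x)) \<le> \<kappa> * norm (y - x)"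
    by (rule uniform_differentiability[OF compact_sing B(1) _ B(2) \<kappa>(1), of b0]) (use B(3) in \<open>simp, meson insertI1\<close>)
  then obtain d0 where d0: "d0 > 0" "\<And>x. norm (x - b0) < d0 \<Longrightarrow> x \<in> B"
    "\<And>x y. norm (x - b0) < d0 \<Longrightarrow> norm (y - b0) < d0 \<Longrightarrow> norm (G y - G x - D G b0 (y - x)) \<le> \<kappa> * norm (y - x)"
    by metis
  define d1 where "d1 = min d0 \<rho>0"
  \<comment> \<open>\<open>R\<close> maps vectors of norm at most \<open>\<rho>1\<close> to norm at
    most \<open>d1 / 2\<close>; the other half of \<open>d1\<close> is left for
    \<open>b - b0\<close>.\<close>
  define \<rho>1 where "\<rho>1 = d1 / (2 * c)"
  have d1: "d1 > 0" "d1 \<le> d0" "d1 \<le> \<rho>0" and \<rho>1: "\<rho>1 > 0" "c * \<rho>1 = d1 / 2"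
    unfolding d1_def \<rho>1_def using d0 \<rho>0 c by auto
  have "isCont G b0"
    using Ck_on_imp_continuous_on[OF B(2)] B(1,3) continuous_on_eq_continuous_at by blast
  then obtain d2 where d2: "d2 > 0" "\<And>b. norm (b - b0) < d2 \<Longrightarrow> norm (G b) < \<rho>1 / 2"
    using \<rho>1 B(4) unfolding continuous_at_eps_delta by (metis diff_zero dist_norm half_gt_zero)
  define \<rho> where "\<rho> = min d2 (d1 / 2)"
  have main: "\<exists>b'\<in>B. G b' = 0 \<and> norm (b' - b0) < \<rho>0 \<and> norm (b - b') \<le> (2 * c) * norm (G b)" if b: "norm (b - b0) < \<rho>" for b
  proof -
    define S where "S = V \<inter> cball 0 \<rho>1"
    define T where "T y = y - G (b + R y)" for y
    have near: "norm (b + R y - b0) < d1" if "y \<in> S" for y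
    proof -
      have "norm (R y) \<le> c * \<rho>1" using order_trans[OF c(2)[of y]] that c(1) unfolding S_def by (simp add: mult_left_mono)
      then show ?thesis using norm_triangle_ineq[of "b - b0" "R y"] b \<rho>1 unfolding \<rho>_def by (simp add: algebra_simps)
    qed
    have contr: "norm (T y - T y') \<le> (1/2) * norm (y - y')" if y: "y \<in> S" "y' \<in> S" for y y'
    proof -
      have "y' - y \<in> V" using y V(1) unfolding S_def by (auto intro: subspace_diff)
      then have "D G b0 ((b + R y') - (b + R y)) = y' - y"
        using R(2)[of "y' - y"] linear_diff[OF R(1), of y' y] by simp
      then have "T y - T y' = G (b + R y') - G (b + R y) - D G b0 ((b + R y') - (b + R y))"
        unfolding T_def by simp
      then have "norm (T y - T y') \<le> \<kappa> * norm ((b + R y') - (b + R y))"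
        using d0(3)[of "b + R y" "b + R y'"] near[OF y(1)] near[OF y(2)] d1 by simp
      also have "\<dots> \<le> \<kappa> * (c * norm (y' - y))"
        using c(2)[of "y' - y"] \<kappa> linear_diff[OF R(1)] by (intro mult_left_mono) auto
      finally show ?thesis using \<kappa>(2) by (simp add: mult.assoc[symmetric] norm_minus_commute)
    qed
    have z: "0 \<in> S" unfolding S_def using V(1) \<rho>1 by (auto intro: subspace_0)
    have T0: "T 0 = - G b" unfolding T_def using linear_0[OF R(1)] by simp
    have "\<exists>!y. y \<in> S \<and> T y = y"
    proof (rule Banach_fix[where c = "1/2"])
      show "complete S" unfolding complete_eq_closed S_def
        by (intro closed_Int closed_subspace V closed_cball)
      show "S \<noteq> {}" using z by blast
      show "T ` S \<subseteq> S"
      proof safe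
        fix y assume y: "y \<in> S"
        have "b + R y \<in> B" using d0(2) near[OF y] d1 by simp
        then have "T y \<in> V" unfolding T_def using y V unfolding S_def by (auto intro: subspace_diff)
        moreover have "norm (T y) \<le> norm (T y - T 0) + norm (T 0)" using norm_triangle_sub[of "T y" "T 0"] by simp
        moreover have "norm (T y - T 0) \<le> \<rho>1 / 2" using contr[OF y z] y unfolding S_def by simp
        moreover have "norm (T 0) \<le> \<rho>1 / 2" using d2(2)[of b] b unfolding T0 \<rho>_def by simp
        ultimately show "T y \<in> S" unfolding S_def by simp
      qed
      show "dist (T y) (T y') \<le> (1/2) * dist y y'" if "y \<in> S" "y' \<in> S" for y y'
        using contr[OF that] by (simp add: dist_norm)
    qed auto
    then obtain y where y: "y \<in> S" "T y = y" by blast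
    have "norm y \<le> norm (T y - T 0) + norm (T 0)" using norm_triangle_sub[of "T y" "T 0"] y(2) by simp
    then have "norm y \<le> 2 * norm (G b)" using contr[OF y(1) z] T0 by simp
    then have "norm (R y) \<le> (2 * c) * norm (G b)" 
      using c(2)[of y] mult_left_mono[OF \<open>norm y \<le> 2 * norm (G b)\<close> less_imp_le[OF c(1)]] by linarith
    moreover have "G (b + R y) = 0" using y(2) unfolding T_def by simp
    ultimately show ?thesis using near[OF y(1)] d1 d0(2) by (intro bexI[of _ "b + R y"]) auto
  qed
  have "\<rho> > 0" unfolding \<rho>_def using d2 d1 by simp
  moreover have "2 * c > 0" using c by simp
  ultimately show ?thesis using main by blast
qed

text \<open>Full rank makes the indexed vectors distinct and independent. The witness is a nonzero
  vector of their span orthogonal to all \<open>a m\<close> with \<open>m \<noteq> l\<close>,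
  rescaled; it would vanish if it were also orthogonal to \<open>a l\<close>.\<close>

lemma dual_vector:
  fixes a :: "nat \<Rightarrow> 'a::euclidean_space"
  assumes "dim (a ` I) = card I" "finite I" "l \<in> I"
  obtains y where "a l \<bullet> y = 1" "\<And>m. m \<in> I \<Longrightarrow> m \<noteq> l \<Longrightarrow> a m \<bullet> y = 0"
proof -
  have fin: "finite (a ` I)" using assms by simp
  have "card (a ` I) = card I"
    using card_image_le[OF assms(2), of a] dim_le_card'[OF fin] assms(1) by simp
  then have inj: "inj_on a I" using assms(2) by (simp add: eq_card_imp_inj_on)
  have "independent (a ` I)"
    by (rule card_le_dim_spanning[OF subset_refl span_superset fin]) (simp add: assms \<open>card (a ` I) = card I\<close>)
  moreover define S where "S = a ` (I - {l})"
  moreover have "a ` I - {a l} = S" unfolding S_def using inj assms(3) by (auto simp: inj_on_def)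
  ultimately have nin: "a l \<notin> span S" using assms(3) unfolding dependent_def by (metis imageI)
  have "span S \<subset> span (insert (a l) S)"
    using nin span_mono[of S "insert (a l) S"] span_base[of "a l" "insert (a l) S"] by blast
  then obtain x where x: "x \<noteq> 0" "x \<in> span (insert (a l) S)" "\<And>y. y \<in> span S \<Longrightarrow> orthogonal x y"
    using orthogonal_to_subspace_exists_gen by blast
  have ne: "x \<bullet> a l \<noteq> 0"
  proof
    assume 0: "x \<bullet> a l = 0"
    have "orthogonal x y" if "y \<in> span (insert (a l) S)" for y
      using that
    proof (rule span_induct)
      show "subspace {y. orthogonal x y}" by (rule subspace_orthogonal_to_vector)
      show "\<And>y. y \<in> insert (a l) S \<Longrightarrow> orthogonal x y" using 0 x(3) span_base by (auto simp: orthogonal_def)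
    qed
    then have "x \<bullet> x = 0" using x(2) unfolding orthogonal_def by blast
    then show False using x(1) by simp
  qed
  show ?thesis
  proof (rule that[of "x /\<^sub>R (x \<bullet> a l)"])
    show "a l \<bullet> (x /\<^sub>R (x \<bullet> a l)) = 1" using ne by (simp add: inner_commute)
    fix m assume "m \<in> I" "m \<noteq> l"
    then have "a m \<in> span S" unfolding S_def by (auto intro: span_base)
    then show "a m \<bullet> (x /\<^sub>R (x \<bullet> a l)) = 0" using x(3)[of "a m"] by (simp add: orthogonal_def inner_commute)
  qed
qed

text \<open>\<open>g'\<close> is the Lie derivative of \<open>g\<close> along the curves \<open>c\<close>.  It is Lipschitz and vanishes on the zero set
  of \<open>g\<close>, whose distance from \<open>c s\<close> is at most \<open>C \<bar>g (c s)\<bar>\<close> by metric regularity; hence \<open>g \<circ> c\<close> obeys a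
  linear differential inequality.  The \<open>n\<close> functions are packed into one map of the space into itself because
  \<open>n\<close> is not a type.\<close>

lemma invariant_level_set:
  fixes g g' :: "nat \<Rightarrow> 'a::euclidean_space \<Rightarrow> real" and n :: nat
  assumes B: "open B"
    and g: "\<And>l. l \<in> {1..n} \<Longrightarrow> Ck_on (Suc 0) B (g l)"
    and g': "\<And>l. l \<in> {1..n} \<Longrightarrow> Ck_on (Suc 0) B (g' l)"
    and tangent: "\<And>b l. b \<in> B \<Longrightarrow> (\<And>m. m \<in> {1..n} \<Longrightarrow> g m b = 0) \<Longrightarrow> l \<in> {1..n} \<Longrightarrow> g' l b = 0"
    and rank: "\<And>b. b \<in> B \<Longrightarrow> (\<And>m. m \<in> {1..n} \<Longrightarrow> g m b = 0) \<Longrightarrow>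
        dim ((\<lambda>l. \<Sum>i\<in>Basis. D (g l) b i *\<^sub>R i) ` {1..n}) = n"
    and c: "continuous_on {s1..s2} c" "\<And>s. s \<in> {s1..s2} \<Longrightarrow> c s \<in> B"
    and der: "\<And>s l. s \<in> {s1..s2} \<Longrightarrow> l \<in> {1..n} \<Longrightarrow>
        ((\<lambda>s. g l (c s)) has_vector_derivative g' l (c s)) (at s within {s1..s2})"
    and s0: "s0 \<in> {s1..s2}" "\<And>l. l \<in> {1..n} \<Longrightarrow> g l (c s0) = 0" and s: "s \<in> {s1..s2}" and l: "l \<in> {1..n}"
  shows "g l (c s) = 0"
proof -
  have "dim ((\<lambda>l. \<Sum>i\<in>Basis. D (g l) (c s0) i *\<^sub>R i) ` {1..n}) = n"
    by (rule rank[OF c(2)[OF s0(1)]]) (rule s0(2))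
  then have "n \<le> DIM('a)" using dim_subset_UNIV by (metis (no_types))
  \<comment> \<open>The rank at \<open>c s0\<close> bounds \<open>n\<close> by the dimension, so
    there are enough basis vectors to serve as labels of the \<open>n\<close> functions.\<close>
  then have "\<exists>\<beta>::nat \<Rightarrow> 'a. \<beta> ` {1..n} \<subseteq> Basis \<and> inj_on \<beta> {1..n}"
    by (intro card_le_inj) simp_all
  then obtain \<beta> :: "nat \<Rightarrow> 'a" where \<beta>: "\<beta> ` {1..n} \<subseteq> Basis" "inj_on \<beta> {1..n}"
    by blast
  define G where "G b = (\<Sum>l\<in>{1..n}. g l b *\<^sub>R \<beta> l)" for b
  have coord: "(\<Sum>l\<in>{1..n}. x l *\<^sub>R \<beta> l) \<bullet> \<beta> m = x m" if m: "m \<in> {1..n}" for x :: "nat \<Rightarrow> real" and m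
  proof -
    have "(\<Sum>l\<in>{1..n}. x l *\<^sub>R \<beta> l) \<bullet> \<beta> m = (\<Sum>l\<in>{1..n}. if l = m then x l else 0)"
      unfolding inner_sum_left
    proof (rule sum.cong)
      fix l assume l: "l \<in> {1..n}"
      have "\<beta> l \<in> Basis" "\<beta> m \<in> Basis" using \<beta>(1) l m by blast+
      moreover have "\<beta> l = \<beta> m \<longleftrightarrow> l = m" by (rule inj_on_eq_iff[OF \<beta>(2) l m])
      ultimately show "x l *\<^sub>R \<beta> l \<bullet> \<beta> m = (if l = m then x l else 0)" by (simp add: inner_Basis)
    qed simp
    then show ?thesis using m by simp
  qed
  have Gzero: "G b = 0 \<longleftrightarrow> (\<forall>m\<in>{1..n}. g m b = 0)" for b
    using coord[of _ "\<lambda>l. g l b"] unfolding G_def by (auto intro!: sum.neutral)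
  have GC: "Ck_on (Suc 0) B G" unfolding G_def
    by (intro Ck_on_sum Ck_on_scaleR Ck_on_const B g)
  define V where "V = span (\<beta> ` {1..n})"
  have GV: "G b \<in> V" for b unfolding G_def V_def by (intro span_sum span_scale span_base) auto
  define e' where "e' s = (\<Sum>l\<in>{1..n}. g' l (c s) *\<^sub>R \<beta> l)" for s
  have "G (c s) = 0"
  proof (rule zero_propagation[where e = "\<lambda>s. G (c s)" and e' = e', OF _ _ s0(1) _ s])
    show "((\<lambda>s. G (c s)) has_vector_derivative e' s) (at s within {s1..s2})" if "s \<in> {s1..s2}" for s
      unfolding G_def e'_def
      by (intro has_vector_derivative_sum bounded_linear.has_vector_derivative[OF bounded_linear_scaleR_left] der that)
    show "G (c s0) = 0" using s0 Gzero by blast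
  next
    fix r0 assume r0: "r0 \<in> {s1..s2}" "G (c r0) = 0"
    define b0 where "b0 = c r0"
    have b0: "b0 \<in> B" "G b0 = 0" unfolding b0_def using c(2)[OF r0(1)] r0(2) by auto
    then have b0_zero: "g m b0 = 0" if "m \<in> {1..n}" for m using Gzero that by blast
    define a where "a l = (\<Sum>i\<in>Basis. D (g l) b0 i *\<^sub>R i)" for l
    have a: "D (g l) b0 y = a l \<bullet> y" if "l \<in> {1..n}" for l y
    proof -
      have "a l \<bullet> y = (\<Sum>i\<in>Basis. (y \<bullet> i) *\<^sub>R D (g l) b0 i)"
        unfolding a_def inner_sum_left by (intro sum.cong) (auto simp: inner_commute)
      then show ?thesis using linear_Basis_sum[OF Ck_on_linear_D[OF g[OF that] b0(1)], of y] by simp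
    qed
    have DG: "D G b0 y = (\<Sum>l\<in>{1..n}. (a l \<bullet> y) *\<^sub>R \<beta> l)" for y
    proof -
      have "(G has_derivative (\<lambda>y. \<Sum>l\<in>{1..n}. D (g l) b0 y *\<^sub>R \<beta> l)) (at b0)"
        unfolding G_def by (intro has_derivative_sum has_derivative_scaleR_left Ck_on_has_derivative[OF g] b0)
      then show ?thesis by (simp add: D_eqI a)
    qed
    \<comment> \<open>By maximal rank each label is attained by \<open>D G b0\<close> on a dual
      vector of the gradients; this makes \<open>metric_regularity\<close> applicable.\<close>
    have rng: "V \<subseteq> range (D G b0)"
      unfolding V_def
    proof (rule span_minimal)
      show "subspace (range (D G b0))"
        by (rule linear_subspace_image[OF Ck_on_linear_D[OF GC b0(1)] subspace_UNIV])
      have "dim (a ` {1..n}) = n" unfolding a_def by (rule rank[OF b0(1) b0_zero])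
      then have dim: "dim (a ` {1..n}) = card {1..n}" by simp
      have "\<beta> m \<in> range (D G b0)" if m: "m \<in> {1..n}" for m
      proof -
        obtain y where y: "a m \<bullet> y = 1" "\<And>l. l \<in> {1..n} \<Longrightarrow> l \<noteq> m \<Longrightarrow> a l \<bullet> y = 0"
          using dual_vector[OF dim _ m] by auto
        have "D G b0 y = (\<Sum>l\<in>{1..n}. if l = m then \<beta> l else 0)"
          unfolding DG by (intro sum.cong) (use y in auto)
        also have "\<dots> = \<beta> m" using m by simp
        finally show ?thesis by (metis rangeI)
      qed
      then show "\<beta> ` {1..n} \<subseteq> range (D G b0)" by blast
    qed
    have "\<exists>d>0. \<exists>M>0. \<forall>x y. norm (x - b0) < d \<longrightarrow> norm (y - b0) < d \<longrightarrow> norm (g' l y - g' l x) \<le> M * norm (y - x)"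
      if l: "l \<in> {1..n}" for l
    proof -
      have "\<exists>d>0. \<forall>x y. norm (x - b0) < d \<longrightarrow> norm (y - b0) < d \<longrightarrow> norm (g' l y - g' l x - D (g' l) b0 (y - x)) \<le> 1 * norm (y - x)"
        by (rule uniform_differentiability[OF compact_sing B _ g'[OF l] zero_less_one, of b0]) (use b0 in \<open>simp, meson insertI1\<close>)
      then obtain d where d: "d > 0" "\<And>x y. norm (x - b0) < d \<Longrightarrow> norm (y - b0) < d \<Longrightarrow> norm (g' l y - g' l x - D (g' l) b0 (y - x)) \<le> 1 * norm (y - x)"
        by blast
      obtain M where M: "M > 0" "\<And>w. norm (D (g' l) b0 w) \<le> norm w * M"
        using bounded_linear.pos_bounded[OF linear_conv_bounded_linear[THEN iffD1, OF Ck_on_linear_D[OF g'[OF l] b0(1)]]] by blast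
      have "norm (g' l y - g' l x) \<le> (1 + M) * norm (y - x)" if "norm (x - b0) < d" "norm (y - b0) < d" for x y
        using d(2)[OF that] M(2)[of "y - x"] norm_triangle_sub[of "g' l y - g' l x" "D (g' l) b0 (y - x)"]
        by (simp add: algebra_simps)
      then show ?thesis using d(1) M(1) by (intro exI[of _ d] conjI exI[of _ "1 + M"]) auto
    qed
    then obtain d M where dM: "\<And>l. l \<in> {1..n} \<Longrightarrow> d l > 0" "\<And>l. l \<in> {1..n} \<Longrightarrow> M l > 0"
      "\<And>l x y. l \<in> {1..n} \<Longrightarrow> norm (x - b0) < d l \<Longrightarrow> norm (y - b0) < d l \<Longrightarrow> norm (g' l y - g' l x) \<le> M l * norm (y - x)"
      by metis
    \<comment> \<open>The minimum is over a nonempty set, since \<open>l\<close> lies in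
      \<open>{1..n}\<close>.\<close>
    define \<rho>0 where "\<rho>0 = Min (d ` {1..n})"
    have \<rho>0: "\<rho>0 > 0" "\<And>l. l \<in> {1..n} \<Longrightarrow> \<rho>0 \<le> d l" using dM(1) l unfolding \<rho>0_def by (auto simp: Min_gr_iff)
    obtain C \<rho> where C: "C > 0" "\<rho> > 0" "\<And>b. norm (b - b0) < \<rho> \<Longrightarrow>
        \<exists>b'\<in>B. G b' = 0 \<and> norm (b' - b0) < \<rho>0 \<and> norm (b - b') \<le> C * norm (G b)"
      using metric_regularity[OF B GC b0(1,2) subspace_span[of "\<beta> ` {1..n}", folded V_def] GV rng \<rho>0(1)] by blast
    obtain \<sigma> where \<sigma>: "\<sigma> > 0" "\<And>s. s \<in> {s1..s2} \<Longrightarrow> \<bar>s - r0\<bar> < \<sigma> \<Longrightarrow> norm (c s - b0) < min \<rho> \<rho>0"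
      using c(1) r0(1) C(2) \<rho>0(1) unfolding continuous_on_iff b0_def dist_norm real_norm_def
      by (metis min_less_iff_conj)
    have "norm (e' s) \<le> (\<Sum>l\<in>{1..n}. M l * C) * norm (G (c s))" if s: "s \<in> {s1..s2}" "\<bar>s - r0\<bar> < \<sigma>" for s
    proof -
      obtain b' where b': "b' \<in> B" "G b' = 0" "norm (b' - b0) < \<rho>0" "norm (c s - b') \<le> C * norm (G (c s))"
        using C(3)[of "c s"] \<sigma>(2)[OF s] by auto
      have "norm (e' s) \<le> (\<Sum>l\<in>{1..n}. norm (g' l (c s) *\<^sub>R \<beta> l))" unfolding e'_def by (rule norm_sum)
      also have "\<dots> \<le> (\<Sum>l\<in>{1..n}. (M l * C) * norm (G (c s)))"
      proof (rule sum_mono)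
        fix l assume l: "l \<in> {1..n}"
        have "g' l b' = 0" by (rule tangent[OF b'(1) _ l]) (use b'(2) Gzero in blast)
        then have "norm (g' l (c s)) \<le> M l * norm (c s - b')"
          using dM(3)[OF l, of b' "c s"] b'(3) \<sigma>(2)[OF s] \<rho>0(2)[OF l] by simp
        also have "\<dots> \<le> M l * (C * norm (G (c s)))" using dM(2)[OF l] b'(4) by (intro mult_left_mono) auto
        finally show "norm (g' l (c s) *\<^sub>R \<beta> l) \<le> (M l * C) * norm (G (c s))"
          using \<beta>(1) l by (auto simp: mult.assoc norm_Basis subset_iff)
      qed
      finally show ?thesis by (simp add: sum_distrib_right)
    qed
    then show "\<exists>L \<rho>. \<rho> > 0 \<and> (\<forall>s\<in>{s1..s2}. \<bar>s - r0\<bar> < \<rho> \<longrightarrow> norm (e' s) \<le> L * norm (G (c s)))"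
      using \<sigma>(1) by blast
  qed
  then show ?thesis using Gzero l by blast
qed

section \<open>Derivatives relative to sets with corners\<close>

text \<open>The criterion for uniqueness of derivatives within a set: every point can be approached
  along each coordinate line, from at least one side. Corners and edges of the domains satisfy
  it.\<close>

definition thick :: "'a::euclidean_space set \<Rightarrow> bool" where
  "thick S \<longleftrightarrow> (\<forall>p\<in>S. \<forall>b\<in>Basis. \<forall>e>0. \<exists>d. 0 < \<bar>d\<bar> \<and> \<bar>d\<bar> < e \<and> p + d *\<^sub>R b \<in> S)"

text \<open>The bridge between the relative derivatives in the definitions and ordinary derivatives
  of smooth extensions.\<close>

lemma thick_derivative:
  assumes "thick S" "p \<in> S" "(F has_derivative F') (at p)" "\<And>q. q \<in> S \<Longrightarrow> F q = \<phi> q"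
  shows "frechet_derivative \<phi> (at p within S) = F'"
proof -
  have 1: "(\<phi> has_derivative F') (at p within S)"
    by (rule has_derivative_transform[OF assms(2) _ has_derivative_at_withinI[OF assms(3)]]) (simp add: assms(4))
  then have "(\<phi> has_derivative frechet_derivative \<phi> (at p within S)) (at p within S)"
    unfolding frechet_derivative_works[symmetric] differentiable_def by blast
  then show ?thesis
    by (rule frechet_derivative_unique_within[OF _ 1]) (use assms(1,2) in \<open>auto simp: thick_def\<close>)
qed

lemma thick_UNIV: "thick UNIV"
  unfolding thick_def
proof (intro ballI allI impI)
  fix p b :: 'a and e :: real assume "e > 0"
  then show "\<exists>d. 0 < \<bar>d\<bar> \<and> \<bar>d\<bar> < e \<and> p + d *\<^sub>R b \<in> UNIV" by (intro exI[of _ "e / 2"]) auto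
qed

lemma thick_openin:
  fixes T :: "'a::euclidean_space set"
  assumes "thick T" "openin (top_of_set T) S"
  shows "thick S"
  unfolding thick_def
proof (intro ballI allI impI)
  fix p b :: 'a and e :: real assume p: "p \<in> S" and b: "b \<in> Basis" and e: "e > 0"
  obtain r where r: "r > 0" "ball p r \<inter> T \<subseteq> S" "p \<in> T"
    using assms(2) p unfolding openin_contains_ball by blast
  obtain d where d: "0 < \<bar>d\<bar>" "\<bar>d\<bar> < min e r" "p + d *\<^sub>R b \<in> T"
    using assms(1) r(1,3) b e unfolding thick_def by (meson min_less_iff_conj)
  have "p + d *\<^sub>R b \<in> ball p r" using d(2) b by (simp add: dist_norm)
  then show "\<exists>d. 0 < \<bar>d\<bar> \<and> \<bar>d\<bar> < e \<and> p + d *\<^sub>R b \<in> S" using d r(2) by auto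
qed

lemma thick_Int_open: "thick T \<Longrightarrow> open U \<Longrightarrow> thick (T \<inter> U)"
  by (rule thick_openin[of T]) (auto simp: openin_open)

lemma thick_Times:
  fixes A :: "'a::euclidean_space set" and B :: "'b::euclidean_space set"
  assumes "thick A" "thick B"
  shows "thick (A \<times> B)"
  unfolding thick_def
proof (intro ballI allI impI)
  fix p b :: "'a \<times> 'b" and e :: real assume p: "p \<in> A \<times> B" and b: "b \<in> Basis" and e: "e > 0"
  from b consider i where "b = (i, 0)" "i \<in> Basis" | j where "b = (0, j)" "j \<in> Basis"
    unfolding Basis_prod_def by auto
  then show "\<exists>d. 0 < \<bar>d\<bar> \<and> \<bar>d\<bar> < e \<and> p + d *\<^sub>R b \<in> A \<times> B"
  proof cases
    case 1
    then obtain d where "0 < \<bar>d\<bar>" "\<bar>d\<bar> < e" "fst p + d *\<^sub>R i \<in> A"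
      using assms(1) p e unfolding thick_def by (metis mem_Times_iff)
    then show ?thesis using 1 p by (intro exI[of _ d]) (auto simp: mem_Times_iff)
  next
    case 2
    then obtain d where "0 < \<bar>d\<bar>" "\<bar>d\<bar> < e" "snd p + d *\<^sub>R j \<in> B"
      using assms(2) p e unfolding thick_def by (metis mem_Times_iff)
    then show ?thesis using 2 p by (intro exI[of _ d]) (auto simp: mem_Times_iff)
  qed
qed

lemma thick_unit_interval: "thick {0..1::real}"
  unfolding thick_def
proof (intro ballI allI impI)
  fix p b e :: real assume p: "p \<in> {0..1}" and b: "b \<in> Basis" and e: "e > 0"
  \<comment> \<open>The step points towards the far end of the interval and has length at most
    1/2.\<close>
  define d where "d = (if p \<le> 1/2 then 1 else -1) * min (e/2) (1/2)"
  show "\<exists>d. 0 < \<bar>d\<bar> \<and> \<bar>d\<bar> < e \<and> p + d *\<^sub>R b \<in> {0..1}"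
    using p b e by (intro exI[of _ d]) (auto simp: d_def min_def)
qed

lemma thick_atLeast: "thick {0::real..}"
  unfolding thick_def
proof (intro ballI allI impI)
  fix p b e :: real assume "p \<in> {0..}" "b \<in> Basis" "e > 0"
  then show "\<exists>d. 0 < \<bar>d\<bar> \<and> \<bar>d\<bar> < e \<and> p + d *\<^sub>R b \<in> {0..}" by (intro exI[of _ "e / 2"]) auto
qed

lemma thick_atLeastLessThan: "thick {0::real..<T}"
proof -
  have "{0..<T} = {0..} \<inter> {..<T}" by auto
  then show ?thesis using thick_Int_open[OF thick_atLeast, of "{..<T}"] by simp
qed

section \<open>The symmetry flow on sections\<close>

text \<open>\<open>V\<close> and \<open>f\<close> are smooth extensions of \<open>v\<close> and of
  the right-hand side. The open set \<open>W\<close> is both the domain of \<open>V\<close> and the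
  set that cuts the total space out of the product with corners.\<close>

locale symmetric_system =
  fixes P :: "('n::finite) pde_sys" and v :: "'n pt \<Rightarrow> real^'n"
    and W :: "'n pt set" and V :: "'n pt \<Rightarrow> real^'n"
    and Wf :: "(real \<times> real \<times> (real^'n) \<times> (real^'n) \<times> (real^'n) \<times> real) set"
    and f :: "real \<times> real \<times> (real^'n) \<times> (real^'n) \<times> (real^'n) \<times> real \<Rightarrow> real^'n"
  assumes open_W: "open W" and E_eq: "total_space P = ({0..1} \<times> {0..} \<times> UNIV \<times> UNIV) \<inter> W"
    and V_smooth: "\<And>k. Ck_on k W V" and V_eq: "\<And>p. p \<in> total_space P \<Longrightarrow> V p = v p"
    and open_Wf: "open Wf" and f_smooth: "\<And>k. Ck_on k Wf f"
    and f_dom: "\<And>z t x xz xzz u. (z, t, x, u) \<in> total_space P \<Longrightarrow> (z, t, x, xz, xzz, u) \<in> Wf"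
    and f_eq: "\<And>z t x xz xzz u. (z, t, x, u) \<in> total_space P \<Longrightarrow> f (z, t, x, xz, xzz, u) = rhs P (z, t, x, xz, xzz, u)"
    and pde_lie: "\<And>\<alpha> p. p \<in> S2 P \<Longrightarrow> lie (J2 P) (j2 P v) (pde_fun P \<alpha>) p = 0"
begin

lemma E_W: "p \<in> total_space P \<Longrightarrow> p \<in> W"
  using E_eq by auto

lemma thick_E: "thick (total_space P)"
  unfolding E_eq
  by (intro thick_Int_open thick_Times thick_unit_interval thick_atLeast thick_UNIV open_W)

lemma J1_eq: "J1 P = ({0..1} \<times> {0..} \<times> UNIV) \<inter> (\<lambda>q. (fst q, fst (snd q), fst (snd (snd q)), fst (snd (snd (snd q))))) -` W"
  unfolding J1_def E_eq by auto

lemma open_J1_vimage: "open ((\<lambda>q::'n jet1. (fst q, fst (snd q), fst (snd (snd q)), fst (snd (snd (snd q))))) -` W)"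
  by (intro open_vimage open_W continuous_intros)

lemma thick_J1: "thick (J1 P)"
  unfolding J1_eq
  by (intro thick_Int_open thick_Times thick_unit_interval thick_atLeast thick_UNIV open_J1_vimage)

lemma thick_J2: "thick (J2 P)"
proof -
  have "J2 P = J1 P \<times> UNIV" unfolding J2_def by auto
  then show ?thesis using thick_Times[OF thick_J1 thick_UNIV] by simp
qed

text \<open>The jets over \<open>z\<close> without the constraint \<open>t \<ge> 0\<close>, which
  makes the set open.\<close>

definition bset :: "real \<Rightarrow> 'n bjet set" where
  "bset z = (\<lambda>b. (z, fst b, fst (snd b), fst (snd (snd b)))) -` W"

lemma open_bset: "open (bset z)"
  unfolding bset_def by (intro open_vimage open_W continuous_intros)

lemma bjets_eq: "z \<in> {0..1} \<Longrightarrow> bjets P z = ({0..} \<times> UNIV) \<inter> bset z"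
  unfolding bjets_def J1_def E_eq bset_def by auto

lemma thick_bjets: "z \<in> {0..1} \<Longrightarrow> thick (bjets P z)"
  unfolding bjets_eq
  by (intro thick_Int_open thick_Times thick_atLeast thick_UNIV open_bset)

section \<open>Prolongations and Lie derivatives in terms of the smooth extensions\<close>

lemma dz0_eq:
  "(z, t, x, u) \<in> total_space P \<Longrightarrow> dz0 P v (z, t, x, u, xz, xt, uz, ut) = D V (z, t, x, u) (1, 0, xz, uz)"
  unfolding dz0_def prod.case
  by (subst thick_derivative[OF thick_E _ Ck_on_has_derivative[OF V_smooth] V_eq]) (auto intro: E_W)

lemma dt0_eq:
  "(z, t, x, u) \<in> total_space P \<Longrightarrow> dt0 P v (z, t, x, u, xz, xt, uz, ut) = D V (z, t, x, u) (0, 1, xt, ut)"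
  unfolding dt0_def prod.case
  by (subst thick_derivative[OF thick_E _ Ck_on_has_derivative[OF V_smooth] V_eq]) (auto intro: E_W)

text \<open>This is the total derivative d_z v written for \<open>V\<close>, as a function of the
  coordinates \<open>(z, t, x, u, x_z, u_z)\<close> on which it depends. Its own total derivative in
  \<open>z\<close> gives the \<open>x_zz\<close> component of the prolongation.\<close>

definition h :: "real \<times> real \<times> (real^'n) \<times> real \<times> (real^'n) \<times> real \<Rightarrow> real^'n" where
  "h q = D V (fst q, fst (snd q), fst (snd (snd q)), fst (snd (snd (snd q)))) (1, 0, snd (snd (snd (snd q))))"

definition Wh :: "(real \<times> real \<times> (real^'n) \<times> real \<times> (real^'n) \<times> real) set" where
  "Wh = (\<lambda>q. (fst q, fst (snd q), fst (snd (snd q)), fst (snd (snd (snd q))))) -` W"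

lemma open_Wh: "open Wh"
  unfolding Wh_def by (intro open_vimage open_W continuous_intros)

lemma h_smooth: "Ck_on k Wh h"
  unfolding h_def
  by (rule Ck_on_D_apply[OF open_Wh open_W V_smooth])
    (auto simp: Wh_def intro!: Ck_on_Pair Ck_on_fst Ck_on_snd Ck_on_ident Ck_on_const open_Wh[unfolded Wh_def])

lemma dz1_eq:
  assumes "(z, t, x, u) \<in> total_space P"
  shows "dz1 P (dz0 P v) ((z, t, x, u, xz, xt, uz, ut), (xzz, xzt, xtt, uzz, uzt, utt)) =
    D h (z, t, x, u, xz, uz) (1, 0, xz, uz, xzz, uzz)"
proof -
  define pr where "pr = (\<lambda>q::'n jet1. (fst q, fst (snd q), fst (snd (snd q)), fst (snd (snd (snd q))),
    fst (snd (snd (snd (snd q)))), fst (snd (snd (snd (snd (snd (snd q))))))))"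
  have pr: "bounded_linear pr" unfolding pr_def
    by (intro bounded_linear_Pair bounded_linear_fst_comp bounded_linear_snd_comp bounded_linear_ident)
  have "(h has_derivative D h (pr (z, t, x, u, xz, xt, uz, ut))) (at (pr (z, t, x, u, xz, xt, uz, ut)))"
    by (rule Ck_on_has_derivative[OF h_smooth]) (use assms E_W in \<open>auto simp: pr_def Wh_def\<close>)
  then have 1: "((\<lambda>q. h (pr q)) has_derivative (\<lambda>w. D h (pr (z, t, x, u, xz, xt, uz, ut)) (pr w))) (at (z, t, x, u, xz, xt, uz, ut))"
    by (rule has_derivative_compose[OF bounded_linear_imp_has_derivative[OF pr]])
  have 2: "h (pr q) = dz0 P v q" if "q \<in> J1 P" for q
    using that dz0_eq unfolding pr_def h_def J1_def by auto
  have 3: "(z, t, x, u, xz, xt, uz, ut) \<in> J1 P" unfolding J1_def using assms by auto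
  have "frechet_derivative (dz0 P v) (at (z, t, x, u, xz, xt, uz, ut) within J1 P) =
      (\<lambda>w. D h (pr (z, t, x, u, xz, xt, uz, ut)) (pr w))"
    by (rule thick_derivative[OF thick_J1 3 1 2])
  then show ?thesis unfolding dz1_def pr_def by simp
qed

lemma lie_pde_fun:
  assumes "(z, t, x, u) \<in> total_space P"
  shows "lie (J2 P) w (pde_fun P \<alpha>) ((z, t, x, u, xz, xt, uz, ut), (xzz, xzt, xtt, uzz, uzt, utt)) =
    (case w ((z, t, x, u, xz, xt, uz, ut), (xzz, xzt, xtt, uzz, uzt, utt)) of
      ((z', t', x', u', xz', xt', uz', ut'), (xzz', xzt', xtt', uzz', uzt', utt')) \<Rightarrow>
        xt' $ \<alpha> - D f (z, t, x, xz, xzz, u) (z', t', x', xz', xzz', u') $ \<alpha>)"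
proof -
  define p where "p = ((z, t, x, u, xz, xt, uz, ut), (xzz, xzt, xtt, uzz, uzt, utt))"
  define pr where "pr = (\<lambda>q::'n jet2. (fst (fst q), fst (snd (fst q)), fst (snd (snd (fst q))),
    fst (snd (snd (snd (snd (fst q))))), fst (snd q), fst (snd (snd (snd (fst q))))))"
  define xt' where "xt' = (\<lambda>q::'n jet2. fst (snd (snd (snd (snd (snd (fst q)))))) $ \<alpha>)"
  have pr: "bounded_linear pr" unfolding pr_def
    by (intro bounded_linear_Pair bounded_linear_fst_comp bounded_linear_snd_comp bounded_linear_ident)
  have xt': "bounded_linear xt'" unfolding xt'_def
    by (intro bounded_linear_compose[OF bounded_linear_vec_nth] bounded_linear_fst_comp bounded_linear_snd_comp bounded_linear_ident)
  have "(f has_derivative D f (pr p)) (at (pr p))"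
    by (rule Ck_on_has_derivative[OF f_smooth]) (use assms f_dom in \<open>auto simp: pr_def p_def\<close>)
  then have "((\<lambda>q. f (pr q)) has_derivative (\<lambda>w. D f (pr p) (pr w))) (at p)"
    by (rule has_derivative_compose[OF bounded_linear_imp_has_derivative[OF pr]])
  then have 1: "((\<lambda>q. xt' q - f (pr q) $ \<alpha>) has_derivative (\<lambda>w. xt' w - D f (pr p) (pr w) $ \<alpha>)) (at p)"
    by (intro has_derivative_diff bounded_linear_imp_has_derivative[OF xt']
        bounded_linear.has_derivative[OF bounded_linear_vec_nth])
  have 2: "xt' q - f (pr q) $ \<alpha> = pde_fun P \<alpha> q" if "q \<in> J2 P" for q
    using that f_eq unfolding pr_def xt'_def pde_fun_def J2_def J1_def by auto
  have 3: "p \<in> J2 P" unfolding J2_def J1_def p_def using assms by auto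
  have 4: "frechet_derivative (pde_fun P \<alpha>) (at p within J2 P) = (\<lambda>w. xt' w - D f (pr p) (pr w) $ \<alpha>)"
    by (rule thick_derivative[OF thick_J2 3 1 2])
  show ?thesis unfolding lie_def p_def[symmetric] 4
    by (simp add: case_prod_unfold) (simp add: pr_def xt'_def p_def)
qed

text \<open>Condition 3 of the theorem at the jets with \<open>u_z = u_zz = u_zt = 0\<close> and \<open>x_t = f\<close>.\<close>

lemma pde_identity:
  assumes E: "(z, t, x, u) \<in> total_space P"
  shows "D V (z, t, x, u) (0, 1, f (z, t, x, xz, xzz, u), ut) =
    D f (z, t, x, xz, xzz, u) (0, 0, V (z, t, x, u), h (z, t, x, u, xz, 0), D h (z, t, x, u, xz, 0) (1, 0, xz, 0, xzz, 0), 0)"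
proof (rule vec_eq_iff[THEN iffD2, rule_format])
  fix \<alpha>
  define p where "p = ((z, t, x, u, xz, f (z, t, x, xz, xzz, u), 0::real, ut), (xzz, 0::real^'n, 0::real^'n, 0::real, 0::real, 0::real))"
  have "p \<in> S2 P"
    unfolding S2_def S2_funs_def J2_def J1_def p_def pde_fun_def using E f_eq[OF E] by auto
  from pde_lie[OF this, of \<alpha>]
  show "D V (z, t, x, u) (0, 1, f (z, t, x, xz, xzz, u), ut) $ \<alpha> =
    D f (z, t, x, xz, xzz, u) (0, 0, V (z, t, x, u), h (z, t, x, u, xz, 0), D h (z, t, x, u, xz, 0) (1, 0, xz, 0, xzz, 0), 0) $ \<alpha>"
    unfolding p_def lie_pde_fun[OF E] unfolding j2_def j1_def Let_def prod.case dz0_eq[OF E] dt0_eq[OF E] dz1_eq[OF E]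
    by (simp add: h_def V_eq[OF E])
qed

text \<open>Rank and tangency conditions are formulated relative to the jet manifold and for \<phi>.
  With the extension \<open>g\<close> they become statements about ordinary derivatives.\<close>

lemma bjet_derivative:
  fixes g :: "real \<times> (real^'n) \<times> (real^'n) \<Rightarrow> real"
  assumes z: "z \<in> {0..1}" and g: "open Wg" "Ck_on (Suc 0) Wg g"
    "\<And>t x xz u. (z, t, x, u) \<in> total_space P \<Longrightarrow> (t, x, xz) \<in> Wg \<and> g (t, x, xz) = \<phi> (t, x, xz)"
    and b: "(t, x, u, xz, xt, uz, ut) \<in> bjets P z"
  shows "frechet_derivative (on_bjet \<phi>) (at (t, x, u, xz, xt, uz, ut) within bjets P z) =
      (\<lambda>w. D g (t, x, xz) (fst w, fst (snd w), fst (snd (snd (snd w)))))"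
    and "D (on_bjet g) (t, x, u, xz, xt, uz, ut) = (\<lambda>w. D g (t, x, xz) (fst w, fst (snd w), fst (snd (snd (snd w)))))"
    and "lie (bjets P z) (j1_at P v z) (on_bjet \<phi>) (t, x, u, xz, xt, uz, ut) =
      D g (t, x, xz) (0, V (z, t, x, u), h (z, t, x, u, xz, uz))"
proof -
  have E: "(z, t, x, u) \<in> total_space P" using b unfolding bjets_def J1_def by auto
  define pr where "pr = (\<lambda>q::'n bjet. (fst q, fst (snd q), fst (snd (snd (snd q)))))"
  have pr: "bounded_linear pr" unfolding pr_def
    by (intro bounded_linear_Pair bounded_linear_fst_comp bounded_linear_snd_comp bounded_linear_ident)
  have on: "on_bjet g = (\<lambda>q. g (pr q))" unfolding on_bjet_def pr_def by (auto simp: fun_eq_iff)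
  have "(g has_derivative D g (pr (t, x, u, xz, xt, uz, ut))) (at (pr (t, x, u, xz, xt, uz, ut)))"
    by (rule Ck_on_has_derivative[OF g(2)]) (use g(3)[OF E] in \<open>auto simp: pr_def\<close>)
  then have 1: "(on_bjet g has_derivative (\<lambda>w. D g (pr (t, x, u, xz, xt, uz, ut)) (pr w))) (at (t, x, u, xz, xt, uz, ut))"
    unfolding on by (rule has_derivative_compose[OF bounded_linear_imp_has_derivative[OF pr]])
  have 2: "on_bjet g q = on_bjet \<phi> q" if "q \<in> bjets P z" for q
    using that g(3) unfolding on_bjet_def bjets_def J1_def by auto
  show 3: "frechet_derivative (on_bjet \<phi>) (at (t, x, u, xz, xt, uz, ut) within bjets P z) =
      (\<lambda>w. D g (t, x, xz) (fst w, fst (snd w), fst (snd (snd (snd w)))))"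
  proof -
    have "frechet_derivative (on_bjet \<phi>) (at (t, x, u, xz, xt, uz, ut) within bjets P z) =
        (\<lambda>w. D g (pr (t, x, u, xz, xt, uz, ut)) (pr w))"
      by (rule thick_derivative[OF thick_bjets[OF z] b 1 2])
    then show ?thesis by (simp add: pr_def)
  qed
  show "D (on_bjet g) (t, x, u, xz, xt, uz, ut) = (\<lambda>w. D g (t, x, xz) (fst w, fst (snd w), fst (snd (snd (snd w)))))"
    unfolding D_eqI[OF 1] by (simp add: pr_def)
  show "lie (bjets P z) (j1_at P v z) (on_bjet \<phi>) (t, x, u, xz, xt, uz, ut) =
      D g (t, x, xz) (0, V (z, t, x, u), h (z, t, x, u, xz, uz))"
    unfolding lie_def 3 unfolding j1_at_def j1_def Let_def prod.case dz0_eq[OF E] by (simp add: h_def V_eq[OF E])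
qed

subsection \<open>Flow boxes\<close>

text \<open>Only the \<open>x\<close>-component \<open>X\<close> of the flow is recorded:
  \<open>v\<close> is vertical, so \<open>z\<close>, \<open>t\<close>, \<open>u\<close> stay fixed.
  Hence a trajectory over admissible \<open>(z, t)\<close> that stays in \<open>W\<close> stays in
  the total space.\<close>

definition flow_box :: "real \<Rightarrow> 'n pt set \<Rightarrow> (real \<times> 'n pt \<Rightarrow> real^'n) \<Rightarrow> bool" where
  "flow_box \<delta> N X \<longleftrightarrow> \<delta> > 0 \<and> open N \<and> N \<subseteq> W \<and> (\<forall>k. Ck_on k ({-\<delta><..<\<delta>} \<times> N) X) \<and>
     (\<forall>z t x u. (z, t, x, u) \<in> N \<longrightarrow> X (0, z, t, x, u) = x \<and>
       (\<forall>s\<in>{-\<delta><..<\<delta>}. (z, t, X (s, z, t, x, u), u) \<in> W \<and>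
          ((\<lambda>s. X (s, z, t, x, u)) has_vector_derivative V (z, t, X (s, z, t, x, u), u)) (at s)))"

lemma flow_box_exists:
  assumes "compact K" "K \<subseteq> W"
  shows "\<exists>\<delta> N X. flow_box \<delta> N X \<and> K \<subseteq> N"
proof -
  define Vf where "Vf p = (0::real, 0::real, V p, 0::real)" for p
  have Vf: "Ck_on k W Vf" for k
    unfolding Vf_def by (intro Ck_on_Pair Ck_on_const V_smooth open_W)
  show ?thesis
  proof (rule local_flow[OF open_W Vf assms])
    fix \<delta> N \<Phi>
    assume \<delta>: "\<delta> > 0" and N: "open N" "K \<subseteq> N" "N \<subseteq> W"
      and sm: "\<And>k. Ck_on k ({-\<delta><..<\<delta>} \<times> N) \<Phi>"
      and init: "\<And>p. p \<in> N \<Longrightarrow> \<Phi> (0, p) = p"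
      and in_W: "\<And>s p. s \<in> {-\<delta><..<\<delta>} \<Longrightarrow> p \<in> N \<Longrightarrow> \<Phi> (s, p) \<in> W"
      and der: "\<And>s p. s \<in> {-\<delta><..<\<delta>} \<Longrightarrow> p \<in> N \<Longrightarrow> ((\<lambda>s. \<Phi> (s, p)) has_vector_derivative Vf (\<Phi> (s, p))) (at s)"
    define X where "X y = fst (snd (snd (\<Phi> y)))" for y
    have op: "open ({-\<delta><..<\<delta>} \<times> N)" by (intro open_Times N) auto
    \<comment> \<open>\<open>z\<close>, \<open>t\<close> and \<open>u\<close> have zero velocity
      along the flow of \<open>Vf\<close>, so they keep their initial values.\<close>
    have form: "\<Phi> (s, z, t, x, u) = (z, t, X (s, z, t, x, u), u)" if s: "s \<in> {-\<delta><..<\<delta>}" and p: "(z, t, x, u) \<in> N" for s z t x u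
    proof -
      define pr where "pr = (\<lambda>q::'n pt. (fst q, fst (snd q), snd (snd (snd q))))"
      have pr: "bounded_linear pr" unfolding pr_def
        by (intro bounded_linear_Pair bounded_linear_fst_comp bounded_linear_snd_comp bounded_linear_ident)
      have "((\<lambda>s. pr (\<Phi> (s, z, t, x, u))) has_vector_derivative 0) (at s within {-\<delta><..<\<delta>})" if "s \<in> {-\<delta><..<\<delta>}" for s
        using bounded_linear.has_vector_derivative[OF pr has_vector_derivative_at_within[OF der[OF that p]]]
        unfolding Vf_def pr_def by (simp add: zero_prod_def)
      then obtain c where c: "\<And>s. s \<in> {-\<delta><..<\<delta>} \<Longrightarrow> pr (\<Phi> (s, z, t, x, u)) = c"
        using has_vector_derivative_zero_constant[of "{-\<delta><..<\<delta>}" "\<lambda>s. pr (\<Phi> (s, z, t, x, u))"] by fastforce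
      have "pr (\<Phi> (s, z, t, x, u)) = pr (\<Phi> (0, z, t, x, u))" using c[OF s] c[of 0] \<delta> by simp
      then show ?thesis unfolding init[OF p] pr_def X_def by (auto simp: prod_eq_iff)
    qed
    have "flow_box \<delta> N X"
      unfolding flow_box_def
    proof (intro conjI allI impI ballI)
      show "Ck_on k ({-\<delta><..<\<delta>} \<times> N) X" for k unfolding X_def by (intro Ck_on_fst Ck_on_snd sm op)
      fix z t u :: real and x :: "real^'n" assume p: "(z, t, x, u) \<in> N"
      show "X (0, z, t, x, u) = x" unfolding X_def init[OF p] by simp
      fix s assume s: "s \<in> {-\<delta><..<\<delta>}"
      show "(z, t, X (s, z, t, x, u), u) \<in> W" using in_W[OF s p] unfolding form[OF s p] .
      have "bounded_linear (\<lambda>q::'n pt. fst (snd (snd q)))"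
        by (intro bounded_linear_fst_comp bounded_linear_snd_comp bounded_linear_ident)
      from bounded_linear.has_vector_derivative[OF this der[OF s p]]
      show "((\<lambda>s. X (s, z, t, x, u)) has_vector_derivative V (z, t, X (s, z, t, x, u), u)) (at s)"
        unfolding form[OF s p] unfolding X_def Vf_def by simp
    qed (use \<delta> N in auto)
    then show ?thesis using N(2) by blast
  qed
qed

end

section \<open>Derivatives along slices and commuting derivatives\<close>

lemma has_vector_derivative_fst:
  assumes "(F has_derivative F') (at (s, q))"
  shows "((\<lambda>s. F (s, q)) has_vector_derivative F' (1, 0)) (at s)"
proof -
  have "((\<lambda>s. (s, q)) has_derivative (\<lambda>\<sigma>. (\<sigma>, 0))) (at s)"
    by (intro has_derivative_Pair has_derivative_ident has_derivative_const)
  from has_derivative_compose[OF this assms]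
  have "((\<lambda>s. F (s, q)) has_derivative (\<lambda>\<sigma>. F' (\<sigma>, 0))) (at s)" by simp
  moreover have "(\<lambda>\<sigma>. F' (\<sigma>, 0)) = (\<lambda>\<sigma>. \<sigma> *\<^sub>R F' (1, 0))"
  proof (rule ext)
    show "F' (\<sigma>, 0) = \<sigma> *\<^sub>R F' (1, 0)" for \<sigma>
      using linear_scale[OF has_derivative_linear[OF assms], of \<sigma> "(1, 0)"] by simp
  qed
  ultimately show ?thesis unfolding has_vector_derivative_def by metis
qed

lemma has_vector_derivative_chain:
  assumes "(c has_vector_derivative c') (at s within S)" "(G has_derivative G') (at (c s))"
  shows "((\<lambda>s. G (c s)) has_vector_derivative G' c') (at s within S)"
  using vector_derivative_diff_chain_within[OF assms(1) has_derivative_at_withinI[OF assms(2)]] by (simp add: o_def)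

lemma has_derivative_snd_section:
  assumes "(F has_derivative F') (at (s, q))"
  shows "((\<lambda>q. F (s, q)) has_derivative (\<lambda>a. F' (0, a))) (at q)"
proof -
  have "((\<lambda>q. (s, q)) has_derivative (\<lambda>a. (0, a))) (at q)"
    by (intro has_derivative_Pair has_derivative_ident has_derivative_const)
  from has_derivative_compose[OF this assms] show ?thesis by simp
qed

lemma pd_eq:
  assumes "thick M" "q \<in> M" "(F has_derivative F') (at q)" "\<And>q. q \<in> M \<Longrightarrow> F q = \<phi> q"
  shows "pd_z M \<phi> q = F' (1, 0)" "pd_t M \<phi> q = F' (0, 1)"
proof -
  have "frechet_derivative \<phi> (at q within M) = F'" by (rule thick_derivative[OF assms])
  then show "pd_z M \<phi> q = F' (1, 0)" "pd_t M \<phi> q = F' (0, 1)" unfolding pd_z_def pd_t_def by simp_all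
qed

text \<open>Used with \<open>a\<close> the flow direction: if the flow derivative of
  \<open>F\<close> is known to be \<open>G\<close>, the flow derivative of a space or time
  derivative of \<open>F\<close> is found by differentiating \<open>G\<close>.\<close>

lemma D_D_commute:
  fixes F :: "'a::euclidean_space \<Rightarrow> 'b::real_normed_vector"
  assumes "open \<Omega>" "Ck_on 2 \<Omega> F" "p \<in> \<Omega>" "\<And>y. y \<in> \<Omega> \<Longrightarrow> D F y a = G y" "(G has_derivative G') (at p)"
  shows "D (\<lambda>y. D F y b) p a = G' b"
proof -
  have "D (\<lambda>y. D F y b) p a = D (\<lambda>y. D F y a) p b" by (rule D_symmetric[OF assms(1,3,2)])
  also have "D (\<lambda>y. D F y a) p = D G p"
    by (rule D_cong_open(3)[OF assms(1,3)]) (use assms in \<open>auto intro: differentiableI\<close>)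
  finally show ?thesis unfolding D_eqI[OF assms(5)] .
qed

text \<open>The section is extended to an open \<open>U\<close> over which its graph lies in the
  flow box, because mixed derivatives are interchanged on open sets only. The time interval is
  bounded, as one flow box has to cover the whole graph.\<close>

locale transformed_section = symmetric_system P v W V Wf f
  for P :: "('n::finite) pde_sys" and v W V Wf f +
  fixes \<delta> T :: real and N :: "'n pt set" and X :: "real \<times> 'n pt \<Rightarrow> real^'n"
    and \<gamma>x x' :: "real \<times> real \<Rightarrow> real^'n" and \<gamma>u u' :: "real \<times> real \<Rightarrow> real"
    and U :: "(real \<times> real) set"
  assumes box: "flow_box \<delta> N X" and T: "T > 0" and open_U: "open U" and MU: "{0..1} \<times> {0..<T} \<subseteq> U"
    and x': "\<And>k. Ck_on k U x'" "\<And>q. q \<in> {0..1} \<times> {0..<T} \<Longrightarrow> x' q = \<gamma>x q"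
    and u': "\<And>k. Ck_on k U u'" "\<And>q. q \<in> {0..1} \<times> {0..<T} \<Longrightarrow> u' q = \<gamma>u q"
    and graph_N: "\<And>q. q \<in> U \<Longrightarrow> (fst q, snd q, x' q, u' q) \<in> N"
    and sol: "is_solution P {0..<T} \<gamma>x \<gamma>u"
begin

abbreviation M :: "(real \<times> real) set" where "M \<equiv> {0..1} \<times> {0..<T}"
abbreviation I :: "real set" where "I \<equiv> {-\<delta><..<\<delta>}"
abbreviation \<Omega> :: "(real \<times> real \<times> real) set" where "\<Omega> \<equiv> I \<times> U"

text \<open>All transformed sections at once, as one smooth function of flow parameter, position and
  time. \<open>Hz\<close>, \<open>Ht\<close> and \<open>Hzz\<close> are the derivatives that enter
  the PDE, and \<open>K\<close>, \<open>K1\<close> the points at which \<open>V\<close> and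
  \<open>h\<close> are evaluated along it.\<close>

definition H :: "real \<times> real \<times> real \<Rightarrow> real^'n" where
  "H y = X (fst y, fst (snd y), snd (snd y), x' (snd y), u' (snd y))"
definition Hz :: "real \<times> real \<times> real \<Rightarrow> real^'n" where "Hz y = D H y (0, 1, 0)"
definition Ht :: "real \<times> real \<times> real \<Rightarrow> real^'n" where "Ht y = D H y (0, 0, 1)"
definition Hzz :: "real \<times> real \<times> real \<Rightarrow> real^'n" where "Hzz y = D Hz y (0, 1, 0)"
definition uz :: "real \<times> real \<Rightarrow> real" where "uz q = D u' q (1, 0)"
definition ut :: "real \<times> real \<Rightarrow> real" where "ut q = D u' q (0, 1)"
definition K :: "real \<times> real \<times> real \<Rightarrow> 'n pt" where "K y = (fst (snd y), snd (snd y), H y, u' (snd y))"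
definition K1 :: "real \<times> real \<times> real \<Rightarrow> real \<times> real \<times> (real^'n) \<times> real \<times> (real^'n) \<times> real" where
  "K1 y = (fst (snd y), snd (snd y), H y, u' (snd y), Hz y, uz (snd y))"

section \<open>Smoothness and range of the transformed family\<close>

lemma \<delta>: "\<delta> > 0" and open_N: "open N" and X_smooth: "Ck_on k (I \<times> N) X"
  using box unfolding flow_box_def by auto

lemma open_\<Omega>: "open \<Omega>"
  by (intro open_Times open_U) auto

lemma thick_M: "thick M"
  by (intro thick_Times thick_unit_interval thick_atLeastLessThan)

lemma u'_\<Omega>: "Ck_on k \<Omega> (\<lambda>y. u' (snd y))"
  by (rule Ck_on_compose[OF open_\<Omega> open_U _ u'(1)]) (auto intro: Ck_on_bounded_linear_id[OF open_\<Omega> bounded_linear_snd])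

lemma uz_smooth: "Ck_on k U uz"
  unfolding uz_def using Ck_on_D[OF u'(1)] .

lemma H_smooth: "Ck_on k \<Omega> H"
proof -
  have op: "open (I \<times> N)" by (intro open_Times open_N) auto
  have sec: "Ck_on k \<Omega> (\<lambda>y. x' (snd y))"
    by (rule Ck_on_compose[OF open_\<Omega> open_U _ x'(1)]) (auto intro: Ck_on_bounded_linear_id[OF open_\<Omega> bounded_linear_snd])
  have "Ck_on k \<Omega> (\<lambda>y. (fst y, fst (snd y), snd (snd y), x' (snd y), u' (snd y)))"
    by (intro Ck_on_Pair Ck_on_fst Ck_on_snd Ck_on_ident sec u'_\<Omega> open_\<Omega>)
  then have "Ck_on k \<Omega> (\<lambda>y. X (fst y, fst (snd y), snd (snd y), x' (snd y), u' (snd y)))"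
    by (rule Ck_on_compose[OF open_\<Omega> op _ X_smooth]) (use graph_N in auto)
  then show ?thesis unfolding H_def .
qed

lemma Hz_smooth: "Ck_on k \<Omega> Hz" and Ht_smooth: "Ck_on k \<Omega> Ht"
  unfolding Hz_def Ht_def using Ck_on_D[OF H_smooth] by auto

lemma Hzz_smooth: "Ck_on k \<Omega> Hzz"
  unfolding Hzz_def using Ck_on_D[OF Hz_smooth] by auto

lemma H_has_derivative: "y \<in> \<Omega> \<Longrightarrow> (H has_derivative D H y) (at y)"
  by (rule Ck_on_has_derivative[OF H_smooth])

lemma Hz_has_derivative: "y \<in> \<Omega> \<Longrightarrow> (Hz has_derivative D Hz y) (at y)"
  by (rule Ck_on_has_derivative[OF Hz_smooth])

lemma H0: "q \<in> U \<Longrightarrow> H (0, q) = x' q"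
  using box graph_N unfolding flow_box_def H_def by auto

lemma K_W: "y \<in> \<Omega> \<Longrightarrow> K y \<in> W"
  using box graph_N unfolding flow_box_def H_def K_def by auto

lemma K1_Wh: "y \<in> \<Omega> \<Longrightarrow> K1 y \<in> Wh"
  using K_W unfolding K_def K1_def Wh_def by auto

lemma K_E: "s \<in> I \<Longrightarrow> q \<in> M \<Longrightarrow> K (s, q) \<in> total_space P"
  using K_W[of "(s, q)"] MU unfolding E_eq K_def by auto

lemma dsH: "y \<in> \<Omega> \<Longrightarrow> D H y (1, 0, 0) = V (K y)"
proof -
  assume y: "y \<in> \<Omega>"
  obtain s q where sq: "y = (s, q)" "s \<in> I" "q \<in> U" using y by auto
  have "((\<lambda>s. H (s, q)) has_vector_derivative D H (s, q) (1, 0)) (at s)"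
    by (rule has_vector_derivative_fst[OF H_has_derivative]) (use sq in auto)
  moreover have "((\<lambda>s. H (s, q)) has_vector_derivative V (K (s, q))) (at s)"
    using box graph_N[OF sq(3)] sq(2) unfolding flow_box_def H_def K_def by auto
  ultimately have "D H (s, q) (1, 0) = V (K (s, q))" by (rule vector_derivative_unique_at)
  then show ?thesis unfolding sq(1) by (simp add: zero_prod_def)
qed

lemma VK_has_derivative:
  assumes y: "y \<in> \<Omega>"
  shows "((\<lambda>y. V (K y)) has_derivative
    (\<lambda>w. D V (K y) (fst (snd w), snd (snd w), D H y w, D u' (snd y) (snd w)))) (at y)"
proof -
  have u: "((\<lambda>y. u' (snd y)) has_derivative (\<lambda>w. D u' (snd y) (snd w))) (at y)"
    by (rule has_derivative_compose[OF bounded_linear_imp_has_derivative[OF bounded_linear_snd]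
          Ck_on_has_derivative[OF u'(1)]]) (use y in auto)
  have Kd: "(K has_derivative (\<lambda>w. (fst (snd w), snd (snd w), D H y w, D u' (snd y) (snd w)))) (at y)"
    unfolding K_def
    by (intro has_derivative_Pair u H_has_derivative y bounded_linear_imp_has_derivative
        bounded_linear_fst_comp bounded_linear_snd_comp bounded_linear_ident)
  show ?thesis
    by (rule has_derivative_compose[OF Kd Ck_on_has_derivative[OF V_smooth K_W[OF y]]])
qed

lemma hK1_has_derivative:
  assumes y: "y \<in> \<Omega>"
  shows "((\<lambda>y. h (K1 y)) has_derivative
    (\<lambda>w. D h (K1 y) (fst (snd w), snd (snd w), D H y w, D u' (snd y) (snd w), D Hz y w, D uz (snd y) (snd w)))) (at y)"
proof -
  have s: "(snd has_derivative snd) (at y)" by (intro bounded_linear_imp_has_derivative bounded_linear_snd)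
  have u: "((\<lambda>y. u' (snd y)) has_derivative (\<lambda>w. D u' (snd y) (snd w))) (at y)"
    by (rule has_derivative_compose[OF s Ck_on_has_derivative[OF u'(1)]]) (use y in auto)
  have uz: "((\<lambda>y. uz (snd y)) has_derivative (\<lambda>w. D uz (snd y) (snd w))) (at y)"
    by (rule has_derivative_compose[OF s Ck_on_has_derivative[OF uz_smooth]]) (use y in auto)
  have Kd: "(K1 has_derivative (\<lambda>w. (fst (snd w), snd (snd w), D H y w, D u' (snd y) (snd w), D Hz y w, D uz (snd y) (snd w)))) (at y)"
    unfolding K1_def
    by (intro has_derivative_Pair u uz H_has_derivative Hz_has_derivative y bounded_linear_imp_has_derivative
        bounded_linear_fst_comp bounded_linear_snd_comp bounded_linear_ident)
  show ?thesis
    by (rule has_derivative_compose[OF Kd Ck_on_has_derivative[OF h_smooth K1_Wh[OF y]]])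
qed

text \<open>Differentiating the flow equation \<open>dsH\<close> in \<open>t\<close> and
  \<open>z\<close>, and the result for \<open>Hz\<close> once more in \<open>z\<close>, gives here
  and in the next two lemmas the \<open>x_t\<close>, \<open>x_z\<close> and \<open>x_zz\<close>
  components of the prolonged field along the transformed sections.\<close>

lemma dsHt: "y \<in> \<Omega> \<Longrightarrow> D Ht y (1, 0, 0) = D V (K y) (0, 1, Ht y, ut (snd y))"
  using D_D_commute[OF open_\<Omega> H_smooth _ dsH VK_has_derivative, of y "(0, 0, 1)"]
  unfolding Ht_def ut_def by simp

lemma dsHz: "y \<in> \<Omega> \<Longrightarrow> D Hz y (1, 0, 0) = h (K1 y)"
  using D_D_commute[OF open_\<Omega> H_smooth _ dsH VK_has_derivative, of y "(0, 1, 0)"]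
  unfolding Hz_def h_def K1_def K_def uz_def by simp

lemma dsHzz: "y \<in> \<Omega> \<Longrightarrow> D Hzz y (1, 0, 0) =
    D h (K1 y) (1, 0, Hz y, uz (snd y), Hzz y, D uz (snd y) (1, 0))"
  using D_D_commute[OF open_\<Omega> Hz_smooth _ dsHz hK1_has_derivative, of y "(0, 1, 0)"]
  unfolding Hzz_def uz_def Hz_def by simp

text \<open>Formed from the original section, not from its extension, because this is the function
  that occurs in solutions; on \<open>M\<close> it agrees with \<open>H\<close>.\<close>

definition \<Gamma> :: "real \<Rightarrow> real \<times> real \<Rightarrow> real^'n" where
  "\<Gamma> r q = X (r, fst q, snd q, \<gamma>x q, \<gamma>u q)"

section \<open>Jets of the original and of the transformed section\<close>

lemma \<Gamma>_eq: "q \<in> M \<Longrightarrow> H (r, q) = \<Gamma> r q"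
  unfolding \<Gamma>_def H_def using x'(2) u'(2) by simp

lemma \<Gamma>_E: "r \<in> I \<Longrightarrow> q \<in> M \<Longrightarrow> (fst q, snd q, \<Gamma> r q, \<gamma>u q) \<in> total_space P"
  using K_E[of r q] u'(2)[of q] \<Gamma>_eq[of q r] unfolding K_def by auto

lemma pd_\<Gamma>:
  assumes r: "r \<in> I" and q: "q \<in> M"
  shows "pd_z M (\<Gamma> r) q = Hz (r, q)" "pd_t M (\<Gamma> r) q = Ht (r, q)" "pd_z M (pd_z M (\<Gamma> r)) q = Hzz (r, q)"
proof -
  have *: "(r, q) \<in> \<Omega>" if "q \<in> M" for q using r that MU by auto
  have 1: "pd_z M (\<Gamma> r) q = Hz (r, q)" "pd_t M (\<Gamma> r) q = Ht (r, q)" if "q \<in> M" for q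
    using pd_eq[OF thick_M that has_derivative_snd_section[OF H_has_derivative[OF *[OF that]]] \<Gamma>_eq]
    unfolding Hz_def Ht_def by auto
  show "pd_z M (\<Gamma> r) q = Hz (r, q)" "pd_t M (\<Gamma> r) q = Ht (r, q)" by (rule 1[OF q])+
  show "pd_z M (pd_z M (\<Gamma> r)) q = Hzz (r, q)"
    using pd_eq(1)[OF thick_M q has_derivative_snd_section[OF Hz_has_derivative[OF *[OF q]]] 1(1)[symmetric]]
    unfolding Hzz_def by auto
qed

lemma pd_\<gamma>u:
  assumes q: "q \<in> M"
  shows "pd_z M \<gamma>u q = uz q" "pd_t M \<gamma>u q = ut q" "pd_z M (pd_z M \<gamma>u) q = D uz q (1, 0)"
proof -
  have *: "q \<in> U" if "q \<in> M" for q using that MU by auto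
  have 1: "pd_z M \<gamma>u q = uz q" "pd_t M \<gamma>u q = ut q" if "q \<in> M" for q
    using pd_eq[OF thick_M that Ck_on_has_derivative[OF u'(1) *[OF that]] u'(2)]
    unfolding uz_def ut_def by auto
  show "pd_z M \<gamma>u q = uz q" "pd_t M \<gamma>u q = ut q" by (rule 1[OF q])+
  show "pd_z M (pd_z M \<gamma>u) q = D uz q (1, 0)"
    by (rule pd_eq(1)[OF thick_M q Ck_on_has_derivative[OF uz_smooth *[OF q]] 1(1)[symmetric]])
qed

lemma \<Gamma>0: "q \<in> M \<Longrightarrow> \<Gamma> 0 q = \<gamma>x q"
  using \<Gamma>_eq[of q 0] H0[of q] x'(2)[of q] MU by auto

lemma pd_\<gamma>x:
  assumes q: "q \<in> M"
  shows "pd_z M \<gamma>x q = Hz (0, q)" "pd_t M \<gamma>x q = Ht (0, q)" "pd_z M (pd_z M \<gamma>x) q = Hzz (0, q)"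
proof -
  have 0: "0 \<in> I" using \<delta> by auto
  have *: "(0, q) \<in> \<Omega>" if "q \<in> M" for q using 0 that MU by auto
  have e: "H (0, q) = \<gamma>x q" if "q \<in> M" for q using \<Gamma>_eq[OF that] \<Gamma>0[OF that] by simp
  have 1: "pd_z M \<gamma>x q = Hz (0, q)" "pd_t M \<gamma>x q = Ht (0, q)" if "q \<in> M" for q
    using pd_eq[OF thick_M that has_derivative_snd_section[OF H_has_derivative[OF *[OF that]]] e]
    unfolding Hz_def Ht_def by auto
  show "pd_z M \<gamma>x q = Hz (0, q)" "pd_t M \<gamma>x q = Ht (0, q)" by (rule 1[OF q])+
  show "pd_z M (pd_z M \<gamma>x) q = Hzz (0, q)"
    using pd_eq(1)[OF thick_M q has_derivative_snd_section[OF Hz_has_derivative[OF *[OF q]]] 1(1)[symmetric]]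
    unfolding Hzz_def by auto
qed

text \<open>The equations, and with them \<open>u_z = 0\<close>, are imposed for
  \<open>0 < z < 1\<close> only. The boundary and output lemmas below therefore carry
  \<open>uz\<close> along as a jet coordinate.\<close>

lemma u_interior:
  assumes "z \<in> {0<..<1}" "t \<in> {0..<T}"
  shows "uz (z, t) = 0" "D uz (z, t) (1, 0) = 0" "pd_t M (pd_z M \<gamma>u) (z, t) = 0"
proof -
  have q: "(z, t) \<in> M" using assms by auto
  have "sec_j2 M \<gamma>x \<gamma>u (z, t) \<in> S2 P" using sol assms unfolding is_solution_def by blast
  then have "pd_z M \<gamma>u (z, t) = 0" "pd_z M (pd_z M \<gamma>u) (z, t) = 0" "pd_t M (pd_z M \<gamma>u) (z, t) = 0"
    unfolding S2_def S2_funs_def sec_j2_def sec_j1_def by auto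
  then show "uz (z, t) = 0" "D uz (z, t) (1, 0) = 0" "pd_t M (pd_z M \<gamma>u) (z, t) = 0"
    using pd_\<gamma>u[OF q] by simp_all
qed

text \<open>The defect \<open>e = x_t - f\<close> of the transformed section satisfies a linear homogeneous ODE in the flow
  parameter: only the \<open>d_t v\<close> part of the prolongation depends on \<open>x_t\<close>, and it is affine in it.\<close>

lemma transformed_pde:
  assumes r: "r \<in> I" and z: "z \<in> {0<..<1}" and t: "t \<in> {0..<T}"
  shows "Ht (r, z, t) = f (z, t, H (r, z, t), Hz (r, z, t), Hzz (r, z, t), u' (z, t))"
proof -
  define q where "q = (z, t)"
  have q: "q \<in> M" "q \<in> U" using z t MU unfolding q_def by auto
  define Fc where "Fc s = (z, t, H (s, q), Hz (s, q), Hzz (s, q), u' q)" for s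
  define e where "e s = Ht (s, q) - f (Fc s)" for s
  define a b where "a = min 0 r" and "b = max 0 r"
  have ab: "0 \<in> {a..b}" "r \<in> {a..b}" "{a..b} \<subseteq> I" using r \<delta> unfolding a_def b_def by auto
  have y: "(s, q) \<in> \<Omega>" if "s \<in> {a..b}" for s using that ab q by auto
  have KE: "K (s, q) \<in> total_space P" if "s \<in> {a..b}" for s using K_E[OF _ q(1)] that ab by auto
  have Keq: "K (s, q) = (z, t, H (s, q), u' q)" for s unfolding K_def q_def by simp
  have FcW: "Fc s \<in> Wf" if "s \<in> {a..b}" for s unfolding Fc_def using f_dom KE[OF that] unfolding Keq by blast
  have u0: "uz q = 0" "D uz q (1, 0) = 0" using u_interior[OF z t] unfolding q_def by auto
  have K1eq: "K1 (s, q) = (z, t, H (s, q), u' q, Hz (s, q), 0)" for s unfolding K1_def using u0 by (simp add: q_def)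
  have der_e: "(e has_vector_derivative D V (K (s, q)) (0, 0, e s, 0)) (at s within {a..b})" if s: "s \<in> {a..b}" for s
  proof -
    note fstd = has_vector_derivative_fst[OF Ck_on_has_derivative[OF _ y[OF s]]]
    have dt: "((\<lambda>s. Ht (s, q)) has_vector_derivative D V (K (s, q)) (0, 1, Ht (s, q), ut q)) (at s)"
      using fstd[OF Ht_smooth] dsHt[OF y[OF s]] by (simp add: zero_prod_def)
    have d: "((\<lambda>s. H (s, q)) has_vector_derivative V (K (s, q))) (at s)"
      using fstd[OF H_smooth] dsH[OF y[OF s]] by (simp add: zero_prod_def)
    have dz: "((\<lambda>s. Hz (s, q)) has_vector_derivative h (K1 (s, q))) (at s)"
      using fstd[OF Hz_smooth] dsHz[OF y[OF s]] by (simp add: zero_prod_def)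
    have dzz: "((\<lambda>s. Hzz (s, q)) has_vector_derivative D h (K1 (s, q)) (1, 0, Hz (s, q), 0, Hzz (s, q), 0)) (at s)"
      using fstd[OF Hzz_smooth] dsHzz[OF y[OF s]] u0 by (simp add: zero_prod_def)
    have dFc: "(Fc has_vector_derivative (0, 0, V (K (s, q)), h (K1 (s, q)), D h (K1 (s, q)) (1, 0, Hz (s, q), 0, Hzz (s, q), 0), 0)) (at s)"
      unfolding Fc_def by (intro has_vector_derivative_Pair has_vector_derivative_const d dz dzz)
    have df: "((\<lambda>s. f (Fc s)) has_vector_derivative D f (Fc s) (0, 0, V (K (s, q)), h (K1 (s, q)), D h (K1 (s, q)) (1, 0, Hz (s, q), 0, Hzz (s, q), 0), 0)) (at s)"
      by (rule has_vector_derivative_chain[OF dFc Ck_on_has_derivative[OF f_smooth FcW[OF s]]])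
    \<comment> \<open>Condition 3 is used at the jet obtained by replacing \<open>Ht\<close> with
      \<open>f (Fc s)\<close>. This jet lies on \<open>S2 P\<close> whether or not the transformed
      section is already known to solve the PDE.\<close>
    have id: "D f (Fc s) (0, 0, V (K (s, q)), h (K1 (s, q)), D h (K1 (s, q)) (1, 0, Hz (s, q), 0, Hzz (s, q), 0), 0) =
        D V (K (s, q)) (0, 1, f (Fc s), ut q)"
      using pde_identity[OF KE[OF s, unfolded Keq], of "Hz (s, q)" "Hzz (s, q)" "ut q"] unfolding Keq K1eq Fc_def by simp
    have "D V (K (s, q)) (0, 1, Ht (s, q), ut q) - D V (K (s, q)) (0, 1, f (Fc s), ut q) = D V (K (s, q)) (0, 0, e s, 0)"
      using linear_diff[OF Ck_on_linear_D[OF V_smooth K_W[OF y[OF s]]], of "(0, 1, Ht (s, q), ut q)" "(0, 1, f (Fc s), ut q)"]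
      unfolding e_def by simp
    then have "(e has_vector_derivative D V (K (s, q)) (0, 0, e s, 0)) (at s)"
      using has_vector_derivative_diff[OF dt df[unfolded id]] unfolding e_def by simp
    then show ?thesis by (rule has_vector_derivative_at_within)
  qed
  \<comment> \<open>A single bound for \<open>D V\<close> along the compact flow line turns the
    linear ODE into the inequality required by \<open>zero_propagation\<close>.\<close>
  have cK: "compact ((\<lambda>s. K (s, q)) ` {a..b})"
  proof (intro compact_continuous_image compact_Icc)
    have "continuous_on {a..b} (\<lambda>s. H (s, q))"
      by (rule continuous_on_compose2[OF Ck_on_imp_continuous_on[OF H_smooth]]) (use y in \<open>auto intro!: continuous_intros\<close>)
    then show "continuous_on {a..b} (\<lambda>s. K (s, q))" unfolding Keq by (intro continuous_intros)
  qed
  have "(\<lambda>s. K (s, q)) ` {a..b} \<subseteq> W" using K_W[OF y] by blast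
  then have "\<exists>B. \<forall>p\<in>(\<lambda>s. K (s, q)) ` {a..b}. \<forall>w. norm (D V p w) \<le> B * norm w"
    by (rule bounded_D_compact[OF cK _ V_smooth]) meson
  then obtain B where B: "\<And>s w. s \<in> {a..b} \<Longrightarrow> norm (D V (K (s, q)) w) \<le> B * norm w" by blast
  have "e r = 0"
  proof (rule zero_propagation[OF der_e _ ab(1) _ ab(2)])
    show "\<exists>L \<rho>. 0 < \<rho> \<and> (\<forall>s\<in>{a..b}. \<bar>s - s0\<bar> < \<rho> \<longrightarrow> norm (D V (K (s, q)) (0, 0, e s, 0)) \<le> L * norm (e s))" for s0
    proof (rule exI[of _ B], rule exI[of _ 1], intro conjI ballI impI)
      fix s assume "s \<in> {a..b}"
      then show "norm (D V (K (s, q)) (0, 0, e s, 0)) \<le> B * norm (e s)"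
        using B[of s "(0, 0, e s, 0)"] by (simp add: norm_Pair)
    qed simp
    have "sec_j2 M \<gamma>x \<gamma>u (z, t) \<in> S2 P" using sol z t unfolding is_solution_def by blast
    then have "pde_fun P \<alpha> (sec_j2 M \<gamma>x \<gamma>u q) = 0" for \<alpha> unfolding S2_def S2_funs_def q_def by auto
    then have "pd_t M \<gamma>x q $ \<alpha> = rhs P (z, t, \<gamma>x q, pd_z M \<gamma>x q, pd_z M (pd_z M \<gamma>x) q, \<gamma>u q) $ \<alpha>" for \<alpha>
      unfolding pde_fun_def sec_j2_def sec_j1_def q_def by simp
    then have "pd_t M \<gamma>x q = rhs P (z, t, \<gamma>x q, pd_z M \<gamma>x q, pd_z M (pd_z M \<gamma>x) q, \<gamma>u q)"
      by (simp add: vec_eq_iff)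
    then have "Ht (0, q) = rhs P (z, t, H (0, q), Hz (0, q), Hzz (0, q), u' q)"
      using pd_\<gamma>x[OF q(1)] H0[OF q(2)] x'(2)[OF q(1)] u'(2)[OF q(1)] by simp
    then show "e 0 = 0" unfolding e_def Fc_def using f_eq[of z t "H (0, q)" "u' q"] KE[OF ab(1)] unfolding Keq by simp
  qed auto
  then show ?thesis unfolding e_def Fc_def q_def by simp
qed

lemma sec_j2_\<Gamma>:
  assumes r: "r \<in> I" and z: "z \<in> {0<..<1}" and t: "t \<in> {0..<T}"
  shows "sec_j2 M (\<Gamma> r) \<gamma>u (z, t) \<in> S2 P"
proof -
  have q: "(z, t) \<in> M" using z t by auto
  have E: "(z, t, \<Gamma> r (z, t), \<gamma>u (z, t)) \<in> total_space P" using \<Gamma>_E[OF r q] by simp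
  have "pde_fun P \<alpha> (sec_j2 M (\<Gamma> r) \<gamma>u (z, t)) = 0" for \<alpha>
    unfolding pde_fun_def sec_j2_def sec_j1_def
    using transformed_pde[OF r z t] pd_\<Gamma>[OF r q] \<Gamma>_eq[OF q, of r] u'(2)[OF q] f_eq[OF E] by simp
  moreover have "sec_j2 M (\<Gamma> r) \<gamma>u (z, t) \<in> J2 P" unfolding sec_j2_def sec_j1_def J2_def J1_def using E by simp
  ultimately show ?thesis
    unfolding S2_def S2_funs_def using u_interior[OF z t] pd_\<gamma>u[OF q] by (auto simp: sec_j2_def sec_j1_def)
qed

section \<open>Output and boundary conditions along the flow\<close>

lemma bfun_derivative:
  fixes g :: "real \<times> (real^'n) \<times> (real^'n) \<Rightarrow> real"
  assumes s: "s \<in> I" and q: "(z, t) \<in> U" and g: "Ck_on (Suc 0) Wg g" "(t, H (s, z, t), Hz (s, z, t)) \<in> Wg"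
  shows "((\<lambda>s. g (t, H (s, z, t), Hz (s, z, t))) has_vector_derivative
    D g (t, H (s, z, t), Hz (s, z, t)) (0, V (z, t, H (s, z, t), u' (z, t)), h (z, t, H (s, z, t), u' (z, t), Hz (s, z, t), uz (z, t)))) (at s)"
proof -
  have y: "(s, z, t) \<in> \<Omega>" using s q by auto
  note fstd = has_vector_derivative_fst[OF Ck_on_has_derivative[OF _ y]]
  have d: "((\<lambda>s. H (s, z, t)) has_vector_derivative V (z, t, H (s, z, t), u' (z, t))) (at s)"
    using fstd[OF H_smooth] dsH[OF y] by (simp add: zero_prod_def K_def)
  have dz: "((\<lambda>s. Hz (s, z, t)) has_vector_derivative h (z, t, H (s, z, t), u' (z, t), Hz (s, z, t), uz (z, t))) (at s)"
    using fstd[OF Hz_smooth] dsHz[OF y] by (simp add: zero_prod_def K1_def)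
  have dc: "((\<lambda>s. (t, H (s, z, t), Hz (s, z, t))) has_vector_derivative
      (0, V (z, t, H (s, z, t), u' (z, t)), h (z, t, H (s, z, t), u' (z, t), Hz (s, z, t), uz (z, t)))) (at s)"
    by (intro has_vector_derivative_Pair has_vector_derivative_const d dz)
  show ?thesis
    by (rule has_vector_derivative_chain[OF dc Ck_on_has_derivative[OF g]])
qed

text \<open>The Lie derivative vanishes at all jets over \<open>z\<close>, not only on a level set,
  so the function has zero derivative along the flow line and is constant there.\<close>

lemma output_invariant:
  assumes r: "r \<in> I" and z: "z \<in> {0..1}" and t: "t \<in> {0..<T}"
    and g: "open Wg" "Ck_on (Suc 0) Wg g"
      "\<And>t x xz u. (z, t, x, u) \<in> total_space P \<Longrightarrow> (t, x, xz) \<in> Wg \<and> g (t, x, xz) = \<phi> (t, x, xz)"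
    and lie: "\<And>b. b \<in> bjets P z \<Longrightarrow> lie (bjets P z) (j1_at P v z) (on_bjet \<phi>) b = 0"
  shows "\<phi> (t, \<Gamma> r (z, t), pd_z M (\<Gamma> r) (z, t)) = \<phi> (t, \<gamma>x (z, t), pd_z M \<gamma>x (z, t))"
proof -
  have q: "(z, t) \<in> M" "(z, t) \<in> U" using z t MU by auto
  have E: "(z, t, H (s, z, t), u' (z, t)) \<in> total_space P" if "s \<in> I" for s
    using K_E[OF that q(1)] unfolding K_def by simp
  have "((\<lambda>s. g (t, H (s, z, t), Hz (s, z, t))) has_vector_derivative 0) (at s within I)" if s: "s \<in> I" for s
  proof -
    have b: "(t, H (s, z, t), u' (z, t), Hz (s, z, t), 0, uz (z, t), 0) \<in> bjets P z"
      using E[OF s] unfolding bjets_def J1_def by simp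
    have "D g (t, H (s, z, t), Hz (s, z, t)) (0, V (z, t, H (s, z, t), u' (z, t)), h (z, t, H (s, z, t), u' (z, t), Hz (s, z, t), uz (z, t))) = 0"
      using bjet_derivative(3)[OF z g b] lie[OF b] by simp
    moreover have "(t, H (s, z, t), Hz (s, z, t)) \<in> Wg" using g(3)[OF E[OF s]] by blast
    ultimately show ?thesis
      using has_vector_derivative_at_within[OF bfun_derivative[OF s q(2) g(2)]] by simp
  qed
  then obtain c where c: "\<And>s. s \<in> I \<Longrightarrow> g (t, H (s, z, t), Hz (s, z, t)) = c"
    using has_vector_derivative_zero_constant[of I "\<lambda>s. g (t, H (s, z, t), Hz (s, z, t))"] by fastforce
  have 0: "0 \<in> I" using \<delta> by simp
  have eq: "g (t, H (s, z, t), Hz (s, z, t)) = \<phi> (t, \<Gamma> s (z, t), pd_z M (\<Gamma> s) (z, t))" if "s \<in> I" for s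
    using g(3)[OF E[OF that]] \<Gamma>_eq[OF q(1), of s] pd_\<Gamma>(1)[OF that q(1)] by simp
  show ?thesis
    using c[OF r] c[OF 0] eq[OF r] eq[OF 0] \<Gamma>0[OF q(1)] pd_\<gamma>x(1)[OF q(1)] pd_\<Gamma>(1)[OF 0 q(1)] by simp
qed

text \<open>At \<open>t = 0\<close> the boundary jets form a half space and the rank may come from the \<open>t\<close>-direction, so the level
  set argument is used for \<open>t > 0\<close> only and \<open>t = 0\<close> is reached by continuity.\<close>

lemma boundary_invariant:
  fixes bc :: "nat \<Rightarrow> real \<times> (real^'n) \<times> (real^'n) \<Rightarrow> real"
  defines "S \<equiv> \<lambda>z n. {b \<in> bjets P z. \<forall>l\<in>{1..n}. on_bjet (bc l) b = 0}"
  assumes r: "r \<in> I" and z: "z \<in> {0..1}" and t: "t \<in> {0..<T}"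
    and sm: "\<And>l. l \<in> {1..n} \<Longrightarrow> smooth_on {(t, x, xz). \<exists>u. (z, t, x, u) \<in> total_space P} (bc l)"
    and lie: "\<And>l b. l \<in> {1..n} \<Longrightarrow> b \<in> S z n \<Longrightarrow> lie (bjets P z) (j1_at P v z) (on_bjet (bc l)) b = 0"
    and rank: "\<And>b. b \<in> S z n \<Longrightarrow> jacobian_rank (bjets P z) ((\<lambda>l. on_bjet (bc l)) ` {1..n}) b = n"
    and sol0: "\<And>t l. t \<in> {0..<T} \<Longrightarrow> l \<in> {1..n} \<Longrightarrow> bc l (t, \<gamma>x (z, t), pd_z M \<gamma>x (z, t)) = 0"
    and l: "l \<in> {1..n}"
  shows "bc l (t, \<Gamma> r (z, t), pd_z M (\<Gamma> r) (z, t)) = 0"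
proof -
  have "\<exists>Wg g. open Wg \<and> (\<forall>k. Ck_on k Wg g) \<and>
      (\<forall>t x xz u. (z, t, x, u) \<in> total_space P \<longrightarrow> (t, x, xz) \<in> Wg \<and> g (t, x, xz) = bc l (t, x, xz))"
    if l: "l \<in> {1..n}" for l
  proof -
    obtain Wg g where "open Wg" "{(t, x, xz). \<exists>u. (z, t, x, u) \<in> total_space P} \<subseteq> Wg" "\<forall>k. Ck_on k Wg g"
      "\<forall>p\<in>{(t, x, xz). \<exists>u. (z, t, x, u) \<in> total_space P}. g p = bc l p"
      using sm[OF l] unfolding smooth_on_def by blast
    then show ?thesis by (intro exI[of _ Wg] exI[of _ g]) auto
  qed
  then have "\<forall>l\<in>{1..n}. \<exists>Wg. \<exists>g. open Wg \<and> (\<forall>k. Ck_on k Wg g) \<and>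
      (\<forall>t x xz u. (z, t, x, u) \<in> total_space P \<longrightarrow> (t, x, xz) \<in> Wg \<and> g (t, x, xz) = bc l (t, x, xz))" by simp
  then have "\<exists>Wg. \<forall>l\<in>{1..n}. \<exists>g. open (Wg l) \<and> (\<forall>k. Ck_on k (Wg l) g) \<and>
      (\<forall>t x xz u. (z, t, x, u) \<in> total_space P \<longrightarrow> (t, x, xz) \<in> Wg l \<and> g (t, x, xz) = bc l (t, x, xz))" by (rule bchoice)
  then obtain Wg where "\<forall>l\<in>{1..n}. \<exists>g. open (Wg l) \<and> (\<forall>k. Ck_on k (Wg l) g) \<and>
      (\<forall>t x xz u. (z, t, x, u) \<in> total_space P \<longrightarrow> (t, x, xz) \<in> Wg l \<and> g (t, x, xz) = bc l (t, x, xz))" ..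
  then have "\<exists>g. \<forall>l\<in>{1..n}. open (Wg l) \<and> (\<forall>k. Ck_on k (Wg l) (g l)) \<and>
      (\<forall>t x xz u. (z, t, x, u) \<in> total_space P \<longrightarrow> (t, x, xz) \<in> Wg l \<and> g l (t, x, xz) = bc l (t, x, xz))" by (rule bchoice)
  then obtain g where gW: "\<forall>l\<in>{1..n}. open (Wg l) \<and> (\<forall>k. Ck_on k (Wg l) (g l)) \<and>
      (\<forall>t x xz u. (z, t, x, u) \<in> total_space P \<longrightarrow> (t, x, xz) \<in> Wg l \<and> g l (t, x, xz) = bc l (t, x, xz))" ..
  have Wg: "open (Wg l)" and gs: "Ck_on k (Wg l) (g l)" if "l \<in> {1..n}" for l k
    using bspec[OF gW that] by simp_all
  have ext: "(t, x, xz) \<in> Wg l \<and> g l (t, x, xz) = bc l (t, x, xz)"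
    if "l \<in> {1..n}" "(z, t, x, u) \<in> total_space P" for l t x xz u
    using bspec[OF gW that(1)] that(2) by blast
  have E: "(z, t, H (s, z, t), u' (z, t)) \<in> total_space P" if "s \<in> I" "t \<in> {0..<T}" for s t
    using K_E[OF that(1), of "(z, t)"] z that(2) unfolding K_def by auto
  have pos: "g l (t, H (r, z, t), Hz (r, z, t)) = 0" if t: "t \<in> {0<..<T}" and l: "l \<in> {1..n}" for t l
  proof -
    have q: "(z, t) \<in> M" "(z, t) \<in> U" using z t MU by auto
    \<comment> \<open>Open in the full jet space, as \<open>invariant_level_set\<close> requires,
      and contained in the boundary jets.\<close>
    define B where "B = ({0<..} \<times> UNIV) \<inter> bset z"
    have B: "open B" unfolding B_def by (intro open_Int open_Times open_bset) auto
    have BE: "(z, fst b, fst (snd b), fst (snd (snd b))) \<in> total_space P" if "b \<in> B" for b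
      using that z unfolding B_def bset_def E_eq by auto
    have Bb: "b \<in> bjets P z" if "b \<in> B" for b
      using that unfolding bjets_eq[OF z] B_def by auto
    define pr where "pr = (\<lambda>q::'n bjet. (fst q, fst (snd q), fst (snd (snd (snd q)))))"
    define g' where "g' l b = D (g l) (pr b) (0, V (z, fst b, fst (snd b), fst (snd (snd b))),
        h (z, fst b, fst (snd b), fst (snd (snd b)), fst (snd (snd (snd b))), fst (snd (snd (snd (snd (snd b)))))))"
      for l and b :: "'n bjet"
    have on: "on_bjet (g l) = (\<lambda>b. g l (pr b))" for l unfolding on_bjet_def pr_def by (auto simp: fun_eq_iff)
    have pr: "Ck_on k B pr" for k unfolding pr_def
      by (intro Ck_on_Pair Ck_on_fst Ck_on_snd Ck_on_ident B)
    have pr_in: "pr b \<in> Wg l" if "l \<in> {1..n}" "b \<in> B" for l b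
      using ext[OF that(1) BE[OF that(2)]] unfolding pr_def by blast
    have zero_S: "b \<in> S z n" if b: "b \<in> B" and 0: "\<And>m. m \<in> {1..n} \<Longrightarrow> on_bjet (g m) b = 0" for b
    proof -
      have "on_bjet (bc m) b = 0" if m: "m \<in> {1..n}" for m
        using 0[OF m] ext[OF m BE[OF b], of "fst (snd (snd (snd b)))"] unfolding on_bjet_def by (simp add: case_prod_unfold)
      then show ?thesis unfolding S_def using Bb[OF b] by simp
    qed
    have g'_lie: "g' l b = lie (bjets P z) (j1_at P v z) (on_bjet (bc l)) b" if "l \<in> {1..n}" "b \<in> B" for l b
    proof -
      obtain t x u xz xt uz ut where b: "b = (t, x, u, xz, xt, uz, ut)" by (cases b) auto
      show ?thesis
        using bjet_derivative(3)[OF z Wg[OF that(1)] gs[OF that(1)] ext[OF that(1)] Bb[OF that(2), unfolded b]]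
        unfolding b g'_def pr_def by simp
    qed
    have grad: "gradient (bjets P z) (on_bjet (bc l)) b = (\<Sum>i\<in>Basis. D (on_bjet (g l)) b i *\<^sub>R i)" if "l \<in> {1..n}" "b \<in> B" for l b
    proof -
      obtain t x u xz xt uz ut where b: "b = (t, x, u, xz, xt, uz, ut)" by (cases b) auto
      have "frechet_derivative (on_bjet (bc l)) (at b within bjets P z) = D (on_bjet (g l)) b"
        using bjet_derivative(1,2)[OF z Wg[OF that(1)] gs[OF that(1)] ext[OF that(1)] Bb[OF that(2), unfolded b]]
        unfolding b by simp
      then show ?thesis unfolding gradient_def by simp
    qed
    \<comment> \<open>The slots for \<open>x_t\<close> and \<open>u_t\<close> are filled with 0, as
      neither the conditions nor their Lie derivatives depend on them.\<close>
    define c where "c s = (t, H (s, z, t), u' (z, t), Hz (s, z, t), 0::real^'n, uz (z, t), 0::real)" for s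
    define a b where "a = min 0 r" and "b = max 0 r"
    have ab: "0 \<in> {a..b}" "r \<in> {a..b}" "{a..b} \<subseteq> I" using r \<delta> unfolding a_def b_def by auto
    have cB: "c s \<in> B" if "s \<in> {a..b}" for s
      using K_W[of "(s, z, t)"] that ab q(2) t unfolding B_def c_def bset_def K_def by auto
    have prc: "pr (c s) = (t, H (s, z, t), Hz (s, z, t))" for s unfolding pr_def c_def by simp
    have "on_bjet (g l) (c r) = 0"
    proof (rule invariant_level_set[where B = B and g = "\<lambda>l. on_bjet (g l)" and g' = g' and n = n and c = c, OF B _ _ _ _ _ cB _ ab(1) _ ab(2) l])
      show "Ck_on (Suc 0) B (on_bjet (g l))" if "l \<in> {1..n}" for l
        unfolding on by (rule Ck_on_compose[OF B Wg[OF that] pr gs[OF that] pr_in[OF that]])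
      show "Ck_on (Suc 0) B (g' l)" if "l \<in> {1..n}" for l
        unfolding g'_def
      proof (rule Ck_on_D_apply[OF B Wg[OF that] gs[OF that] pr _ pr_in[OF that]])
        have VC: "Ck_on (Suc 0) B (\<lambda>b. V (z, fst b, fst (snd b), fst (snd (snd b))))"
          by (rule Ck_on_compose[OF B open_W _ V_smooth])
            (use BE E_W in \<open>auto intro!: Ck_on_Pair Ck_on_fst Ck_on_snd Ck_on_ident Ck_on_const B\<close>)
        have hC: "Ck_on (Suc 0) B (\<lambda>b. h (z, fst b, fst (snd b), fst (snd (snd b)), fst (snd (snd (snd b))), fst (snd (snd (snd (snd (snd b)))))))"
          by (rule Ck_on_compose[OF B open_Wh _ h_smooth])
            (use BE E_W in \<open>auto simp: Wh_def intro!: Ck_on_Pair Ck_on_fst Ck_on_snd Ck_on_ident Ck_on_const B\<close>)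
        show "Ck_on (Suc 0) B (\<lambda>b. (0, V (z, fst b, fst (snd b), fst (snd (snd b))),
            h (z, fst b, fst (snd b), fst (snd (snd b)), fst (snd (snd (snd b))), fst (snd (snd (snd (snd (snd b))))))))"
          by (intro Ck_on_Pair Ck_on_const VC hC B)
      qed
      show "g' l b = 0" if "b \<in> B" "\<And>m. m \<in> {1..n} \<Longrightarrow> on_bjet (g m) b = 0" "l \<in> {1..n}" for b l
        using g'_lie[OF that(3,1)] lie[OF that(3) zero_S[OF that(1,2)]] by simp
      show "dim ((\<lambda>l. \<Sum>i\<in>Basis. D (on_bjet (g l)) b i *\<^sub>R i) ` {1..n}) = n"
        if "b \<in> B" "\<And>m. m \<in> {1..n} \<Longrightarrow> on_bjet (g m) b = 0" for b
      proof -
        have "(\<lambda>l. \<Sum>i\<in>Basis. D (on_bjet (g l)) b i *\<^sub>R i) ` {1..n} =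
            (\<lambda>\<phi>. gradient (bjets P z) \<phi> b) ` ((\<lambda>l. on_bjet (bc l)) ` {1..n})"
          unfolding image_image by (intro image_cong refl grad[symmetric] that(1))
        moreover have "jacobian_rank (bjets P z) ((\<lambda>l. on_bjet (bc l)) ` {1..n}) b = n"
          by (rule rank[OF zero_S[OF that(1,2)]])
        ultimately show ?thesis unfolding jacobian_rank_def by simp
      qed
      have "continuous_on {a..b} (\<lambda>s. H (s, z, t))"
        by (rule continuous_on_compose2[OF Ck_on_imp_continuous_on[OF H_smooth]]) (use ab q in \<open>auto intro!: continuous_intros\<close>)
      moreover have "continuous_on {a..b} (\<lambda>s. Hz (s, z, t))"
        by (rule continuous_on_compose2[OF Ck_on_imp_continuous_on[OF Hz_smooth]]) (use ab q in \<open>auto intro!: continuous_intros\<close>)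
      ultimately show "continuous_on {a..b} c" unfolding c_def by (intro continuous_intros)
      show "((\<lambda>s. on_bjet (g l) (c s)) has_vector_derivative g' l (c s)) (at s within {a..b})"
        if s: "s \<in> {a..b}" and l: "l \<in> {1..n}" for s l
      proof (rule has_vector_derivative_at_within)
        have "(t, H (s, z, t), Hz (s, z, t)) \<in> Wg l" using pr_in[OF l cB[OF s]] unfolding prc .
        from bfun_derivative[OF _ q(2) gs[OF l] this]
        show "((\<lambda>s. on_bjet (g l) (c s)) has_vector_derivative g' l (c s)) (at s)"
          unfolding on prc g'_def using s ab(3) by (auto simp: c_def)
      qed
      show "on_bjet (g l) (c 0) = 0" if l: "l \<in> {1..n}" for l
      proof -
        have t': "t \<in> {0..<T}" using t by simp
        have "g l (t, H (0, z, t), Hz (0, z, t)) = bc l (t, H (0, z, t), Hz (0, z, t))"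
          using ext[OF l E[OF _ t']] \<delta> by auto
        also have "\<dots> = 0"
          using sol0[OF t' l] pd_\<gamma>x(1)[OF q(1)] H0[OF q(2)] x'(2)[OF q(1)] by simp
        finally show ?thesis unfolding on prc .
      qed
    qed
    then show ?thesis unfolding on prc .
  qed
  have "g l (t, H (r, z, t), Hz (r, z, t)) = 0"
  proof (cases "t = 0")
    case False
    then show ?thesis using pos[OF _ l] t by simp
  next
    case True
    \<comment> \<open>Half of \<open>T\<close> gives a closed interval inside
      \<open>{0..<T}\<close>, on which the limit towards \<open>t = 0\<close> is taken.\<close>
    have cl: "closure {0<..<T / 2} = {0..T / 2}" using T by simp
    have U': "(r, z, t) \<in> \<Omega>" if "t \<in> {0..T / 2}" for t using that r z T MU by auto
    have "continuous_on {0..T / 2} (\<lambda>t. H (r, z, t))"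
      by (rule continuous_on_compose2[OF Ck_on_imp_continuous_on[OF H_smooth]]) (use U' in \<open>auto intro!: continuous_intros\<close>)
    moreover have "continuous_on {0..T / 2} (\<lambda>t. Hz (r, z, t))"
      by (rule continuous_on_compose2[OF Ck_on_imp_continuous_on[OF Hz_smooth]]) (use U' in \<open>auto intro!: continuous_intros\<close>)
    ultimately have c: "continuous_on {0..T / 2} (\<lambda>t. (t, H (r, z, t), Hz (r, z, t)))" by (intro continuous_intros)
    have "continuous_on {0..T / 2} (\<lambda>t. g l (t, H (r, z, t), Hz (r, z, t)))"
    proof (rule continuous_on_compose2[OF Ck_on_imp_continuous_on[OF gs[OF l, of 0]] c])
      show "(\<lambda>t. (t, H (r, z, t), Hz (r, z, t))) ` {0..T / 2} \<subseteq> Wg l"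
        using ext[OF l E[OF r]] T by fastforce
    qed
    then have "g l (0, H (r, z, 0), Hz (r, z, 0)) = 0"
      using continuous_constant_on_closure[of "{0<..<T / 2}" "\<lambda>t. g l (t, H (r, z, t), Hz (r, z, t))" 0 0]
        pos[OF _ l] T unfolding cl by auto
    then show ?thesis using True by simp
  qed
  moreover have "(z, t) \<in> M" using z t by auto
  ultimately show ?thesis using ext[OF l E[OF r t]] \<Gamma>_eq[of "(z, t)" r] pd_\<Gamma>(1)[OF r, of "(z, t)"] by simp
qed

lemma transformed_solution:
  assumes reg: "regular_system P"
    and lieA: "\<forall>l\<in>{1..nA P}. \<forall>b\<in>S1A P. lie (bjets P 0) (j1_at P v 0) (on_bjet (bcA P l)) b = 0"
    and lieB: "\<forall>m\<in>{1..nB P}. \<forall>b\<in>S1B P. lie (bjets P 1) (j1_at P v 1) (on_bjet (bcB P m)) b = 0"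
    and r: "r \<in> I"
  shows "is_solution P {0..<T} (\<Gamma> r) \<gamma>u"
  unfolding is_solution_def
proof (intro conjI ballI)
  have "Ck_on k U (\<lambda>q. H (r, q))" for k
    by (rule Ck_on_compose[OF open_U open_\<Omega> _ H_smooth])
      (use r in \<open>auto intro!: Ck_on_Pair Ck_on_const Ck_on_ident open_U\<close>)
  then show "smooth_on M (\<Gamma> r)" unfolding smooth_on_def
    using open_U MU \<Gamma>_eq by (intro exI[of _ U] exI[of _ "\<lambda>q. H (r, q)"]) auto
  show "smooth_on M \<gamma>u" using sol unfolding is_solution_def by blast
  show "(z, t, \<Gamma> r (z, t), \<gamma>u (z, t)) \<in> total_space P" if "z \<in> {0..1}" "t \<in> {0..<T}" for z t
    using \<Gamma>_E[OF r, of "(z, t)"] that by auto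
  show "sec_j2 M (\<Gamma> r) \<gamma>u (z, t) \<in> S2 P" if "z \<in> {0<..<1}" "t \<in> {0..<T}" for z t
    by (rule sec_j2_\<Gamma>[OF r that])
  note bc = reg[unfolded regular_system_def]
  have on: "on_bjet \<phi> (snd (sec_j1 M \<gamma> \<gamma>u (z, t))) = \<phi> (t, \<gamma> (z, t), pd_z M \<gamma> (z, t))" for \<phi> \<gamma> z t
    unfolding on_bjet_def sec_j1_def by simp
  show "on_bjet (bcA P l) (snd (sec_j1 M (\<Gamma> r) \<gamma>u (0, t))) = 0" if t: "t \<in> {0..<T}" and l: "l \<in> {1..nA P}" for t l
    unfolding on
  proof (rule boundary_invariant[OF r _ t _ _ _ _ l])
    show "bcA P l (t, \<gamma>x (0, t), pd_z M \<gamma>x (0, t)) = 0" if "t \<in> {0..<T}" "l \<in> {1..nA P}" for t l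
      using sol that unfolding is_solution_def on by blast
  qed (use bc lieA in \<open>auto simp: S1A_def\<close>)
  show "on_bjet (bcB P l) (snd (sec_j1 M (\<Gamma> r) \<gamma>u (1, t))) = 0" if t: "t \<in> {0..<T}" and l: "l \<in> {1..nB P}" for t l
    unfolding on
  proof (rule boundary_invariant[OF r _ t _ _ _ _ l])
    show "bcB P l (t, \<gamma>x (1, t), pd_z M \<gamma>x (1, t)) = 0" if "t \<in> {0..<T}" "l \<in> {1..nB P}" for t l
      using sol that unfolding is_solution_def on by blast
  qed (use bc lieB in \<open>auto simp: S1B_def\<close>)
qed

end

section \<open>Restriction of solutions\<close>

text \<open>Differentiability does not enter, because the choice operator in
  \<open>frechet_derivative\<close> sees the same predicate on both sides.\<close>

lemma frechet_derivative_within_cong: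
  assumes "p \<in> S" "\<And>q. q \<in> S \<Longrightarrow> F q = G q"
  shows "frechet_derivative F (at p within S) = frechet_derivative G (at p within S)"
proof -
  have "(F has_derivative F') (at p within S) \<longleftrightarrow> (G has_derivative F') (at p within S)" for F'
    using has_derivative_transform[OF assms(1), of G F F'] has_derivative_transform[OF assms(1), of F G F'] assms(2) by auto
  then show ?thesis unfolding frechet_derivative_def by simp
qed

lemma pd_cong:
  assumes "p \<in> S" "\<And>q. q \<in> S \<Longrightarrow> F q = G q"
  shows "pd_z S F p = pd_z S G p" "pd_t S F p = pd_t S G p"
  using frechet_derivative_within_cong[of p S F G] assms unfolding pd_z_def pd_t_def by auto

text \<open>Near a point with time below \<open>T\<close> the two domains coincide, hence so do the
  filters. The hypothesis on \<open>J\<close> covers both \<open>{0..}\<close> and a longer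
  half-open interval.\<close>

lemma pd_restrict:
  assumes J: "J \<inter> {..<T} = {0..<T}" and p: "p \<in> {0..1} \<times> {0..<T}"
  shows "pd_z ({0..1} \<times> J) F p = pd_z ({0..1} \<times> {0..<T}) F p" "pd_t ({0..1} \<times> J) F p = pd_t ({0..1} \<times> {0..<T}) F p"
proof -
  have "at p within {0..1} \<times> J = at p within {0..1} \<times> {0..<T}"
  proof (rule at_within_nhd[of p "UNIV \<times> {..<T}"])
    show "open (UNIV \<times> {..<T})" by (intro open_Times) auto
    show "p \<in> UNIV \<times> {..<T}" using p by auto
    have "({0..1::real} \<times> J) \<inter> (UNIV \<times> {..<T}) = {0..1} \<times> (J \<inter> {..<T})" by auto
    also have "\<dots> = ({0..1} \<times> {0..<T}) \<inter> (UNIV \<times> {..<T})" unfolding J by auto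
    finally show "({0..1} \<times> J) \<inter> (UNIV \<times> {..<T}) - {p} = ({0..1} \<times> {0..<T}) \<inter> (UNIV \<times> {..<T}) - {p}" by simp
  qed
  then show "pd_z ({0..1} \<times> J) F p = pd_z ({0..1} \<times> {0..<T}) F p" "pd_t ({0..1} \<times> J) F p = pd_t ({0..1} \<times> {0..<T}) F p"
    unfolding pd_z_def pd_t_def by simp_all
qed

lemma smooth_on_subset: "smooth_on S \<phi> \<Longrightarrow> S' \<subseteq> S \<Longrightarrow> smooth_on S' \<phi>"
  unfolding smooth_on_def by (meson order_trans subsetD)

lemma smooth_on_continuous:
  assumes "smooth_on S \<phi>"
  shows "continuous_on S \<phi>"
proof -
  obtain W F where "S \<subseteq> W" "Ck_on 0 W F" "\<And>p. p \<in> S \<Longrightarrow> F p = \<phi> p"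
    using assms unfolding smooth_on_def by blast
  then show ?thesis by (metis Ck_on.simps(1) continuous_on_cong continuous_on_subset)
qed

lemma is_solution_restrict:
  assumes J: "J \<inter> {..<T} = {0..<T}" and sol: "is_solution P J \<gamma>x \<gamma>u"
  shows "is_solution P {0..<T} \<gamma>x \<gamma>u"
proof -
  have sub: "{0..<T} \<subseteq> J" using J by auto
  define M where "M = {0..1::real} \<times> {0..<T}"
  define M' where "M' = {0..1::real} \<times> J"
  note pd = pd_restrict[OF J, folded M_def M'_def]
  have j1: "sec_j1 M \<gamma>x \<gamma>u p = sec_j1 M' \<gamma>x \<gamma>u p" if "p \<in> M" for p
    unfolding sec_j1_def by (simp add: pd[OF that])
  have pp: "pd_z M (pd_z M' F) p = pd_z M (pd_z M F) p" "pd_t M (pd_z M' F) p = pd_t M (pd_z M F) p"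
    "pd_t M (pd_t M' F) p = pd_t M (pd_t M F) p" if "p \<in> M" for p and F :: "real \<times> real \<Rightarrow> 'c::real_normed_vector"
    by (rule pd_cong[OF that], rule pd, assumption)+
  have j2: "sec_j2 M \<gamma>x \<gamma>u p = sec_j2 M' \<gamma>x \<gamma>u p" if "p \<in> M" for p
    unfolding sec_j2_def j1[OF that] by (simp add: pd[OF that] pp[OF that])
  have MM: "M \<subseteq> M'" unfolding M_def M'_def using sub by auto
  show ?thesis
    unfolding is_solution_def M_def[symmetric]
  proof (intro conjI ballI)
    note s = sol[unfolded is_solution_def, folded M'_def]
    show "smooth_on M \<gamma>x" "smooth_on M \<gamma>u" using s smooth_on_subset[OF _ MM] by blast+
    show "(z, t, \<gamma>x (z, t), \<gamma>u (z, t)) \<in> total_space P" if "z \<in> {0..1}" "t \<in> {0..<T}" for z t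
      using s sub that by blast
    show "sec_j2 M \<gamma>x \<gamma>u (z, t) \<in> S2 P" if "z \<in> {0<..<1}" "t \<in> {0..<T}" for z t
      using s sub that j2[of "(z, t)"] unfolding M_def by auto
    show "on_bjet (bcA P l) (snd (sec_j1 M \<gamma>x \<gamma>u (0, t))) = 0" if "t \<in> {0..<T}" "l \<in> {1..nA P}" for t l
      using s sub that j1[of "(0, t)"] unfolding M_def by auto
    show "on_bjet (bcB P l) (snd (sec_j1 M \<gamma>x \<gamma>u (1, t))) = 0" if "t \<in> {0..<T}" "l \<in> {1..nB P}" for t l
      using s sub that j1[of "(1, t)"] unfolding M_def by auto
  qed
qed

lemma has_data_restrict: "has_data J \<gamma>x \<gamma>u \<xi> u \<Longrightarrow> J' \<subseteq> J \<Longrightarrow> has_data J' \<gamma>x \<gamma>u \<xi> u"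
  unfolding has_data_def by blast

section \<open>Transport of solutions by the symmetry flow\<close>

text \<open>\<open>V\<close> is Lipschitz near a point where the curves meet, so their difference
  satisfies the local inequality of \<open>zero_propagation\<close>.\<close>

lemma (in symmetric_system) integral_curve_unique:
  assumes W: "\<And>s. s \<in> {a..b} \<Longrightarrow> (z, t, y1 s, u) \<in> W" "\<And>s. s \<in> {a..b} \<Longrightarrow> (z, t, y2 s, u) \<in> W"
    and der: "\<And>s. s \<in> {a..b} \<Longrightarrow> (y1 has_vector_derivative V (z, t, y1 s, u)) (at s within {a..b})"
      "\<And>s. s \<in> {a..b} \<Longrightarrow> (y2 has_vector_derivative V (z, t, y2 s, u)) (at s within {a..b})"
    and s: "s0 \<in> {a..b}" "y1 s0 = y2 s0" "s \<in> {a..b}"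
  shows "y1 s = y2 s"
proof -
  have cont: "continuous_on {a..b} y1" "continuous_on {a..b} y2"
    using der has_vector_derivative_continuous continuous_on_eq_continuous_within by blast+
  have "y1 s - y2 s = 0"
  proof (rule zero_propagation[where e = "\<lambda>s. y1 s - y2 s" and e' = "\<lambda>s. V (z, t, y1 s, u) - V (z, t, y2 s, u)", OF _ _ s(1) _ s(3)])
    show "((\<lambda>s. y1 s - y2 s) has_vector_derivative V (z, t, y1 s, u) - V (z, t, y2 s, u)) (at s within {a..b})"
      if "s \<in> {a..b}" for s by (intro has_vector_derivative_diff der that)
    fix r assume r: "r \<in> {a..b}" "y1 r - y2 r = 0"
    define p where "p = (z, t, y1 r, u)"
    have p: "p \<in> W" unfolding p_def by (rule W(1)[OF r(1)])
    have V1: "Ck_on (Suc 0) W V" by (rule V_smooth)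
    have "\<exists>d>0. \<forall>x y. norm (x - p) < d \<longrightarrow> norm (y - p) < d \<longrightarrow> norm (V y - V x - D V p (y - x)) \<le> 1 * norm (y - x)"
      by (rule uniform_differentiability[OF compact_sing open_W _ V1 zero_less_one, of p]) (use p in \<open>simp, meson insertI1\<close>)
    then obtain d where d: "d > 0" "\<And>x y. norm (x - p) < d \<Longrightarrow> norm (y - p) < d \<Longrightarrow> norm (V y - V x - D V p (y - x)) \<le> 1 * norm (y - x)"
      by blast
    obtain B where B: "\<And>w. norm (D V p w) \<le> norm w * B"
      using bounded_linear.bounded[OF linear_conv_bounded_linear[THEN iffD1, OF Ck_on_linear_D[OF V1 p]]] by blast
    obtain d1 where d1: "d1 > 0" "\<And>s. s \<in> {a..b} \<Longrightarrow> \<bar>s - r\<bar> < d1 \<Longrightarrow> norm (y1 s - y1 r) < d"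
      using cont(1) r(1) d(1) unfolding continuous_on_iff dist_norm real_norm_def by meson
    obtain d2 where d2: "d2 > 0" "\<And>s. s \<in> {a..b} \<Longrightarrow> \<bar>s - r\<bar> < d2 \<Longrightarrow> norm (y2 s - y2 r) < d"
      using cont(2) r(1) d(1) unfolding continuous_on_iff dist_norm real_norm_def by meson
    have "norm (V (z, t, y1 s, u) - V (z, t, y2 s, u)) \<le> (1 + B) * norm (y1 s - y2 s)"
      if s: "s \<in> {a..b}" "\<bar>s - r\<bar> < min d1 d2" for s
    proof -
      define w :: "'n pt" where "w = (0, 0, y1 s - y2 s, 0)"
      have "norm ((z, t, y2 s, u) - p) < d" "norm ((z, t, y1 s, u) - p) < d"
        using d1(2)[OF s(1)] d2(2)[OF s(1)] s(2) r(2) unfolding p_def by (auto simp: norm_Pair)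
      from d(2)[OF this] have 1: "norm (V (z, t, y1 s, u) - V (z, t, y2 s, u) - D V p w) \<le> norm w" unfolding w_def by simp
      have w: "norm w = norm (y1 s - y2 s)" unfolding w_def by (simp add: norm_Pair)
      have "norm (V (z, t, y1 s, u) - V (z, t, y2 s, u)) \<le> norm (D V p w) + norm w"
        using norm_triangle_sub[of "V (z, t, y1 s, u) - V (z, t, y2 s, u)" "D V p w"] 1 by linarith
      then show ?thesis using B[of w] unfolding w by (simp add: algebra_simps)
    qed
    then show "\<exists>L \<rho>. 0 < \<rho> \<and> (\<forall>s\<in>{a..b}. \<bar>s - r\<bar> < \<rho> \<longrightarrow>
        norm (V (z, t, y1 s, u) - V (z, t, y2 s, u)) \<le> L * norm (y1 s - y2 s))"
      using d1(1) d2(1) by (subst ex_comm, intro exI[of _ "min d1 d2"] exI[of _ "1 + B"]) auto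
  qed (use s in auto)
  then show ?thesis by simp
qed

locale well_posed_symmetric = symmetric_system P v W V Wf f
  for P :: "('n::finite) pde_sys" and v W V Wf f +
  fixes Inp :: "(real \<Rightarrow> real) set"
  assumes reg: "regular_system P" and wp: "well_posed P Inp"
    and input_indep: "\<And>z x u. (z, 0, x, u) \<in> total_space P \<Longrightarrow>
           frechet_derivative v (at (z, 0, x, u) within total_space P) (0, 0, 0, 1) = 0"
    and lieA: "\<forall>l\<in>{1..nA P}. \<forall>b\<in>S1A P. lie (bjets P 0) (j1_at P v 0) (on_bjet (bcA P l)) b = 0"
    and lieB: "\<forall>m\<in>{1..nB P}. \<forall>b\<in>S1B P. lie (bjets P 1) (j1_at P v 1) (on_bjet (bcB P m)) b = 0"
    and lieC: "\<forall>b\<in>bjets P (z_out P). lie (bjets P (z_out P)) (j1_at P v (z_out P)) (on_bjet (out_fun P)) b = 0"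
begin

lemma flow_transport:
  assumes box: "flow_box \<delta> N X" and T: "T > 0" and sol: "is_solution P {0..<T} \<gamma>x \<gamma>u"
    and N: "\<And>z t. z \<in> {0..1} \<Longrightarrow> t \<in> {0..<T} \<Longrightarrow> (z, t, \<gamma>x (z, t), \<gamma>u (z, t)) \<in> N"
    and r: "r \<in> {-\<delta><..<\<delta>}"
  defines "\<Gamma> \<equiv> \<lambda>q. X (r, fst q, snd q, \<gamma>x q, \<gamma>u q)"
  shows "is_solution P {0..<T} \<Gamma> \<gamma>u"
    and "t \<in> {0..<T} \<Longrightarrow> out_fun P (t, \<Gamma> (z_out P, t), pd_z ({0..1} \<times> {0..<T}) \<Gamma> (z_out P, t)) =
      out_fun P (t, \<gamma>x (z_out P, t), pd_z ({0..1} \<times> {0..<T}) \<gamma>x (z_out P, t))"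
proof -
  define M where "M = {0..1::real} \<times> {0..<T}"
  have "smooth_on M \<gamma>x" "smooth_on M \<gamma>u" using sol unfolding is_solution_def M_def by auto
  then obtain W1 x' W2 u' where W1: "open W1" "M \<subseteq> W1" "\<And>k. Ck_on k W1 x'" "\<And>p. p \<in> M \<Longrightarrow> x' p = \<gamma>x p"
    and W2: "open W2" "M \<subseteq> W2" "\<And>k. Ck_on k W2 u'" "\<And>p. p \<in> M \<Longrightarrow> u' p = \<gamma>u p"
    unfolding smooth_on_def by blast
  define g where "g q = (fst q, snd q, x' q, u' q)" for q
  \<comment> \<open>Shrinking the common domain of the extensions keeps the extended graph inside
    the flow box.\<close>
  define U where "U = (W1 \<inter> W2) \<inter> g -` N"
  have openN: "open N" using box unfolding flow_box_def by blast
  have "continuous_on (W1 \<inter> W2) g" unfolding g_def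
    by (intro continuous_intros continuous_on_subset[OF Ck_on_imp_continuous_on[OF W1(3)[of 0]]]
        continuous_on_subset[OF Ck_on_imp_continuous_on[OF W2(3)[of 0]]]) auto
  then have U: "open U" unfolding U_def using W1 W2 openN by (intro continuous_open_preimage) auto
  have gN: "g q \<in> N" if "q \<in> M" for q
    using N[of "fst q" "snd q"] that W1(4)[OF that] W2(4)[OF that] unfolding g_def M_def by auto
  interpret ts: transformed_section P v W V Wf f \<delta> T N X \<gamma>x x' \<gamma>u u' U
  proof unfold_locales
    show "{0..1} \<times> {0..<T} \<subseteq> U" unfolding M_def[symmetric] U_def using W1 W2 gN by blast
    show "Ck_on k U x'" for k by (rule Ck_on_subset[OF W1(3)]) (auto simp: U_def)
    show "Ck_on k U u'" for k by (rule Ck_on_subset[OF W2(3)]) (auto simp: U_def)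
    show "(fst q, snd q, x' q, u' q) \<in> N" if "q \<in> U" for q using that unfolding U_def g_def by auto
  qed (use box T U sol W1 W2 in \<open>auto simp: M_def\<close>)
  have \<Gamma>: "\<Gamma> = ts.\<Gamma> r" unfolding \<Gamma>_def ts.\<Gamma>_def by auto
  show "is_solution P {0..<T} \<Gamma> \<gamma>u" unfolding \<Gamma> by (rule ts.transformed_solution[OF reg lieA lieB r])
  show "out_fun P (t, \<Gamma> (z_out P, t), pd_z ({0..1} \<times> {0..<T}) \<Gamma> (z_out P, t)) =
      out_fun P (t, \<gamma>x (z_out P, t), pd_z ({0..1} \<times> {0..<T}) \<gamma>x (z_out P, t))" if t: "t \<in> {0..<T}"
  proof -
    have zo: "z_out P \<in> {0..1}" and "smooth_on {(t, x, xz). \<exists>u. (z_out P, t, x, u) \<in> total_space P} (out_fun P)"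
      using reg unfolding regular_system_def by blast+
    then obtain Wg g where Wg: "open Wg" "\<And>k. Ck_on k Wg g"
      and sub: "{(t, x, xz). \<exists>u. (z_out P, t, x, u) \<in> total_space P} \<subseteq> Wg"
      and eq: "\<forall>p\<in>{(t, x, xz). \<exists>u. (z_out P, t, x, u) \<in> total_space P}. g p = out_fun P p"
      unfolding smooth_on_def by blast
    have ext: "(t, x, xz) \<in> Wg \<and> g (t, x, xz) = out_fun P (t, x, xz)" if "(z_out P, t, x, u) \<in> total_space P" for t x xz u
    proof -
      have "(t, x, xz) \<in> {(t, x, xz). \<exists>u. (z_out P, t, x, u) \<in> total_space P}" using that by auto
      then show ?thesis using sub eq by blast
    qed
    show ?thesis unfolding \<Gamma>
      by (rule ts.output_invariant[OF r zo t Wg(1) Wg(2) ext bspec[OF lieC]])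
  qed
qed

section \<open>Initial profiles and the input at t = 0\<close>

lemma E_product: "(z, 0, x, u) \<in> total_space P \<Longrightarrow> (z', 0, x', u') \<in> total_space P \<Longrightarrow> (z, 0, x, u') \<in> total_space P"
  using reg unfolding regular_system_def is_bundle_def by metis

text \<open>Condition 1 gives a vanishing derivative in \<open>u\<close>; the admissible input
  values at \<open>t = 0\<close> form an interval, so this yields constancy.\<close>

lemma V_input_indep:
  assumes "(z, 0, x, u) \<in> total_space P" "(z, 0, x, u') \<in> total_space P"
  shows "V (z, 0, x, u) = V (z, 0, x, u')"
proof -
  obtain A B where B: "is_interval B" "\<And>z x u. (z, 0, x, u) \<in> total_space P \<longleftrightarrow> (z, x) \<in> A \<and> u \<in> B"
    using reg unfolding regular_system_def is_bundle_def by blast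
  have "((\<lambda>u. V (z, 0, x, u)) has_vector_derivative 0) (at u within B)" if "u \<in> B" for u
  proof -
    have E: "(z, 0, x, u) \<in> total_space P" using that assms(1) B(2) by blast
    have d: "(V has_derivative D V (z, 0, x, u)) (at (z, 0, x, u))"
      by (rule Ck_on_has_derivative[OF V_smooth E_W[OF E]])
    have "frechet_derivative v (at (z, 0, x, u) within total_space P) = D V (z, 0, x, u)"
      by (rule thick_derivative[OF thick_E E d V_eq])
    then have "D V (z, 0, x, u) (0, 0, 0, 1) = 0" using input_indep[OF E] by simp
    moreover have zu: "((\<lambda>u. (z, 0::real, x, u)) has_vector_derivative (0, 0, 0, 1)) (at u within B)"
      by (intro has_vector_derivative_Pair has_vector_derivative_const has_vector_derivative_id)
    ultimately show ?thesis using has_vector_derivative_chain[OF zu d] by simp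
  qed
  then obtain c where "\<And>u. u \<in> B \<Longrightarrow> V (z, 0, x, u) = c"
    using has_vector_derivative_zero_constant[OF is_interval_convex[OF B(1)], of "\<lambda>u. V (z, 0, x, u)"] by blast
  then show ?thesis using assms B(2) by metis
qed

lemma initial_E:
  assumes "\<xi> \<in> initial_conditions P Inp" "u \<in> Inp" "z \<in> {0..1}"
  shows "(z, 0, \<xi> z, u 0) \<in> total_space P"
proof -
  obtain T \<gamma>x \<gamma>u where "T > 0" "is_solution P {0..<T} \<gamma>x \<gamma>u" "has_data {0..<T} \<gamma>x \<gamma>u \<xi> u"
    using assms unfolding initial_conditions_def by blast
  moreover then have "(z, 0, \<gamma>x (z, 0), \<gamma>u (z, 0)) \<in> total_space P" using assms(3) unfolding is_solution_def by auto
  ultimately show ?thesis using assms(3) unfolding has_data_def by auto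
qed

text \<open>By condition 1 of the theorem the choice of the input \<open>u0\<close> does not matter at \<open>t = 0\<close>.\<close>

definition profile_flow :: "(real \<Rightarrow> real) \<Rightarrow> real \<Rightarrow> (real \<Rightarrow> real \<Rightarrow> real^'n) \<Rightarrow> bool" where
  "profile_flow u0 \<delta> \<Xi> \<longleftrightarrow> \<delta> > 0 \<and>
     (\<forall>s\<in>{-\<delta><..<\<delta>}. \<forall>z\<in>{0..1}. (z, 0, \<Xi> s z, u0 0) \<in> total_space P \<and>
        ((\<lambda>s. \<Xi> s z) has_vector_derivative V (z, 0, \<Xi> s z, u0 0)) (at s)) \<and>
     (\<exists>Oz F. open Oz \<and> {0..1} \<subseteq> Oz \<and> (\<forall>k. Ck_on k ({-\<delta><..<\<delta>} \<times> Oz) F) \<and>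
        (\<forall>s\<in>{-\<delta><..<\<delta>}. \<forall>z\<in>{0..1}. F (s, z) = \<Xi> s z))"

lemma profile_flow_exists:
  assumes \<xi>: "\<xi> \<in> initial_conditions P Inp" and u0: "u0 \<in> Inp"
  shows "\<exists>\<delta> \<Xi>. profile_flow u0 \<delta> \<Xi> \<and> (\<forall>z\<in>{0..1}. \<Xi> 0 z = \<xi> z)"
proof -
  have sm: "smooth_on {0..1} \<xi>" using \<xi> unfolding initial_conditions_def by blast
  define g0 where "g0 z = (z, 0::real, \<xi> z, u0 0)" for z
  have "compact (g0 ` {0..1})" unfolding g0_def
    by (intro compact_continuous_image continuous_intros smooth_on_continuous[OF sm]) auto
  moreover have "g0 ` {0..1} \<subseteq> W" unfolding g0_def using initial_E[OF \<xi> u0] E_W by blast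
  ultimately obtain \<delta> N X where box: "flow_box \<delta> N X" and N: "g0 ` {0..1} \<subseteq> N"
    using flow_box_exists by blast
  have g0N: "(z, 0, \<xi> z, u0 0) \<in> N" if "z \<in> {0..1}" for z using N that unfolding g0_def by blast
  define \<Xi> where "\<Xi> s z = X (s, z, 0, \<xi> z, u0 0)" for s z
  obtain W1 \<xi>' where W1: "open W1" "{0..1} \<subseteq> W1" "\<And>k. Ck_on k W1 \<xi>'" "\<And>z. z \<in> {0..1} \<Longrightarrow> \<xi>' z = \<xi> z"
    using sm unfolding smooth_on_def by blast
  define g where "g z = (z, 0::real, \<xi>' z, u0 0)" for z
  define Oz where "Oz = W1 \<inter> g -` N"
  have bx: "\<delta> > 0" "open N" "\<And>k. Ck_on k ({-\<delta><..<\<delta>} \<times> N) X" using box unfolding flow_box_def by auto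
  have "continuous_on W1 g" unfolding g_def
    by (intro continuous_intros Ck_on_imp_continuous_on[OF W1(3)[of 0]])
  then have Oz: "open Oz" unfolding Oz_def using W1 bx by (intro continuous_open_preimage) auto
  have op: "open ({-\<delta><..<\<delta>} \<times> Oz)" "open ({-\<delta><..<\<delta>} \<times> N)" by (intro open_Times Oz bx open_greaterThanLessThan)+
  \<comment> \<open>The extended profile makes the curve smooth jointly in the parameter and
    \<open>z\<close>, which \<open>profile_flow_close\<close> uses for closeness of the
    derivatives.\<close>
  have "Ck_on k ({-\<delta><..<\<delta>} \<times> Oz) (\<lambda>y. X (fst y, snd y, 0, \<xi>' (snd y), u0 0))" for k
  proof (rule Ck_on_compose[OF op _ bx(3)])
    have "Ck_on k ({-\<delta><..<\<delta>} \<times> Oz) (\<lambda>y. \<xi>' (snd y))"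
      by (rule Ck_on_compose[OF op(1) W1(1) Ck_on_bounded_linear_id[OF op(1) bounded_linear_snd] W1(3)])
        (auto simp: Oz_def)
    then show "Ck_on k ({-\<delta><..<\<delta>} \<times> Oz) (\<lambda>y. (fst y, snd y, 0, \<xi>' (snd y), u0 0))"
      by (intro Ck_on_Pair Ck_on_fst Ck_on_snd Ck_on_ident Ck_on_const op)
  qed (auto simp: Oz_def g_def)
  moreover have "{0..1} \<subseteq> Oz" unfolding Oz_def g_def using W1(2,4) g0N by auto
  moreover have "(\<lambda>y. X (fst y, snd y, 0, \<xi>' (snd y), u0 0)) (s, z) = \<Xi> s z" if "z \<in> {0..1}" for s z
    using W1(4)[OF that] unfolding \<Xi>_def by simp
  moreover have "(z, 0, \<Xi> s z, u0 0) \<in> total_space P \<and>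
      ((\<lambda>s. \<Xi> s z) has_vector_derivative V (z, 0, \<Xi> s z, u0 0)) (at s)" if "s \<in> {-\<delta><..<\<delta>}" "z \<in> {0..1}" for s z
    using box g0N[OF that(2)] that unfolding flow_box_def \<Xi>_def E_eq by auto
  ultimately have "profile_flow u0 \<delta> \<Xi>" unfolding profile_flow_def using bx(1) Oz by blast
  moreover have "\<Xi> 0 z = \<xi> z" if "z \<in> {0..1}" for z
    using box g0N[OF that] unfolding flow_box_def \<Xi>_def by blast
  ultimately show ?thesis by blast
qed

section \<open>The curve of initial conditions and its outputs\<close>

context
  fixes u0 \<delta> \<Xi> \<epsilon>
  assumes pf: "profile_flow u0 \<delta> \<Xi>" and u0: "u0 \<in> Inp" and \<epsilon>: "0 < \<epsilon>" "\<epsilon> < \<delta>"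
    and \<Xi>0: "\<Xi> 0 \<in> initial_conditions P Inp"
begin

text \<open>\<Xi> was built with the input \<open>u0\<close>, but serves every admissible input: its
  values remain in the domain by the product structure at \<open>t = 0\<close>, and \<open>V\<close>
  takes the same value there.\<close>

lemma \<Xi>_E:
  assumes "s \<in> {-\<delta><..<\<delta>}" "z \<in> {0..1}" "u \<in> Inp"
  shows "(z, 0, \<Xi> s z, u 0) \<in> total_space P" "((\<lambda>s. \<Xi> s z) has_vector_derivative V (z, 0, \<Xi> s z, u 0)) (at s)"
proof -
  have a: "(z, 0, \<Xi> s z, u0 0) \<in> total_space P" "((\<lambda>s. \<Xi> s z) has_vector_derivative V (z, 0, \<Xi> s z, u0 0)) (at s)"
    using pf assms unfolding profile_flow_def by auto
  show b: "(z, 0, \<Xi> s z, u 0) \<in> total_space P"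
    by (rule E_product[OF a(1) initial_E[OF \<Xi>0 assms(3,2)]])
  show "((\<lambda>s. \<Xi> s z) has_vector_derivative V (z, 0, \<Xi> s z, u 0)) (at s)"
    using a(2) V_input_indep[OF a(1) b] by simp
qed

text \<open>Both sides are integral curves of \<open>V\<close> over the same \<open>z\<close> and
  \<open>u 0\<close> that pass through \<open>\<Xi> s1 z\<close>; by uniqueness any flow box
  reproduces the profile curve.\<close>

lemma \<Xi>_step:
  assumes box: "flow_box d N X" and u: "u \<in> Inp" and z: "z \<in> {0..1}"
    and s: "s1 \<in> {-\<delta><..<\<delta>}" "s2 \<in> {-\<delta><..<\<delta>}" "\<bar>s2 - s1\<bar> < d" and N: "(z, 0, \<Xi> s1 z, u 0) \<in> N"
  shows "X (s2 - s1, z, 0, \<Xi> s1 z, u 0) = \<Xi> s2 z"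
proof (rule integral_curve_unique[where a = "min s1 s2" and b = "max s1 s2" and ?s0.0 = s1 and s = s2
      and ?y1.0 = "\<lambda>s. X (s - s1, z, 0, \<Xi> s1 z, u 0)" and ?y2.0 = "\<lambda>s. \<Xi> s z" and z = z and t = 0 and u = "u 0"])
  have bx: "X (0, z, 0, \<Xi> s1 z, u 0) = \<Xi> s1 z"
    "\<And>s. s \<in> {-d<..<d} \<Longrightarrow> (z, 0, X (s, z, 0, \<Xi> s1 z, u 0), u 0) \<in> W"
    "\<And>s. s \<in> {-d<..<d} \<Longrightarrow> ((\<lambda>s. X (s, z, 0, \<Xi> s1 z, u 0)) has_vector_derivative V (z, 0, X (s, z, 0, \<Xi> s1 z, u 0), u 0)) (at s)"
    using box N unfolding flow_box_def by blast+
  show "X (s1 - s1, z, 0, \<Xi> s1 z, u 0) = \<Xi> s1 z" using bx(1) by simp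
  fix s assume "s \<in> {min s1 s2..max s1 s2}"
  then have s': "s \<in> {-\<delta><..<\<delta>}" "s - s1 \<in> {-d<..<d}" using s by auto
  show "(z, 0, X (s - s1, z, 0, \<Xi> s1 z, u 0), u 0) \<in> W" by (rule bx(2)[OF s'(2)])
  show "(z, 0, \<Xi> s z, u 0) \<in> W" by (rule E_W[OF \<Xi>_E(1)[OF s'(1) z u]])
  have "((\<lambda>s. s - s1) has_vector_derivative 1) (at s)" by (auto intro!: derivative_eq_intros)
  from vector_diff_chain_at[OF this bx(3)[OF s'(2)]]
  have "((\<lambda>s. X (s - s1, z, 0, \<Xi> s1 z, u 0)) has_vector_derivative V (z, 0, X (s - s1, z, 0, \<Xi> s1 z, u 0), u 0)) (at s)"
    by (simp add: o_def)
  then show "((\<lambda>s. X (s - s1, z, 0, \<Xi> s1 z, u 0)) has_vector_derivative V (z, 0, X (s - s1, z, 0, \<Xi> s1 z, u 0), u 0))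
      (at s within {min s1 s2..max s1 s2})"
    by (rule has_vector_derivative_at_within)
  show "((\<lambda>s. \<Xi> s z) has_vector_derivative V (z, 0, \<Xi> s z, u 0)) (at s within {min s1 s2..max s1 s2})"
    by (rule has_vector_derivative_at_within[OF \<Xi>_E(2)[OF s'(1) z u]])
qed auto

lemma \<Xi>_joint_continuous: "continuous_on ({-\<delta><..<\<delta>} \<times> {0..1}) (\<lambda>y. \<Xi> (fst y) (snd y))"
proof -
  obtain Oz F where F: "{0..1} \<subseteq> Oz" "Ck_on 0 ({-\<delta><..<\<delta>} \<times> Oz) F"
      "\<And>s z. s \<in> {-\<delta><..<\<delta>} \<Longrightarrow> z \<in> {0..1} \<Longrightarrow> F (s, z) = \<Xi> s z"
    using pf unfolding profile_flow_def by blast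
  have "continuous_on ({-\<delta><..<\<delta>} \<times> {0..1}) F"
    by (rule continuous_on_subset[OF Ck_on_imp_continuous_on[OF F(2)]]) (use F(1) in auto)
  then show ?thesis by (rule continuous_on_eq) (use F(3) in auto)
qed

lemma \<Xi>_smooth:
  assumes "s \<in> {-\<delta><..<\<delta>}"
  shows "smooth_on {0..1} (\<Xi> s)"
proof -
  obtain Oz F where F: "open Oz" "{0..1} \<subseteq> Oz" "\<And>k. Ck_on k ({-\<delta><..<\<delta>} \<times> Oz) F"
      "\<And>s z. s \<in> {-\<delta><..<\<delta>} \<Longrightarrow> z \<in> {0..1} \<Longrightarrow> F (s, z) = \<Xi> s z"
    using pf unfolding profile_flow_def by blast
  have "open ({-\<delta><..<\<delta>} \<times> Oz)" by (intro open_Times F) auto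
  then have "Ck_on k Oz (\<lambda>z. F (s, z))" for k
    by (rule Ck_on_compose[OF F(1) _ _ F(3)]) (use assms in \<open>auto intro!: Ck_on_Pair Ck_on_const Ck_on_ident F\<close>)
  then show ?thesis unfolding smooth_on_def using F(1,2,4) assms by (intro exI[of _ Oz] exI[of _ "\<lambda>z. F (s, z)"]) auto
qed

lemma transported_data:
  assumes box: "flow_box d N X" and u: "u \<in> Inp" and T: "T > 0"
    and s: "s1 \<in> {-\<delta><..<\<delta>}" "s2 \<in> {-\<delta><..<\<delta>}" "\<bar>s2 - s1\<bar> < d"
    and data: "has_data {0..<T} \<gamma>x \<gamma>u (\<Xi> s1) u"
    and N: "\<And>z t. z \<in> {0..1} \<Longrightarrow> t \<in> {0..<T} \<Longrightarrow> (z, t, \<gamma>x (z, t), \<gamma>u (z, t)) \<in> N"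
  shows "has_data {0..<T} (\<lambda>q. X (s2 - s1, fst q, snd q, \<gamma>x q, \<gamma>u q)) \<gamma>u (\<Xi> s2) u"
proof -
  have "X (s2 - s1, z, 0, \<gamma>x (z, 0), \<gamma>u (z, 0)) = \<Xi> s2 z" if z: "z \<in> {0..1}" for z
  proof -
    have "\<gamma>x (z, 0) = \<Xi> s1 z" "\<gamma>u (z, 0) = u 0" using data z T unfolding has_data_def by auto
    then show ?thesis using \<Xi>_step[OF box u z s] N[OF z, of 0] T by simp
  qed
  then show ?thesis using data unfolding has_data_def by simp
qed

text \<open>\<epsilon> is fixed before the input \<open>u\<close>, while the size of a flow box
  depends on \<open>u\<close> and on the profile. For fixed \<open>u\<close> the existence of a
  short-time solution is therefore passed between nearby parameters by connectedness of
  \<open>{0..\<epsilon>}\<close>, with no control of the time \<open>T\<close>.\<close>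

lemma \<Xi>_initial:
  assumes s: "s \<in> {0..\<epsilon>}"
  shows "\<Xi> s \<in> initial_conditions P Inp"
proof -
  have "\<exists>T>0. \<exists>\<gamma>x \<gamma>u. is_solution P {0..<T} \<gamma>x \<gamma>u \<and> has_data {0..<T} \<gamma>x \<gamma>u (\<Xi> s) u" if u: "u \<in> Inp" for u
  proof (rule connected_induction_simple[OF connected_Icc[of 0 \<epsilon>] _ s, of 0 "\<lambda>s. \<exists>T>0. \<exists>\<gamma>x \<gamma>u. is_solution P {0..<T} \<gamma>x \<gamma>u \<and> has_data {0..<T} \<gamma>x \<gamma>u (\<Xi> s) u"])
    show "0 \<in> {0..\<epsilon>}" using \<epsilon> by simp
    show "\<exists>T>0. \<exists>\<gamma>x \<gamma>u. is_solution P {0..<T} \<gamma>x \<gamma>u \<and> has_data {0..<T} \<gamma>x \<gamma>u (\<Xi> 0) u"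
      using \<Xi>0 u unfolding initial_conditions_def by blast
    fix a assume a: "a \<in> {0..\<epsilon>}"
    have aI: "a \<in> {-\<delta><..<\<delta>}" using a \<epsilon> by auto
    define g where "g y = (snd y, 0::real, \<Xi> (fst y) (snd y), u 0)" for y
    have gc: "continuous_on ({-\<delta><..<\<delta>} \<times> {0..1}) g" unfolding g_def
      by (intro continuous_intros \<Xi>_joint_continuous)
    have gK: "compact (g ` ({a} \<times> {0..1}))"
      by (intro compact_continuous_image compact_Times continuous_on_subset[OF gc]) (use aI in auto)
    have gW: "g ` ({a} \<times> {0..1}) \<subseteq> W" unfolding g_def using E_W[OF \<Xi>_E(1)[OF aI _ u]] by auto
    obtain d N X where box: "flow_box d N X" and N: "g ` ({a} \<times> {0..1}) \<subseteq> N"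
      using flow_box_exists[OF gK gW] by blast
    have dN: "d > 0" "open N" using box unfolding flow_box_def by auto
    obtain B where B: "open B" "B \<inter> ({-\<delta><..<\<delta>} \<times> {0..1}) = g -` N \<inter> ({-\<delta><..<\<delta>} \<times> {0..1})"
      using gc[unfolded continuous_on_open_invariant, rule_format, OF dN(2)] by blast
    have "(a, z) \<in> B" if z: "z \<in> {0..1}" for z
    proof -
      have "(a, z) \<in> g -` N \<inter> ({-\<delta><..<\<delta>} \<times> {0..1})" using N z aI by auto
      then show ?thesis unfolding B(2)[symmetric] by simp
    qed
    then have "{a} \<times> {0..1} \<subseteq> B" by auto
    \<comment> \<open>Compactness of \<open>{0..1}\<close> gives a parameter neighbourhood that
      works for all \<open>z\<close> at once.\<close>
    then obtain A where A: "a \<in> A" "open A" "A \<times> {0..1} \<subseteq> B"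
      using Elementary_Topology.tube_lemma[OF compact_Icc[of 0 1] B(1), of a] by blast
    \<comment> \<open>With radius \<open>d / 2\<close> any two parameters in \<open>R\<close> differ
      by less than \<open>d\<close>.\<close>
    define R where "R = {0..\<epsilon>} \<inter> (A \<inter> ball a (d / 2))"
    have RN: "(z, 0, \<Xi> s z, u 0) \<in> N" if "s \<in> R" "z \<in> {0..1}" for s z
    proof -
      have "(s, z) \<in> B \<inter> ({-\<delta><..<\<delta>} \<times> {0..1})" using that A(3) \<epsilon> unfolding R_def by auto
      then show ?thesis unfolding B(2) g_def by simp
    qed
    show "\<exists>R. openin (top_of_set {0..\<epsilon>}) R \<and> a \<in> R \<and> (\<forall>s1\<in>R. \<forall>s2\<in>R.
        (\<exists>T>0. \<exists>\<gamma>x \<gamma>u. is_solution P {0..<T} \<gamma>x \<gamma>u \<and> has_data {0..<T} \<gamma>x \<gamma>u (\<Xi> s1) u) \<longrightarrow>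
        (\<exists>T>0. \<exists>\<gamma>x \<gamma>u. is_solution P {0..<T} \<gamma>x \<gamma>u \<and> has_data {0..<T} \<gamma>x \<gamma>u (\<Xi> s2) u))"
    proof (intro exI[of _ R] conjI ballI impI)
      show "openin (top_of_set {0..\<epsilon>}) R" unfolding R_def using A by (intro openin_open_Int) auto
      show "a \<in> R" unfolding R_def using a A dN by simp
      fix s1 s2 assume s1: "s1 \<in> R" and s2: "s2 \<in> R"
      assume "\<exists>T>0. \<exists>\<gamma>x \<gamma>u. is_solution P {0..<T} \<gamma>x \<gamma>u \<and> has_data {0..<T} \<gamma>x \<gamma>u (\<Xi> s1) u"
      then obtain T \<gamma>x \<gamma>u where T: "T > 0" and sol: "is_solution P {0..<T} \<gamma>x \<gamma>u" and data: "has_data {0..<T} \<gamma>x \<gamma>u (\<Xi> s1) u"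
        by blast
      have "\<bar>a - s1\<bar> < d / 2" "\<bar>a - s2\<bar> < d / 2" using s1 s2 unfolding R_def by (auto simp: dist_real_def)
      then have "\<bar>s2 - s1\<bar> < d" by linarith
      then have s12: "s1 \<in> {-\<delta><..<\<delta>}" "s2 \<in> {-\<delta><..<\<delta>}" "\<bar>s2 - s1\<bar> < d"
        using s1 s2 \<epsilon> unfolding R_def by auto
      \<comment> \<open>Time is put first for the tube lemma, which shortens the time interval until
        the whole graph lies in the flow box.\<close>
      define G where "G y = (snd y, fst y, \<gamma>x (snd y, fst y), \<gamma>u (snd y, fst y))" for y
      have cc: "continuous_on ({0..1} \<times> {0..<T}) \<gamma>x" "continuous_on ({0..1} \<times> {0..<T}) \<gamma>u"
        using sol smooth_on_continuous unfolding is_solution_def by blast+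
      have "continuous_on ({0..<T} \<times> {0..1}) (\<lambda>y. \<gamma>x (snd y, fst y))"
        by (rule continuous_on_compose2[OF cc(1)]) (auto intro!: continuous_intros)
      moreover have "continuous_on ({0..<T} \<times> {0..1}) (\<lambda>y. \<gamma>u (snd y, fst y))"
        by (rule continuous_on_compose2[OF cc(2)]) (auto intro!: continuous_intros)
      ultimately have Gc: "continuous_on ({0..<T} \<times> {0..1}) G" unfolding G_def by (intro continuous_intros)
      obtain B' where B': "open B'" "B' \<inter> ({0..<T} \<times> {0..1}) = G -` N \<inter> ({0..<T} \<times> {0..1})"
        using Gc[unfolded continuous_on_open_invariant, rule_format, OF dN(2)] by blast
      have "(0, z) \<in> B'" if z: "z \<in> {0..1}" for z
      proof -
        have "G (0, z) \<in> N" using RN[OF s1 z] data z T unfolding G_def has_data_def by auto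
        then have "(0, z) \<in> B' \<inter> ({0..<T} \<times> {0..1})" unfolding B'(2) using z T by simp
        then show ?thesis by simp
      qed
      then obtain A' where A': "0 \<in> A'" "open A'" "A' \<times> {0..1} \<subseteq> B'"
        using Elementary_Topology.tube_lemma[OF compact_Icc[of 0 1] B'(1), of 0] by blast
      obtain \<rho> where \<rho>: "\<rho> > 0" "ball 0 \<rho> \<subseteq> A'" using A'(1,2) open_contains_ball by blast
      define T' where "T' = min T \<rho>"
      have T': "T' > 0" "T' \<le> T" "{0..<T} \<inter> {..<T'} = {0..<T'}" unfolding T'_def using T \<rho> by auto
      have GN: "(z, t, \<gamma>x (z, t), \<gamma>u (z, t)) \<in> N" if "z \<in> {0..1}" "t \<in> {0..<T'}" for z t
      proof -
        have "t \<in> A'" using that \<rho>(2) unfolding T'_def by auto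
        then have "(t, z) \<in> B' \<inter> ({0..<T} \<times> {0..1})" using A'(3) that T'(2) by auto
        then show ?thesis unfolding B'(2) G_def by simp
      qed
      have sol': "is_solution P {0..<T'} \<gamma>x \<gamma>u" by (rule is_solution_restrict[OF T'(3) sol])
      have data': "has_data {0..<T'} \<gamma>x \<gamma>u (\<Xi> s1) u" by (rule has_data_restrict[OF data]) (use T' in auto)
      have r: "s2 - s1 \<in> {-d<..<d}" using s12(3) by auto
      show "\<exists>T>0. \<exists>\<gamma>x \<gamma>u. is_solution P {0..<T} \<gamma>x \<gamma>u \<and> has_data {0..<T} \<gamma>x \<gamma>u (\<Xi> s2) u"
        using flow_transport(1)[OF box T'(1) sol' GN r] transported_data[OF box u T'(1) s12 data' GN] T'(1) by blast
    qed
  qed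
  then show ?thesis unfolding initial_conditions_def using \<Xi>_smooth[of s] s \<epsilon> by auto
qed

lemma output_restrict:
  assumes "t \<in> {0..<T}"
  shows "output_of P \<gamma>x \<gamma>u t = out_fun P (t, \<gamma>x (z_out P, t), pd_z ({0..1} \<times> {0..<T}) \<gamma>x (z_out P, t))"
proof -
  have "z_out P \<in> {0..1}" using reg unfolding regular_system_def by blast
  then have "pd_z ({0..1} \<times> {0..}) \<gamma>x (z_out P, t) = pd_z ({0..1} \<times> {0..<T}) \<gamma>x (z_out P, t)"
    by (intro pd_restrict) (use assms in auto)
  then show ?thesis unfolding output_of_def on_bjet_def sec_j1_def by simp
qed

text \<open>\<open>d\<close> is the size of a flow box around the graph over
  \<open>{0..t + 1}\<close>, hence depends on \<open>t\<close> and on the solution. Uniqueness on a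
  finite time interval identifies \<eta> with the transported solution there, which suffices for the
  output at \<open>t\<close>.\<close>

lemma \<Xi>_output_step:
  assumes a: "a \<in> {0..\<epsilon>}" and u: "u \<in> Inp" and t: "t \<ge> 0"
    and sol: "is_solution P {0..} \<gamma>x \<gamma>u" and data: "has_data {0..} \<gamma>x \<gamma>u (\<Xi> a) u"
  shows "\<exists>d>0. \<forall>s\<in>{0..\<epsilon>}. \<bar>s - a\<bar> < d \<longrightarrow> (\<forall>\<eta>x \<eta>u. is_solution P {0..} \<eta>x \<eta>u \<and> has_data {0..} \<eta>x \<eta>u (\<Xi> s) u \<longrightarrow>
    output_of P \<eta>x \<eta>u t = output_of P \<gamma>x \<gamma>u t)"
proof -
  \<comment> \<open>Beyond \<open>t\<close>, so that the output time lies in the half-open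
    interval.\<close>
  define T where "T = t + 1"
  have T: "T > 0" "t \<in> {0..<T}" "{0..} \<inter> {..<T} = {0..<T}" unfolding T_def using t by auto
  define G where "G q = (fst q, snd q, \<gamma>x q, \<gamma>u q)" for q
  have sub: "{0..1::real} \<times> {0..T} \<subseteq> {0..1} \<times> {0..}" by auto
  have "smooth_on ({0..1} \<times> {0..}) \<gamma>x" "smooth_on ({0..1} \<times> {0..}) \<gamma>u"
    using sol unfolding is_solution_def by blast+
  then have cc: "continuous_on ({0..1} \<times> {0..T}) \<gamma>x" "continuous_on ({0..1} \<times> {0..T}) \<gamma>u"
    by (auto intro!: smooth_on_continuous intro: smooth_on_subset[OF _ sub])
  have GK: "compact (G ` ({0..1} \<times> {0..T}))" unfolding G_def
    by (intro compact_continuous_image compact_Times continuous_intros cc) auto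
  have GW: "G ` ({0..1} \<times> {0..T}) \<subseteq> W" unfolding G_def using sol E_W unfolding is_solution_def by auto
  obtain d N X where box: "flow_box d N X" and N: "G ` ({0..1} \<times> {0..T}) \<subseteq> N"
    using flow_box_exists[OF GK GW] by blast
  have d: "d > 0" using box unfolding flow_box_def by auto
  have GN: "(z, t, \<gamma>x (z, t), \<gamma>u (z, t)) \<in> N" if "z \<in> {0..1}" "t \<in> {0..<T}" for z t
  proof -
    have "G (z, t) \<in> N" using N that by (auto simp: image_subset_iff)
    then show ?thesis unfolding G_def by simp
  qed
  have sol': "is_solution P {0..<T} \<gamma>x \<gamma>u" by (rule is_solution_restrict[OF T(3) sol])
  have data': "has_data {0..<T} \<gamma>x \<gamma>u (\<Xi> a) u" by (rule has_data_restrict[OF data]) auto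
  show ?thesis
  proof (intro exI[of _ d] conjI ballI impI allI)
    fix s \<eta>x \<eta>u
    assume s: "s \<in> {0..\<epsilon>}" "\<bar>s - a\<bar> < d" and \<eta>: "is_solution P {0..} \<eta>x \<eta>u \<and> has_data {0..} \<eta>x \<eta>u (\<Xi> s) u"
    have as: "a \<in> {-\<delta><..<\<delta>}" "s \<in> {-\<delta><..<\<delta>}" "\<bar>s - a\<bar> < d" using a s \<epsilon> by auto
    have r: "s - a \<in> {-d<..<d}" using s(2) by auto
    define \<Gamma> where "\<Gamma> = (\<lambda>q. X (s - a, fst q, snd q, \<gamma>x q, \<gamma>u q))"
    have \<Gamma>: "is_solution P {0..<T} \<Gamma> \<gamma>u" "has_data {0..<T} \<Gamma> \<gamma>u (\<Xi> s) u"
      unfolding \<Gamma>_def by (rule flow_transport(1)[OF box T(1) sol' GN r] transported_data[OF box u T(1) as data' GN]; assumption)+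
    have \<eta>': "is_solution P {0..<T} \<eta>x \<eta>u" "has_data {0..<T} \<eta>x \<eta>u (\<Xi> s) u"
      using \<eta> is_solution_restrict[OF T(3)] by (auto elim!: has_data_restrict)
    have eq: "\<eta>x p = \<Gamma> p" if "p \<in> {0..1} \<times> {0..<T}" for p
      using wp \<Xi>_initial[OF s(1)] u T(1) \<eta>' \<Gamma> that unfolding well_posed_def by blast
    have zo: "(z_out P, t) \<in> {0..1} \<times> {0..<T}" using reg T(2) unfolding regular_system_def by auto
    have "output_of P \<eta>x \<eta>u t = out_fun P (t, \<Gamma> (z_out P, t), pd_z ({0..1} \<times> {0..<T}) \<Gamma> (z_out P, t))"
      unfolding output_restrict[OF T(2)] eq[OF zo] using pd_cong(1)[OF zo eq] by simp
    also have "\<dots> = output_of P \<gamma>x \<gamma>u t"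
      unfolding output_restrict[OF T(2)] \<Gamma>_def by (rule flow_transport(2)[OF box T(1) sol' GN r T(2)])
    finally show "output_of P \<eta>x \<eta>u t = output_of P \<gamma>x \<gamma>u t" .
  qed (rule d)
qed

text \<open>Two parameters near \<open>a\<close> are compared through a solution \<zeta> starting at
  \<open>\<Xi> a\<close>, which makes the local step symmetric, as induction over a connected set
  requires.\<close>

lemma \<Xi>_indistinguishable: "indistinguishable P Inp (\<Xi> 0) (\<Xi> \<epsilon>)"
  unfolding indistinguishable_def
proof (intro ballI allI impI)
  fix u \<gamma>x \<gamma>u \<eta>x \<eta>u and t :: real
  assume u: "u \<in> Inp" and t: "0 \<le> t"
    and sols: "is_solution P {0..} \<gamma>x \<gamma>u \<and> has_data {0..} \<gamma>x \<gamma>u (\<Xi> 0) u \<and>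
      is_solution P {0..} \<eta>x \<eta>u \<and> has_data {0..} \<eta>x \<eta>u (\<Xi> \<epsilon>) u"
  define Q where "Q s \<longleftrightarrow> (\<forall>\<eta>x \<eta>u. is_solution P {0..} \<eta>x \<eta>u \<and> has_data {0..} \<eta>x \<eta>u (\<Xi> s) u \<longrightarrow>
    output_of P \<eta>x \<eta>u t = output_of P \<gamma>x \<gamma>u t)" for s
  have "Q \<epsilon>"
  proof (rule connected_induction_simple[OF connected_Icc[of 0 \<epsilon>], of 0 \<epsilon> Q])
    show "0 \<in> {0..\<epsilon>}" "\<epsilon> \<in> {0..\<epsilon>}" using \<epsilon> by auto
    have z: "0 \<in> {0..\<epsilon>}" using \<epsilon> by simp
    have "is_solution P {0..} \<gamma>x \<gamma>u" "has_data {0..} \<gamma>x \<gamma>u (\<Xi> 0) u" using sols by auto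
    from \<Xi>_output_step[OF z u t this] obtain d where "d > 0" "\<forall>s\<in>{0..\<epsilon>}. \<bar>s - 0\<bar> < d \<longrightarrow> Q s"
      unfolding Q_def by blast
    then show "Q 0" using z by simp
    fix a assume a: "a \<in> {0..\<epsilon>}"
    obtain \<zeta>x \<zeta>u where \<zeta>: "is_solution P {0..} \<zeta>x \<zeta>u" "has_data {0..} \<zeta>x \<zeta>u (\<Xi> a) u"
      using wp \<Xi>_initial[OF a] u unfolding well_posed_def by blast
    obtain d where d: "d > 0" "\<And>s \<eta>x \<eta>u. s \<in> {0..\<epsilon>} \<Longrightarrow> \<bar>s - a\<bar> < d \<Longrightarrow> is_solution P {0..} \<eta>x \<eta>u \<Longrightarrow>
        has_data {0..} \<eta>x \<eta>u (\<Xi> s) u \<Longrightarrow> output_of P \<eta>x \<eta>u t = output_of P \<zeta>x \<zeta>u t"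
      using \<Xi>_output_step[OF a u t \<zeta>] by blast
    show "\<exists>R. openin (top_of_set {0..\<epsilon>}) R \<and> a \<in> R \<and> (\<forall>x\<in>R. \<forall>y\<in>R. Q x \<longrightarrow> Q y)"
    proof (intro exI[of _ "{0..\<epsilon>} \<inter> ball a d"] conjI ballI impI)
      fix x y assume x: "x \<in> {0..\<epsilon>} \<inter> ball a d" and y: "y \<in> {0..\<epsilon>} \<inter> ball a d" and Q: "Q x"
      have x': "x \<in> {0..\<epsilon>}" "\<bar>x - a\<bar> < d" and y': "y \<in> {0..\<epsilon>}" "\<bar>y - a\<bar> < d"
        using x y by (auto simp: dist_real_def)
      \<comment> \<open>Existence of a solution at \<open>x\<close> keeps \<open>Q x\<close> from
        being vacuous; through it the output of \<zeta> is compared with that of \<gamma>.\<close>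
      obtain \<theta>x \<theta>u where \<theta>: "is_solution P {0..} \<theta>x \<theta>u" "has_data {0..} \<theta>x \<theta>u (\<Xi> x) u"
        using wp \<Xi>_initial[OF x'(1)] u unfolding well_posed_def by blast
      have "output_of P \<zeta>x \<zeta>u t = output_of P \<gamma>x \<gamma>u t"
        using d(2)[OF x' \<theta>] Q \<theta> unfolding Q_def by metis
      then show "Q y" unfolding Q_def using d(2)[OF y'] by simp
    qed (use a d in auto)
  qed
  then show "output_of P \<gamma>x \<gamma>u t = output_of P \<eta>x \<eta>u t" unfolding Q_def using sols by simp
qed

end

end

section \<open>Closeness of the transformed profiles\<close>

text \<open>\<open>Ck_close\<close> iterates derivatives within \<open>{0..1}\<close> of functions
  known only there. The function \<open>Fj\<close> is the \<open>j\<close>-th partial derivative of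
  \<open>F\<close> in \<open>z\<close>; quantifying over \<phi> admits any function that agrees with
  \<open>F (s, z)\<close> on the interval.\<close>

lemma iterated_vector_derivative_eq:
  fixes F :: "real \<times> real \<Rightarrow> 'b::real_normed_vector"
  assumes op: "open (A \<times> B)" and B: "{0..1} \<subseteq> B" and F: "\<And>k. Ck_on k (A \<times> B) F"
  shows "\<exists>Fj. (\<forall>k. Ck_on k (A \<times> B) Fj) \<and> (\<forall>s\<in>A. \<forall>\<phi>. (\<forall>z\<in>{0..1}. \<phi> z = F (s, z)) \<longrightarrow>
    (\<forall>z\<in>{0..1}. ((\<lambda>\<phi> z. vector_derivative \<phi> (at z within {0..1})) ^^ j) \<phi> z = Fj (s, z)))"
proof (induction j)
  case 0
  show ?case by (intro exI[of _ F]) (use F in auto)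
next
  case (Suc j)
  then obtain Fj where Fj: "\<And>k. Ck_on k (A \<times> B) Fj"
    and eq: "\<And>s \<phi> z. s \<in> A \<Longrightarrow> \<forall>z\<in>{0..1}. \<phi> z = F (s, z) \<Longrightarrow> z \<in> {0..1} \<Longrightarrow>
      ((\<lambda>\<phi> z. vector_derivative \<phi> (at z within {0..1})) ^^ j) \<phi> z = Fj (s, z)"
    by blast
  define G where "G y = D Fj y (0, 1)" for y
  have G: "Ck_on k (A \<times> B) G" for k unfolding G_def using Ck_on_D[OF Fj] .
  have "((\<lambda>\<phi> z. vector_derivative \<phi> (at z within {0..1})) ^^ Suc j) \<phi> z = G (s, z)"
    if s: "s \<in> A" and \<phi>: "\<forall>z\<in>{0..1}. \<phi> z = F (s, z)" and z: "z \<in> {0..1}" for s \<phi> z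
  proof -
    have dF: "(Fj has_derivative D Fj (s, z)) (at (s, z))"
      by (rule Ck_on_has_derivative[OF Fj]) (use s z B in auto)
    have "((\<lambda>z. (s, z)) has_vector_derivative (0, 1)) (at z within {0..1})"
      by (intro has_vector_derivative_Pair has_vector_derivative_const has_vector_derivative_id)
    from has_vector_derivative_chain[OF this dF]
    have "((\<lambda>z. Fj (s, z)) has_vector_derivative G (s, z)) (at z within {0..1})" unfolding G_def .
    then have "(((\<lambda>\<phi> z. vector_derivative \<phi> (at z within {0..1})) ^^ j) \<phi> has_vector_derivative G (s, z)) (at z within {0..1})"
      by (rule has_vector_derivative_transform[OF z, rotated]) (rule eq[OF s \<phi>])
    then have "vector_derivative (((\<lambda>\<phi> z. vector_derivative \<phi> (at z within {0..1})) ^^ j) \<phi>) (at z within {0..1}) = G (s, z)"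
      using vector_derivative_within_cbox[of 0 1 z] z by auto
    then show ?thesis by simp
  qed
  then show ?case using G by blast
qed

text \<open>Each derivative extends to a function continuous near the compact set
  \<open>{0} \<times> {0..1}\<close>, hence converges uniformly as \<open>s\<close> tends to 0; the
  finitely many orders are combined by a minimum.\<close>

lemma (in well_posed_symmetric) profile_flow_close:
  assumes pf: "profile_flow u0 \<delta> \<Xi>" and e: "e > 0"
  shows "\<exists>d>0. \<forall>s. \<bar>s\<bar> < d \<longrightarrow> Ck_close k e (\<Xi> 0) (\<Xi> s)"
proof -
  obtain Oz F where F: "open Oz" "{0..1} \<subseteq> Oz" "\<And>k. Ck_on k ({-\<delta><..<\<delta>} \<times> Oz) F"
      "\<And>s z. s \<in> {-\<delta><..<\<delta>} \<Longrightarrow> z \<in> {0..1} \<Longrightarrow> F (s, z) = \<Xi> s z" and \<delta>: "\<delta> > 0"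
    using pf unfolding profile_flow_def by blast
  define Dv where "Dv = (\<lambda>(\<phi>::real \<Rightarrow> real^'n) z. vector_derivative \<phi> (at z within {0..1}))"
  have op: "open ({-\<delta><..<\<delta>} \<times> Oz)" by (intro open_Times F) auto
  have "\<exists>d>0. \<forall>s z. \<bar>s\<bar> < d \<longrightarrow> z \<in> {0..1} \<longrightarrow> norm ((Dv ^^ j) (\<Xi> 0) z - (Dv ^^ j) (\<Xi> s) z) < e" for j
  proof -
    obtain Fj where Fj: "Ck_on 0 ({-\<delta><..<\<delta>} \<times> Oz) Fj"
      and eq: "\<And>s \<phi> z. s \<in> {-\<delta><..<\<delta>} \<Longrightarrow> \<forall>z\<in>{0..1}. \<phi> z = F (s, z) \<Longrightarrow> z \<in> {0..1} \<Longrightarrow> (Dv ^^ j) \<phi> z = Fj (s, z)"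
      using iterated_vector_derivative_eq[OF op F(2,3), of j] unfolding Dv_def by blast
    have eq': "(Dv ^^ j) (\<Xi> s) z = Fj (s, z)" if "s \<in> {-\<delta><..<\<delta>}" "z \<in> {0..1}" for s z
      by (rule eq[OF that(1) _ that(2)]) (use F(4)[OF that(1)] in simp)
    have K: "compact ({0::real} \<times> {0..1::real})" "{0} \<times> {0..1} \<subseteq> {-\<delta><..<\<delta>} \<times> Oz"
      using F(2) \<delta> by (auto intro: compact_Times)
    have "\<exists>d>0. \<forall>q\<in>{0} \<times> {0..1}. \<forall>x. norm (x - q) < d \<longrightarrow> x \<in> {-\<delta><..<\<delta>} \<times> Oz \<and> norm (Fj x - Fj q) < e"
      by (rule uniform_continuity_compact[OF K(1) op K(2) Ck_on_imp_continuous_on[OF Fj] e]) meson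
    then obtain d where d: "d > 0" "\<And>z x. z \<in> {0..1} \<Longrightarrow> norm (x - (0, z)) < d \<Longrightarrow> norm (Fj x - Fj (0, z)) < e"
      by auto
    have "norm ((Dv ^^ j) (\<Xi> 0) z - (Dv ^^ j) (\<Xi> s) z) < e" if s: "\<bar>s\<bar> < min d \<delta>" and z: "z \<in> {0..1}" for s z
    proof -
      have "norm (Fj (s, z) - Fj (0, z)) < e" using d(2)[OF z, of "(s, z)"] s by (simp add: norm_Pair)
      moreover have "s \<in> {-\<delta><..<\<delta>}" "0 \<in> {-\<delta><..<\<delta>}" using s \<delta> by auto
      ultimately show ?thesis by (simp add: eq'[OF _ z] norm_minus_commute del: greaterThanLessThan_iff)
    qed
    then show ?thesis using d(1) \<delta> by (intro exI[of _ "min d \<delta>"]) auto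
  qed
  then obtain d where d: "\<And>j. d j > 0"
    "\<And>j s z. \<bar>s\<bar> < d j \<Longrightarrow> z \<in> {0..1} \<Longrightarrow> norm ((Dv ^^ j) (\<Xi> 0) z - (Dv ^^ j) (\<Xi> s) z) < e" by metis
  show ?thesis
  proof (intro exI[of _ "Min (d ` {..k})"] conjI allI impI)
    show "0 < Min (d ` {..k})" using d(1) by simp
    show "Ck_close k e (\<Xi> 0) (\<Xi> s)" if "\<bar>s\<bar> < Min (d ` {..k})" for s
      unfolding Ck_close_def Let_def Dv_def[symmetric] using d(2) that by simp
  qed
qed

section \<open>A nonconstant curve of indistinguishable profiles\<close>

lemma has_vector_derivative_nonzero:
  fixes c :: "real \<Rightarrow> 'b::real_normed_vector"
  assumes "(c has_vector_derivative c') (at 0)" "c' \<noteq> 0"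
  shows "\<exists>d>0. \<forall>s. 0 < s \<and> s < d \<longrightarrow> c s \<noteq> c 0"
proof -
  have "norm c' / 2 > 0" using assms(2) by simp
  then obtain d where d: "d > 0" "\<And>s. norm (s - 0) < d \<Longrightarrow> norm (c s - c 0 - (s - 0) *\<^sub>R c') \<le> norm c' / 2 * norm (s - 0)"
    using assms(1) unfolding has_vector_derivative_def has_derivative_at_alt by blast
  have "c s \<noteq> c 0" if s: "0 < s" "s < d" for s
  proof
    assume "c s = c 0"
    then have "s * norm c' \<le> norm c' / 2 * s" using d(2)[of s] s by simp
    then show False using s assms(2) by simp
  qed
  then show ?thesis using d(1) by blast
qed

lemma (in well_posed_symmetric) not_observable:
  assumes "(z0, 0, x0, w0) \<in> total_space P" "v (z0, 0, x0, w0) \<noteq> 0"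
  shows "\<not> observable P Inp"
proof
  assume obs: "observable P Inp"
  obtain u0 where u0: "u0 \<in> Inp" using wp unfolding well_posed_def by blast
  text \<open>Well-posedness prescribes initial values only at interior points, so \<open>z0\<close> is moved off the boundary.\<close>
  have "\<exists>z\<in>{0<..<1}. (z, 0, x0, w0) \<in> total_space P \<and> V (z, 0, x0, w0) \<noteq> 0"
  proof -
    have z0: "z0 \<in> {0..1}" "(z0, 0, x0, w0) \<in> W" using assms(1) unfolding E_eq by auto
    have "open (W \<inter> V -` (- {0}))"
      by (intro continuous_open_preimage open_W Ck_on_imp_continuous_on[OF V_smooth[of 0]]) auto
    moreover have "(z0, 0, x0, w0) \<in> W \<inter> V -` (- {0})" using assms V_eq z0 by auto
    ultimately obtain r where r: "r > 0" "ball (z0, 0, x0, w0) r \<subseteq> W \<inter> V -` (- {0})"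
      using open_contains_ball by metis
    \<comment> \<open>An inward shift by less than \<open>r\<close> and at most 1/4 ends strictly
      inside the interval.\<close>
    define z where "z = (if z0 \<le> 1/2 then z0 + min (r/2) (1/4) else z0 - min (r/2) (1/4))"
    have z: "z \<in> {0<..<1}" "\<bar>z - z0\<bar> < r" using z0(1) r(1) unfolding z_def by (auto simp: min_def)
    have "(z, 0::real, x0, w0) \<in> ball (z0, 0, x0, w0) r"
      using z(2) by (simp add: dist_norm norm_Pair abs_minus_commute)
    then have "(z, 0, x0, w0) \<in> W \<inter> V -` (- {0})" using r(2) by blast
    then show ?thesis using z(1) unfolding E_eq by auto
  qed
  then obtain z where z: "z \<in> {0<..<1}" and E: "(z, 0, x0, w0) \<in> total_space P" and V0: "V (z, 0, x0, w0) \<noteq> 0" by blast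
  then obtain \<xi> where \<xi>: "\<xi> \<in> initial_conditions P Inp" "\<xi> z = x0"
    using wp unfolding well_posed_def by blast
  obtain \<delta> \<Xi> where pf: "profile_flow u0 \<delta> \<Xi>" and \<Xi>\<xi>: "\<forall>z\<in>{0..1}. \<Xi> 0 z = \<xi> z"
    using profile_flow_exists[OF \<xi>(1) u0] by blast
  have \<delta>: "\<delta> > 0" using pf unfolding profile_flow_def by blast
  \<comment> \<open>\<open>\<Xi> 0\<close> and \<xi> agree on \<open>{0..1}\<close> only, so
    membership is transferred through the definitions.\<close>
  have "smooth_on {0..1} (\<Xi> 0)"
    using \<xi>(1) \<Xi>\<xi> unfolding initial_conditions_def smooth_on_def by auto
  moreover have "has_data J \<gamma>x \<gamma>u (\<Xi> 0) u = has_data J \<gamma>x \<gamma>u \<xi> u" for J \<gamma>x \<gamma>u u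
    using \<Xi>\<xi> unfolding has_data_def by simp
  ultimately have \<Xi>0: "\<Xi> 0 \<in> initial_conditions P Inp"
    using \<xi>(1) unfolding initial_conditions_def by simp
  have z': "z \<in> {0..1}" using z by auto
  have "(z, 0, \<Xi> 0 z, u0 0) \<in> total_space P" and der: "((\<lambda>s. \<Xi> s z) has_vector_derivative V (z, 0, \<Xi> 0 z, u0 0)) (at 0)"
    using pf z' \<delta> unfolding profile_flow_def by auto
  \<comment> \<open>The nonvanishing is known for the input value \<open>w0\<close>; independence of
    the input at \<open>t = 0\<close> transfers it to \<open>u0 0\<close>.\<close>
  then have "V (z, 0, \<Xi> 0 z, u0 0) \<noteq> 0"
    using V_input_indep[OF E, of "u0 0"] V0 \<Xi>\<xi> z' \<xi>(2) by auto
  from has_vector_derivative_nonzero[OF der this]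
  obtain d1 where d1: "d1 > 0" "\<And>s. 0 < s \<Longrightarrow> s < d1 \<Longrightarrow> \<Xi> s z \<noteq> \<Xi> 0 z" by blast
  obtain k e where e: "e > 0" and no: "\<not> (\<exists>\<eta>\<in>initial_conditions P Inp.
      Ck_close k e (\<Xi> 0) \<eta> \<and> (\<exists>z\<in>{0..1}. \<Xi> 0 z \<noteq> \<eta> z) \<and> indistinguishable P Inp (\<Xi> 0) \<eta>)"
    using obs \<Xi>0 unfolding observable_def by blast
  obtain d2 where d2: "d2 > 0" "\<And>s. \<bar>s\<bar> < d2 \<Longrightarrow> Ck_close k e (\<Xi> 0) (\<Xi> s)"
    using profile_flow_close[OF pf e] by blast
  define \<epsilon> where "\<epsilon> = min (min d1 d2) \<delta> / 2"
  have \<epsilon>: "0 < \<epsilon>" "\<epsilon> < \<delta>" "\<epsilon> < d1" "\<epsilon> < d2" unfolding \<epsilon>_def using d1(1) d2(1) \<delta> by auto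
  have "\<Xi> \<epsilon> \<in> initial_conditions P Inp"
    by (rule \<Xi>_initial[OF pf u0 \<epsilon>(1,2) \<Xi>0]) (use \<epsilon> in auto)
  moreover have "indistinguishable P Inp (\<Xi> 0) (\<Xi> \<epsilon>)"
    by (rule \<Xi>_indistinguishable[OF pf u0 \<epsilon>(1,2) \<Xi>0])
  moreover have "Ck_close k e (\<Xi> 0) (\<Xi> \<epsilon>)" using d2(2) \<epsilon> by simp
  moreover have "\<Xi> 0 z \<noteq> \<Xi> \<epsilon> z" using d1(2)[OF \<epsilon>(1,3)] by simp
  ultimately show False using no z' by blast
qed

theorem theorem2:
  fixes P :: "('n::finite) pde_sys" and U :: "(real \<Rightarrow> real) set"
    and v :: "'n pt \<Rightarrow> real^'n"
  assumes "regular_system P"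
    and "well_posed P U"
    and "smooth_on (total_space P) v"
    and "\<forall>z x u. (z, 0, x, u) \<in> total_space P \<longrightarrow>
           frechet_derivative v (at (z, 0, x, u) within total_space P) (0, 0, 0, 1) = 0"
    and "\<exists>z x u. (z, 0, x, u) \<in> total_space P \<and> v (z, 0, x, u) \<noteq> 0"
    and "\<forall>\<alpha>. \<forall>p\<in>S2 P. lie (J2 P) (j2 P v) (pde_fun P \<alpha>) p = 0"
    and "\<forall>l\<in>{1..nA P}. \<forall>b\<in>S1A P. lie (bjets P 0) (j1_at P v 0) (on_bjet (bcA P l)) b = 0"
    and "\<forall>m\<in>{1..nB P}. \<forall>b\<in>S1B P. lie (bjets P 1) (j1_at P v 1) (on_bjet (bcB P m)) b = 0"
    and "\<forall>b\<in>bjets P (z_out P). lie (bjets P (z_out P)) (j1_at P v (z_out P)) (on_bjet (out_fun P)) b = 0"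
  shows "\<not> observable P U"
proof -
  obtain W0 V where V: "open W0" "total_space P \<subseteq> W0" "\<And>k. Ck_on k W0 V" "\<And>p. p \<in> total_space P \<Longrightarrow> V p = v p"
    using assms(3) unfolding smooth_on_def by blast
  have "openin (top_of_set ({0..1} \<times> {0..} \<times> UNIV \<times> UNIV)) (total_space P)"
    using assms(1) unfolding regular_system_def is_bundle_def by blast
  then obtain O' where O': "open O'" "total_space P = ({0..1} \<times> {0..} \<times> UNIV \<times> UNIV) \<inter> O'"
    unfolding openin_open by blast
  have "smooth_on {(z, t, x, xz, xzz, u). (z, t, x, u) \<in> total_space P} (rhs P)"
    using assms(1) unfolding regular_system_def by blast
  then obtain Wf f where f: "open Wf" "\<And>k. Ck_on k Wf f"
    and dom: "{(z, t, x, xz, xzz, u). (z, t, x, u) \<in> total_space P} \<subseteq> Wf"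
    and eq: "\<forall>p\<in>{(z, t, x, xz, xzz, u). (z, t, x, u) \<in> total_space P}. f p = rhs P p"
    unfolding smooth_on_def by blast
  have mem: "(z, t, x, xz, xzz, u) \<in> {(z, t, x, xz, xzz, u). (z, t, x, u) \<in> total_space P}"
    if "(z, t, x, u) \<in> total_space P" for z t x xz xzz u
    using that by simp
  \<comment> \<open>One open set has to serve as the domain of \<open>V\<close> and to cut out the
    total space, hence the intersection.\<close>
  interpret well_posed_symmetric P v "W0 \<inter> O'" V Wf f U
  proof unfold_locales
    show "open (W0 \<inter> O')" using V(1) O'(1) by blast
    show "total_space P = ({0..1} \<times> {0..} \<times> UNIV \<times> UNIV) \<inter> (W0 \<inter> O')" using V(2) O'(2) by blast
    show "Ck_on k (W0 \<inter> O') V" for k by (rule Ck_on_subset[OF V(3)]) blast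
    show "(z, t, x, xz, xzz, u) \<in> Wf" if "(z, t, x, u) \<in> total_space P" for z t x xz xzz u
      using subsetD[OF dom mem[OF that]] .
    show "f (z, t, x, xz, xzz, u) = rhs P (z, t, x, xz, xzz, u)" if "(z, t, x, u) \<in> total_space P" for z t x xz xzz u
      using bspec[OF eq mem[OF that]] .
  qed (use V(4) f assms in \<open>simp_all\<close>)
  show ?thesis using not_observable assms(5) by blast
qed

end
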